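(* Let $\beta$ be an ordinal with $\omega^\omega\le\beta\le\Gamma_0$, let $N$ be the norm on ordinals below $\Gamma_0$ defined in the context, and put $c_\beta(n)=\#\{\alpha<\beta:N(\alpha)=n\}$. If $\beta\ge\varepsilon_0$, assume that $\lim_{n\to\infty}c_\beta(n)/c_\beta(n+1)=\rho$ for some $\rho<1$. Then the segment $\{\alpha:\alpha<\beta\}$ satisfies a monadic second order limit law with respect to $N$: for every monadic second order sentence $\psi$ in the language of linear orders, the limit $$\lim_{n\to\infty}\frac{\#\{\alpha<\beta:\ \alpha\models\psi,\ N(\alpha)=n\}}{\#\{\alpha<\beta:\ N(\alpha)=n\}}$$ exists.
   Context: $\varepsilon_0$ is the least ordinal $\xi$ with $\xi=\omega^\xi$. The Veblen functions are: $\varphi_0(\xi)=\omega^\xi$ and, for $\alpha>0$, $\varphi_\alpha$ enumerates in increasing order the common fixed points of all $\varphi_{\alpha'}$ with $\alpha'<\alpha$. $\Gamma_0$ is the least ordinal $\alpha>0$ with $\varphi_\alpha(0)=\alpha$. The binary fixed point free Veblen function $\bar\varphi$ (below $\Gamma_0$) is given by letting $\eta\mapsto\bar\varphi\alpha\eta$ be the increasing enumeration of $\{\varphi_\alpha(\xi):\xi<\varphi_\alpha(\xi)\}$; every ordinal of the form $\omega^\xi$ below $\Gamma_0$ can be written uniquely as $\bar\varphi\alpha\eta$ with $\alpha,\eta<\Gamma_0$, and then $\alpha,\eta<\bar\varphi\alpha\eta$. The norm $N:\Gamma_0\to\mathbb N$ is defined recursively by $N(0)=0$ and $N(\bar\varphi\alpha\eta+\gamma)=1+N(\alpha)+N(\eta)+N(\gamma)$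 whenever $\bar\varphi\alpha\eta+\gamma$ is in Cantor normal form, i.e. $\gamma=0$ or the leading term of the Cantor normal form of $\gamma$ is at most $\bar\varphi\alpha\eta$. On ordinals below $\varepsilon_0$ this norm is the number of occurrences of $\omega$ in the hereditary Cantor normal form. The monadic second order language of linear orders has a single relation symbol $<$ (no constants, no function symbols); $\alpha\models\psi$ means that the structure $\langle\alpha,<\rangle$, where $\alpha$ is identified with the set of smaller ordinals, satisfies $\psi$, set variables ranging over all subsets of $\alpha$. *)

theory Defs
  imports Complex_Main "HOL-Library.Countable_Set"
begin

section \<open>Countable ordinals\<close>

unbundle cardinal_syntax

text \<open>
  All ordinals that occur are at most \<open>\<Gamma>\<^sub>0\<close>, hence countable.  A countable ordinal is the
  isomorphism type of a well-order on a set of natural numbers, so the type below is \<open>\<omega>\<^sub>1\<close>.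
\<close>

quotient_type ordinal = "nat rel" / partial: "\<lambda>r s. (r, s) \<in> ordIso"
proof (rule part_equivpI)
  have "({} :: nat rel) =o ({} :: nat rel)"
    by (rule ordIso_reflexive) (simp add: order_on_defs Field_def)
  then show "\<exists>r :: nat rel. r =o r" by blast
  show "symp (\<lambda>r s :: nat rel. r =o s)"
    by (auto intro: sympI ordIso_symmetric)
  show "transp (\<lambda>r s :: nat rel. r =o s)"
    by (auto intro: transpI ordIso_transitive)
qed

instantiation ordinal :: linorder
begin

lift_definition less_eq_ordinal :: "ordinal \<Rightarrow> ordinal \<Rightarrow> bool" is "\<lambda>r s. r \<le>o s"
  by (meson ordIso_ordLeq_trans ordIso_symmetric ordLeq_ordIso_trans)

lift_definition less_ordinal :: "ordinal \<Rightarrow> ordinal \<Rightarrow> bool" is "\<lambda>r s. r <o s"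
  by (meson ordIso_ordLess_trans ordIso_symmetric ordLess_ordIso_trans)

lemma ordIso_self_iff: "r =o r \<longleftrightarrow> Well_order r"
  using ordIso_reflexive by (auto simp: ordIso_def)

instance
proof
  fix x y z :: ordinal
  show "x < y \<longleftrightarrow> x \<le> y \<and> \<not> y \<le> x"
    by transfer (auto simp: ordIso_self_iff not_ordLeq_iff_ordLess ordLess_imp_ordLeq)
  show "x \<le> x"
    by transfer (simp add: ordIso_self_iff ordLeq_reflexive)
  show "x \<le> y \<Longrightarrow> y \<le> z \<Longrightarrow> x \<le> z"
    by transfer (rule ordLeq_transitive)
  show "x \<le> y \<Longrightarrow> y \<le> x \<Longrightarrow> x = y"
    by transfer (simp add: ordIso_iff_ordLeq)
  show "x \<le> y \<or> y \<le> x"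
    by transfer (simp add: ordIso_self_iff ordLeq_total)
qed

end

lemma wf_less_ordinal: "wf {(x, y :: ordinal). x < y}"
proof -
  have "{(x, y :: ordinal). x < y} \<subseteq> inv_image ordLess rep_ordinal"
    by (auto simp: less_ordinal.rep_eq)
  with wf_inv_image[OF wf_ordLess] show ?thesis
    by (rule wf_subset)
qed

instance ordinal :: wellorder
proof
  fix P :: "ordinal \<Rightarrow> bool" and a
  assume "\<And>x. (\<And>y. y < x \<Longrightarrow> P y) \<Longrightarrow> P x"
  then show "P a"
    using wf_induct_rule[OF wf_less_ordinal, of P a] by auto
qed

text \<open>
  The supremum is the intended one for bounded sets, which by \<open>countable_bdd_above\<close> below
  includes every countable set.
\<close>

instantiation ordinal :: conditionally_complete_linorder
begin

definition inf_ordinal :: "ordinal \<Rightarrow> ordinal \<Rightarrow> ordinal" where "inf_ordinal = min"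

definition sup_ordinal :: "ordinal \<Rightarrow> ordinal \<Rightarrow> ordinal" where "sup_ordinal = max"

definition Inf_ordinal :: "ordinal set \<Rightarrow> ordinal" where
  "Inf (X :: ordinal set) = (LEAST x. x \<in> X)"

definition Sup_ordinal :: "ordinal set \<Rightarrow> ordinal" where
  "Sup (X :: ordinal set) = (LEAST x. \<forall>y\<in>X. y \<le> x)"

instance
proof
  fix x y z :: ordinal and X :: "ordinal set"
  show "inf x y \<le> x" "inf x y \<le> y" "x \<le> sup x y" "y \<le> sup x y"
    by (auto simp: inf_ordinal_def sup_ordinal_def)
  show "x \<le> y \<Longrightarrow> x \<le> z \<Longrightarrow> x \<le> inf y z" "y \<le> x \<Longrightarrow> z \<le> x \<Longrightarrow> sup y z \<le> x"
    by (auto simp: inf_ordinal_def sup_ordinal_def)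
  show "x \<in> X \<Longrightarrow> Inf X \<le> x"
    by (auto simp: Inf_ordinal_def intro: Least_le)
  show "X \<noteq> {} \<Longrightarrow> (\<And>x. x \<in> X \<Longrightarrow> z \<le> x) \<Longrightarrow> z \<le> Inf X"
    unfolding Inf_ordinal_def by (meson LeastI ex_in_conv)
  show "x \<le> Sup X" if "x \<in> X" "bdd_above X"
  proof -
    have "\<exists>u. \<forall>y\<in>X. y \<le> u" using that by (auto simp: bdd_above_def)
    then have "\<forall>y\<in>X. y \<le> Sup X"
      unfolding Sup_ordinal_def by (rule LeastI_ex)
    then show ?thesis using that by blast
  qed
  show "X \<noteq> {} \<Longrightarrow> (\<And>x. x \<in> X \<Longrightarrow> x \<le> z) \<Longrightarrow> Sup X \<le> z"
    by (auto simp: Sup_ordinal_def intro: Least_le)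
qed

end

lemma Well_order_rep_ordinal: "Well_order (rep_ordinal x)"
  using Quotient_rep_reflp[OF Quotient_ordinal] by (simp add: ordIso_self_iff)

lemma rep_abs_ordinal: "Well_order r \<Longrightarrow> rep_ordinal (abs_ordinal r) =o r"
  using Quotient_rep_abs[OF Quotient_ordinal] by (simp add: ordIso_self_iff)

lemma ordinal_order_Well_order: "Well_order {(x, y :: ordinal). x \<le> y \<and> y \<in> A \<and> x \<in> A}"
proof -
  have "Field {(x, y :: ordinal). x \<le> y \<and> y \<in> A \<and> x \<in> A} = A"
    by (auto simp: Field_def)
  moreover have "wf ({(x, y :: ordinal). x \<le> y \<and> y \<in> A \<and> x \<in> A} - Id)"
    by (rule wf_subset[OF wf_less_ordinal]) auto
  ultimately show ?thesis
    by (auto simp: order_on_defs refl_on_def antisym_def total_on_def intro!: transI)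
qed

text \<open>Every ordinal is the order type of the set of smaller ordinals.\<close>

lemma rep_ordinal_ordIso_lessThan:
  "rep_ordinal a =o {(x, y). x \<le> y \<and> y \<in> {..<a} \<and> x \<in> {..<a}}" (is "?r =o ?R")
proof -
  define h where "h n = abs_ordinal (Restr ?r (underS ?r n))" for n
  have W: "Well_order ?r" by (rule Well_order_rep_ordinal)
  then have WO: "wo_rel ?r" by (simp add: wo_rel_def)
  have Wn: "Well_order (Restr ?r (underS ?r n))" for n
    using W by (rule Well_order_Restr)
  have h: "rep_ordinal (h n) =o Restr ?r (underS ?r n)" for n
    unfolding h_def using Wn by (rule rep_abs_ordinal)
  have F: "Field ?R = {..<a}" by (auto simp: Field_def)
  have below: "h n < a" if "n \<in> Field ?r" for n
    unfolding less_ordinal.rep_eq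
    by (rule ordIso_ordLess_trans[OF h underS_Restr_ordLess[OF W]]) (use that in auto)
  have onto: "\<exists>n\<in>Field ?r. x = h n" if "x < a" for x
  proof -
    have "rep_ordinal x <o ?r" using that by (simp add: less_ordinal.rep_eq)
    then obtain n where "n \<in> Field ?r" and n: "rep_ordinal x =o Restr ?r (underS ?r n)"
      using ordLess_iff_ordIso_Restr[OF W Well_order_rep_ordinal] by blast
    have "x = h n"
      using Quotient_rel_abs[OF Quotient_ordinal n] Quotient_abs_rep[OF Quotient_ordinal]
      by (simp add: h_def)
    with \<open>n \<in> Field ?r\<close> show ?thesis by blast
  qed
  have le: "(m, n) \<in> ?r \<longleftrightarrow> h m \<le> h n" if "m \<in> Field ?r" "n \<in> Field ?r" for m n
  proof -
    have "(m, n) \<in> ?r \<longleftrightarrow> underS ?r m \<subseteq> underS ?r n"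
      using underS_incl_iff[OF wo_rel.LIN[OF WO] that] by blast
    also have "\<dots> \<longleftrightarrow> Restr ?r (underS ?r m) \<le>o Restr ?r (underS ?r n)"
      using ofilter_subset_ordLeq[OF W wo_rel.underS_ofilter[OF WO] wo_rel.underS_ofilter[OF WO]] .
    also have "\<dots> \<longleftrightarrow> h m \<le> h n"
      unfolding less_eq_ordinal.rep_eq
      using ordIso_ordLeq_trans[OF h ordLeq_ordIso_trans[OF _ ordIso_symmetric[OF h]]]
        ordIso_ordLeq_trans[OF ordIso_symmetric[OF h] ordLeq_ordIso_trans[OF _ h]]
      by (rule iffI)
    finally show ?thesis .
  qed
  have "inj_on h (Field ?r)"
    using le wo_rel.ANTISYM[OF WO] by (auto simp: inj_on_def antisym_def)
  then have "bij_betw h (Field ?r) (Field ?R)"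
    unfolding F bij_betw_def using below onto by blast
  then have "iso ?r ?R h"
    unfolding iso_iff2 using le below by auto
  then show ?thesis
    using W ordinal_order_Well_order[of "{..<a}"] by (auto simp: ordIso_def)
qed

lemma countable_lessThan_ordinal: "countable {..<a :: ordinal}"
proof -
  obtain h :: "nat \<Rightarrow> ordinal" where
    "iso (rep_ordinal a) {(x, y). x \<le> y \<and> y \<in> {..<a} \<and> x \<in> {..<a}} h"
    using rep_ordinal_ordIso_lessThan[of a] by (auto simp: ordIso_def)
  from iso_Field[OF this] have "h ` Field (rep_ordinal a) = {..<a}"
    by (auto simp: Field_def)
  moreover have "countable (h ` Field (rep_ordinal a))"
    by simp
  ultimately show ?thesis by simp
qed

lemma uncountable_ordinal: "uncountable (UNIV :: ordinal set)"
proof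
  assume "countable (UNIV :: ordinal set)"
  then obtain g :: "ordinal \<Rightarrow> nat" where g: "inj g"
    by (auto simp: countable_def)
  let ?O = "{(x, y :: ordinal). x \<le> y}"
  have W: "Well_order ?O"
    using ordinal_order_Well_order[of UNIV] by simp
  have O: "?O =o dir_image ?O g"
    by (rule dir_image_ordIso[OF W]) (use g in \<open>auto simp: inj_on_def\<close>)
  define p where "p = abs_ordinal (dir_image ?O g)"
  have "?O =o rep_ordinal p"
    unfolding p_def
    using ordIso_transitive[OF O] rep_abs_ordinal ordIso_symmetric
      Well_order_dir_image[OF W, of g] g
    by (metis inj_on_subset subset_UNIV)
  also have "rep_ordinal p =o Restr ?O (underS ?O p)"
  proof -
    have "Restr ?O (underS ?O p) = {(x, y). x \<le> y \<and> y \<in> {..<p} \<and> x \<in> {..<p}}"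
      by (auto simp: underS_def)
    then show ?thesis using rep_ordinal_ordIso_lessThan[of p] by simp
  qed
  also have "Restr ?O (underS ?O p) <o ?O"
    by (rule underS_Restr_ordLess[OF W]) (auto simp: Field_def)
  finally show False by (simp add: ordLess_irreflexive)
qed

lemma countable_bdd_above: "countable X \<Longrightarrow> bdd_above (X :: ordinal set)"
proof (rule ccontr)
  assume "countable X" and X: "\<not> bdd_above X"
  have "UNIV \<subseteq> (\<Union>a\<in>X. {..<a})"
    using X by (auto simp: bdd_above_def not_le)
  moreover have "countable (\<Union>a\<in>X. {..<a})"
    using \<open>countable X\<close> countable_lessThan_ordinal by blast
  ultimately show False
    using uncountable_ordinal countable_subset by blast
qed


unbundle no cardinal_syntax


section \<open>Ordinal arithmetic\<close>

text \<open>
  The recursions are the usual ones (zero, successor, limit) written with a single supremum.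
\<close>

instantiation ordinal :: "{zero, one, plus, times}"
begin

definition zero_ordinal :: ordinal where "0 = (LEAST x :: ordinal. True)"

definition osucc :: "ordinal \<Rightarrow> ordinal" where "osucc a = (LEAST x. a < x)"

definition one_ordinal :: ordinal where "1 = osucc 0"

function plus_ordinal :: "ordinal \<Rightarrow> ordinal \<Rightarrow> ordinal" where
  "(a :: ordinal) + b = max a (SUP c\<in>{..<b}. osucc (a + c))"
  by auto
termination
  by (relation "inv_image {(x, y :: ordinal). x < y} snd") (auto intro: wf_less_ordinal)

declare plus_ordinal.simps [simp del]

function times_ordinal :: "ordinal \<Rightarrow> ordinal \<Rightarrow> ordinal" where
  "(a :: ordinal) * b = (SUP c\<in>{..<b}. a * c + a)"
  by auto
termination
  by (relation "inv_image {(x, y :: ordinal). x < y} snd") (auto intro: wf_less_ordinal)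

declare times_ordinal.simps [simp del]

instance ..

end

definition omega :: ordinal where
  "omega = (SUP n :: nat. (osucc ^^ n) 0)"

function omega_pow :: "ordinal \<Rightarrow> ordinal" where
  "omega_pow a = max 1 (SUP c\<in>{..<a}. omega_pow c * omega)"
  by auto
termination
  by (relation "{(x, y :: ordinal). x < y}") (auto simp: wf_less_ordinal)

declare omega_pow.simps [simp del]

definition epsilon0 :: ordinal where
  "epsilon0 = (LEAST x. x = omega_pow x)"

text \<open>
  A list of exponents that gives the Cantor normal form
  \<open>a = \<omega>\<^bsup>e\<^sub>1\<^esup> + \<dots> + \<omega>\<^bsup>e\<^sub>k\<^esup>\<close> with \<open>e\<^sub>1 \<ge> \<dots> \<ge> e\<^sub>k\<close>.
\<close>

definition is_CNF :: "ordinal list \<Rightarrow> ordinal \<Rightarrow> bool" where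
  "is_CNF es a \<longleftrightarrow> sorted_wrt (\<ge>) es \<and> a = foldr (\<lambda>e s. omega_pow e + s) es 0"


section \<open>Veblen functions\<close>

text \<open>The increasing enumeration of a set; meaningful at all arguments for unbounded sets.\<close>

function enum_ord :: "ordinal set \<Rightarrow> ordinal \<Rightarrow> ordinal" where
  "enum_ord A a = (LEAST x. x \<in> A \<and> (\<forall>b<a. enum_ord A b < x))"
  by auto
termination
  by (relation "inv_image {(x, y :: ordinal). x < y} snd") (auto intro: wf_less_ordinal)

declare enum_ord.simps [simp del]

function veblen :: "ordinal \<Rightarrow> ordinal \<Rightarrow> ordinal" where
  "veblen a x =
     (if a = 0 then omega_pow x else enum_ord {y. \<forall>b<a. veblen b y = y} x)"
  by auto
termination
  by (relation "inv_image {(x, y :: ordinal). x < y} fst") (auto intro: wf_less_ordinal)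

declare veblen.simps [simp del]

definition Gamma0 :: ordinal where
  "Gamma0 = (LEAST a. 0 < a \<and> veblen a 0 = a)"

definition veblen_bar :: "ordinal \<Rightarrow> ordinal \<Rightarrow> ordinal" where
  "veblen_bar a = enum_ord {veblen a x | x. x < veblen a x}"


section \<open>The norm\<close>

text \<open>The graph of the norm; the norm is meaningful only below \<open>\<Gamma>\<^sub>0\<close>.\<close>

inductive has_norm :: "ordinal \<Rightarrow> nat \<Rightarrow> bool" where
  zero: "has_norm 0 0"
| step: "has_norm (veblen_bar a x + c) (1 + k + l + m)"
  if "a < Gamma0" "x < Gamma0" "veblen_bar a x + c < Gamma0"
    and "c = 0 \<or> (\<exists>e es. is_CNF (e # es) c \<and> omega_pow e \<le> veblen_bar a x)"
    and "has_norm a k" "has_norm x l" "has_norm c m"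

definition norm_ord :: "ordinal \<Rightarrow> nat" where
  "norm_ord a = (THE n. has_norm a n)"

definition norm_count :: "ordinal \<Rightarrow> nat \<Rightarrow> nat" where
  "norm_count b n = card {a. a < b \<and> norm_ord a = n}"


section \<open>Monadic second order logic of linear orders\<close>

text \<open>Element variables and set variables are two separate sorts, both named by numbers.\<close>

datatype mso =
    Less nat nat
  | Equal nat nat
  | Member nat nat
  | Neg mso
  | Conj mso mso
  | Ex_elem nat mso
  | Ex_set nat mso

fun free_elem :: "mso \<Rightarrow> nat set" where
  "free_elem (Less i j) = {i, j}"
| "free_elem (Equal i j) = {i, j}"
| "free_elem (Member i k) = {i}"
| "free_elem (Neg p) = free_elem p"
| "free_elem (Conj p q) = free_elem p \<union> free_elem q"
| "free_elem (Ex_elem i p) = free_elem p - {i}"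
| "free_elem (Ex_set k p) = free_elem p"

fun free_set :: "mso \<Rightarrow> nat set" where
  "free_set (Less i j) = {}"
| "free_set (Equal i j) = {}"
| "free_set (Member i k) = {k}"
| "free_set (Neg p) = free_set p"
| "free_set (Conj p q) = free_set p \<union> free_set q"
| "free_set (Ex_elem i p) = free_set p"
| "free_set (Ex_set k p) = free_set p - {k}"

definition mso_sentence :: "mso \<Rightarrow> bool" where
  "mso_sentence p \<longleftrightarrow> free_elem p = {} \<and> free_set p = {}"

fun mso_sat ::
    "'a set \<Rightarrow> ('a \<Rightarrow> 'a \<Rightarrow> bool) \<Rightarrow> (nat \<Rightarrow> 'a) \<Rightarrow> (nat \<Rightarrow> 'a set) \<Rightarrow> mso \<Rightarrow> bool" where
  "mso_sat D R v V (Less i j) \<longleftrightarrow> R (v i) (v j)"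
| "mso_sat D R v V (Equal i j) \<longleftrightarrow> v i = v j"
| "mso_sat D R v V (Member i k) \<longleftrightarrow> v i \<in> V k"
| "mso_sat D R v V (Neg p) \<longleftrightarrow> \<not> mso_sat D R v V p"
| "mso_sat D R v V (Conj p q) \<longleftrightarrow> mso_sat D R v V p \<and> mso_sat D R v V q"
| "mso_sat D R v V (Ex_elem i p) \<longleftrightarrow> (\<exists>d\<in>D. mso_sat D R (v(i := d)) V p)"
| "mso_sat D R v V (Ex_set k p) \<longleftrightarrow> (\<exists>S\<subseteq>D. mso_sat D R v (V(k := S)) p)"

lemma mso_sat_cong:
  assumes "\<And>i. i \<in> free_elem p \<Longrightarrow> v i = v' i" "\<And>k. k \<in> free_set p \<Longrightarrow> V k = V' k"
  shows "mso_sat D R v V p \<longleftrightarrow> mso_sat D R v' V' p"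
  using assms
proof (induction p arbitrary: v v' V V')
  case (Ex_elem i p)
  have "mso_sat D R (v(i := d)) V p \<longleftrightarrow> mso_sat D R (v'(i := d)) V' p" for d
    by (rule Ex_elem.IH) (use Ex_elem.prems in auto)
  then show ?case by simp
next
  case (Ex_set k p)
  have "mso_sat D R v (V(k := S)) p \<longleftrightarrow> mso_sat D R v' (V'(k := S)) p" for S
    by (rule Ex_set.IH) (use Ex_set.prems in auto)
  then show ?case by simp
next
  case (Neg p)
  have "mso_sat D R v V p \<longleftrightarrow> mso_sat D R v' V' p"
    by (rule Neg.IH) (use Neg.prems in auto)
  then show ?case by simp
next
  case (Conj p q)
  have "mso_sat D R v V p \<longleftrightarrow> mso_sat D R v' V' p"
    by (rule Conj.IH(1)) (use Conj.prems in auto)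
  moreover have "mso_sat D R v V q \<longleftrightarrow> mso_sat D R v' V' q"
    by (rule Conj.IH(2)) (use Conj.prems in auto)
  ultimately show ?case by simp
qed auto

text \<open>
  For a sentence the initial assignment is irrelevant by \<open>mso_sat_cong\<close>, so a fixed one is used;
  this also covers the empty structure \<open>a = 0\<close>.
\<close>

definition ord_models :: "ordinal \<Rightarrow> mso \<Rightarrow> bool" (infix "\<Turnstile>" 50) where
  "a \<Turnstile> p \<longleftrightarrow> mso_sat {..<a} (<) (\<lambda>_. 0) (\<lambda>_. {}) p"

end

theory Submission
  imports Defs "HOL-Library.Multiset" "HOL-Library.FuncSet"
begin

text \<open>
  Cantor normal forms identify ordinals with finite multisets of exponents, and the norm becomes the
  sum of the weights \<open>N(\<omega>\<^sup>e)\<close>, where \<open>\<omega>\<^sup>i\<close> has weight \<open>i + 1\<close>.  By a pigeonhole argument on monadic types,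
  a sentence cannot distinguish the \<open>\<omega>\<^sup>e\<close> with \<open>e \<ge> m\<close>, nor sums of them.  So, apart from the ordinals below
  \<open>\<omega>\<^sup>m\<close>, its truth depends only on the multiplicities of the exponents \<open>0, \<dots>, m - 1\<close>, and for large
  multiplicities only on their residues modulo some \<open>q\<close>.

  If the counting function \<open>c\<close> satisfies \<open>c(n) / c(n + 1) \<longlonglongrightarrow> \<rho> < 1\<close>, every set that fixes these
  multiplicities has a density, and large multiplicities have small density.  Below \<open>\<epsilon>\<^sub>0\<close> the ratio
  tends to \<open>1\<close>: the growth of \<open>c\<close> below \<open>\<omega>\<^sup>\<gamma>\<close> is controlled by that below \<open>\<gamma>\<close> because
  \<open>N(\<omega>\<^sup>e) = 1 + N(e)\<close>.  Then fixed multiplicities have density \<open>0\<close>, and the residues are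
  equidistributed since exchanging \<open>\<omega>\<^bsup>i+j+1\<^esup>\<close> for \<open>\<omega>\<^sup>i + \<omega>\<^sup>j\<close> preserves the norm.
\<close>

section \<open>Ordinal arithmetic and Cantor normal forms\<close>

text \<open>Densities are computed by adding and removing copies of small exponents, which must not
  lead out of the segment. This is guaranteed when beta is a multiple of omega^M. So beta is first
  cut down to the part beta_0 of its normal form with exponents at least M. The ordinals in between
  inject, with their norms, into those below omega^M, a vanishing share. M is 2m + 1 because the
  exchange is applied with i = m and all j < m, and so involves exponents up to 2m. The threshold
  epsilon_0 comes from the equation N(omega^e) = 1 + N(e): it is guaranteed only while no fixed
  point of e -> omega^e is at most e. From epsilon_0 on, the growth of the counting function is
  therefore a hypothesis instead of a consequence. For rho < 1 only finitely many combinations of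
  multiplicities carry all but a small share, and the limit is approximated. For rho = 1 single
  combinations are null, and the residue classes are compared with each other: their shares differ
  by null sequences and add up to 1, which determines them.\<close>

lemma ordinal_zero_le [simp]: "0 \<le> (x :: ordinal)"
  unfolding zero_ordinal_def by (rule Least_le) simp

lemma ordinal_not_less_zero [simp]: "\<not> x < (0 :: ordinal)"
  by (simp add: not_less)

lemma ordinal_le_zero [simp]: "x \<le> 0 \<longleftrightarrow> x = (0 :: ordinal)"
  by (auto intro: order.antisym)

lemma ordinal_pos_iff: "0 < (x :: ordinal) \<longleftrightarrow> x \<noteq> 0"
  by (metis ordinal_le_zero not_le)

text \<open>As \<open>osucc\<close> is a \<open>LEAST\<close>, this needs some ordinal above x. If x
  were the largest, the whole type would consist of x and its countably many predecessors, against
  uncountability.\<close>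

lemma less_osucc: "x < osucc x"
proof -
  have "\<exists>y. x < y"
  proof (rule ccontr)
    assume "\<nexists>y. x < y"
    then have "UNIV \<subseteq> insert x {..<x}" by (auto simp: not_less order.order_iff_strict)
    then show False
      using uncountable_ordinal countable_lessThan_ordinal countable_insert countable_subset by metis
  qed
  then show ?thesis unfolding osucc_def by (rule LeastI_ex)
qed

lemma osucc_le_iff: "osucc x \<le> y \<longleftrightarrow> x < y"
  using less_osucc[of x] by (auto simp: osucc_def Least_le)

lemma less_osucc_iff: "x < osucc y \<longleftrightarrow> x \<le> y"
  by (meson osucc_le_iff not_less)

text \<open>The empty index set is no exception: \<open>Sup\<close> is the least upper bound in the
  whole type, so the empty supremum is 0. Countability supplies boundedness.\<close>

lemma ordinal_SUP_le_iff:
  fixes f :: "'i \<Rightarrow> ordinal"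
  assumes "countable I"
  shows "(SUP i\<in>I. f i) \<le> y \<longleftrightarrow> (\<forall>i\<in>I. f i \<le> y)"
proof (cases "I = {}")
  case True
  have "Sup {} \<le> y" unfolding Sup_ordinal_def by (rule Least_le) simp
  then show ?thesis using True by simp
next
  case False
  then show ?thesis
    using assms by (intro cSUP_le_iff countable_bdd_above) auto
qed

lemma ordinal_less_SUP_iff:
  fixes f :: "'i \<Rightarrow> ordinal"
  assumes "countable I"
  shows "y < (SUP i\<in>I. f i) \<longleftrightarrow> (\<exists>i\<in>I. y < f i)"
  using ordinal_SUP_le_iff[OF assms] by (meson not_less)

text \<open>Turns the recursion for \<open>+\<close> into a description of the initial segment below
  a sum. Equalities of ordinals are then obtained by comparing initial segments, as in
  \<open>ordinal_eqI\<close>.\<close>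

lemma less_plus_iff: "x < a + b \<longleftrightarrow> x < a \<or> (\<exists>c<b. x \<le> a + (c :: ordinal))"
  by (subst plus_ordinal.simps)
    (auto simp: less_max_iff_disj ordinal_less_SUP_iff countable_lessThan_ordinal less_osucc_iff)

lemma plus_le_iff: "a + b \<le> y \<longleftrightarrow> a \<le> y \<and> (\<forall>c<b. a + c < (y :: ordinal))"
  by (metis less_plus_iff not_less)

lemma ordinal_add_strict_mono: "b < c \<Longrightarrow> a + b < a + (c :: ordinal)"
  by (subst less_plus_iff) auto

lemma ordinal_add_less_cancel [simp]: "a + b < a + c \<longleftrightarrow> b < (c :: ordinal)"
  by (metis ordinal_add_strict_mono linorder_cases not_less_iff_gr_or_eq)

lemma ordinal_add_le_cancel [simp]: "a + b \<le> a + c \<longleftrightarrow> b \<le> (c :: ordinal)"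
  by (meson ordinal_add_less_cancel not_less)

lemma ordinal_add_left_cancel [simp]: "a + b = a + c \<longleftrightarrow> b = (c :: ordinal)"
  by (metis ordinal_add_less_cancel linorder_cases not_less_iff_gr_or_eq)

lemma ordinal_le_add1 [simp]: "a \<le> a + (b :: ordinal)"
  using plus_le_iff by blast

lemma ordinal_eqI: "(\<And>z. z < x \<longleftrightarrow> z < y) \<Longrightarrow> x = (y :: ordinal)"
  by (metis less_irrefl linorder_cases)

instance ordinal :: monoid_add
proof
  fix a b c :: ordinal
  show "0 + a = a"
  proof (induction a rule: less_induct)
    case (less a)
    show ?case
      by (rule ordinal_eqI) (use less in \<open>auto simp: less_plus_iff\<close>)
  qed
  show "a + 0 = a"
    by (rule ordinal_eqI) (simp add: less_plus_iff)
  show "a + b + c = a + (b + c)"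
  proof (induction c rule: less_induct)
    case (less c)
    have "x < a + b + c \<longleftrightarrow> x < a + (b + c)" for x
    proof -
      have "x < a + b + c \<longleftrightarrow> x < a \<or> (\<exists>d<b. x \<le> a + d) \<or> (\<exists>d<c. x \<le> a + (b + d))"
        using less by (auto simp: less_plus_iff[of x])
      also have "\<dots> \<longleftrightarrow> x < a \<or> (\<exists>e<b + c. x \<le> a + e)"
        unfolding less_plus_iff[of _ b c]
        by (meson ordinal_add_le_cancel order_refl order_trans)
      finally show ?thesis by (simp add: less_plus_iff[of x a "b + c"])
    qed
    then show ?case by (rule ordinal_eqI)
  qed
qed

lemma ordinal_add_mono_left: "a \<le> b \<Longrightarrow> a + c \<le> b + (c :: ordinal)"
proof (induction c rule: less_induct)
  case (less c)
  have "a + d < b + c" if "d < c" for d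
    using less.IH[OF that less.prems] that by (meson ordinal_add_strict_mono le_less_trans)
  then show ?case using less.prems by (meson plus_le_iff order_trans ordinal_le_add1)
qed

lemma ordinal_add_mono: "a \<le> b \<Longrightarrow> c \<le> d \<Longrightarrow> a + c \<le> b + (d :: ordinal)"
  by (meson ordinal_add_mono_left ordinal_add_le_cancel order_trans)

lemma ordinal_le_add2 [simp]: "b \<le> a + (b :: ordinal)"
  using ordinal_add_mono_left[of 0 a b] by simp

lemma ordinal_le_imp_diff:
  assumes "a \<le> (b :: ordinal)"
  obtains c where "b = a + c"
proof -
  have *: "b \<le> a + (LEAST c. b \<le> a + c)"
    by (rule LeastI[of _ b]) simp
  have "a + (LEAST c. b \<le> a + c) \<le> b"
    using assms not_less_Least by (fastforce simp: plus_le_iff)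
  with * that show thesis by (meson order.antisym)
qed

lemma osucc_eq: "osucc a = a + 1"
proof -
  have one: "c < 1 \<longleftrightarrow> c = 0" for c :: ordinal
    unfolding one_ordinal_def by (simp add: less_osucc_iff)
  have "x < osucc a \<longleftrightarrow> x < a + 1" for x
    unfolding less_plus_iff[of x a 1] less_osucc_iff by (auto simp: one)
  then show ?thesis by (rule ordinal_eqI)
qed

lemma ordinal_less_one_iff [simp]: "x < 1 \<longleftrightarrow> x = (0 :: ordinal)"
  unfolding one_ordinal_def by (simp add: less_osucc_iff)

lemma less_times_iff: "x < a * b \<longleftrightarrow> (\<exists>c<b. x < a * c + (a :: ordinal))"
  by (subst times_ordinal.simps) (auto simp: ordinal_less_SUP_iff countable_lessThan_ordinal)

subsection \<open>Finite ordinals\<close>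

definition fin_ord :: "nat \<Rightarrow> ordinal" where "fin_ord n = (osucc ^^ n) 0"

lemma fin_ord_0 [simp]: "fin_ord 0 = 0"
  by (simp add: fin_ord_def)

lemma fin_ord_Suc: "fin_ord (Suc n) = fin_ord n + 1"
  by (simp add: fin_ord_def osucc_eq)

lemma less_fin_ord_Suc: "x < fin_ord (Suc n) \<longleftrightarrow> x \<le> fin_ord n"
  by (simp add: fin_ord_def less_osucc_iff)

lemma fin_ord_less_Suc: "fin_ord n < fin_ord (Suc n)"
  by (simp add: less_fin_ord_Suc)

lemma strict_mono_fin_ord: "strict_mono fin_ord"
  by (simp add: strict_mono_Suc_iff fin_ord_less_Suc)

lemma fin_ord_less_iff [simp]: "fin_ord m < fin_ord n \<longleftrightarrow> m < n"
  using strict_mono_fin_ord by (simp add: strict_mono_less)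

lemma fin_ord_le_iff [simp]: "fin_ord m \<le> fin_ord n \<longleftrightarrow> m \<le> n"
  using strict_mono_fin_ord by (simp add: strict_mono_less_eq)

lemma less_fin_ord_iff: "x < fin_ord n \<longleftrightarrow> (\<exists>k<n. x = fin_ord k)"
  by (induction n) (auto simp: less_fin_ord_Suc order.order_iff_strict less_Suc_eq)

lemma less_omega_iff: "x < omega \<longleftrightarrow> (\<exists>n. x = fin_ord n)"
  unfolding omega_def fin_ord_def[symmetric]
  by (subst ordinal_less_SUP_iff) (use less_fin_ord_iff fin_ord_less_Suc in blast)+

lemma fin_ord_less_omega [simp]: "fin_ord n < omega"
  using less_omega_iff by blast

subsection \<open>Finite multiples\<close>

primrec ntimes :: "nat \<Rightarrow> ordinal \<Rightarrow> ordinal" where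
  "ntimes 0 a = 0"
| "ntimes (Suc n) a = ntimes n a + a"

lemma ntimes_add: "ntimes (m + n) a = ntimes m a + ntimes n a"
  by (induction n) (simp_all add: add.assoc[symmetric])

lemma ntimes_Suc_left: "ntimes (Suc n) a = a + ntimes n a"
  using ntimes_add[of 1 n a] by simp

lemma ntimes_mono: "a \<le> b \<Longrightarrow> ntimes n a \<le> ntimes n b"
  by (induction n) (auto intro: ordinal_add_mono)

lemma times_fin_ord: "a * fin_ord n = ntimes n a"
proof (induction n rule: less_induct)
  case (less n)
  have "x < a * fin_ord n \<longleftrightarrow> x < ntimes n a" for x
  proof -
    have "x < a * fin_ord n \<longleftrightarrow> (\<exists>k<n. x < ntimes (Suc k) a)"
      by (auto simp: less_times_iff less_fin_ord_iff less)
    also have "\<dots> \<longleftrightarrow> x < ntimes n a"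
    proof
      assume "\<exists>k<n. x < ntimes (Suc k) a"
      then obtain k where k: "k < n" "x < ntimes (Suc k) a" by blast
      have "ntimes n a = ntimes (Suc k) a + ntimes (n - Suc k) a"
        using k by (metis ntimes_add le_add_diff_inverse Suc_leI)
      then show "x < ntimes n a" using k by (metis less_le_trans ordinal_le_add1)
    next
      assume "x < ntimes n a"
      then show "\<exists>k<n. x < ntimes (Suc k) a" by (cases n) auto
    qed
    finally show ?thesis .
  qed
  then show ?case by (rule ordinal_eqI)
qed

lemma less_times_omega_iff: "x < a * omega \<longleftrightarrow> (\<exists>n. x < ntimes n a)"
proof -
  have "x < a * omega \<longleftrightarrow> (\<exists>n. x < ntimes (Suc n) a)"
    by (auto simp: less_times_iff less_omega_iff times_fin_ord)
  also have "\<dots> \<longleftrightarrow> (\<exists>n. x < ntimes n a)"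
    by (metis less_le_trans ordinal_le_add1 ntimes.simps(2))
  finally show ?thesis .
qed

subsection \<open>Powers of \<open>\<omega>\<close>\<close>

lemma less_omega_pow_iff: "x < omega_pow a \<longleftrightarrow> x = 0 \<or> (\<exists>c<a. \<exists>n. x < ntimes n (omega_pow c))"
  by (subst omega_pow.simps)
    (auto simp: less_max_iff_disj ordinal_less_SUP_iff countable_lessThan_ordinal less_times_omega_iff)

lemma omega_pow_pos [simp]: "0 < omega_pow a"
  by (simp add: less_omega_pow_iff)

lemma omega_pow_nonzero [simp]: "omega_pow a \<noteq> 0"
  using omega_pow_pos[of a] unfolding ordinal_pos_iff .

lemma ntimes_omega_pow_less: "c < a \<Longrightarrow> ntimes n (omega_pow c) < omega_pow a"
proof -
  assume "c < a"
  moreover have "ntimes n (omega_pow c) < ntimes (Suc n) (omega_pow c)"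
    using ordinal_add_strict_mono[OF omega_pow_pos] by simp
  ultimately show ?thesis by (subst less_omega_pow_iff) blast
qed

lemma omega_pow_strict_mono: "c < a \<Longrightarrow> omega_pow c < omega_pow a"
  using ntimes_omega_pow_less[of c a 1] by simp

lemma strict_mono_omega_pow: "strict_mono omega_pow"
  by (simp add: strict_mono_def omega_pow_strict_mono)

lemma omega_pow_less_iff [simp]: "omega_pow c < omega_pow a \<longleftrightarrow> c < a"
  using strict_mono_omega_pow by (simp add: strict_mono_less)

lemma omega_pow_le_iff [simp]: "omega_pow c \<le> omega_pow a \<longleftrightarrow> c \<le> a"
  using strict_mono_omega_pow by (simp add: strict_mono_less_eq)

lemma omega_pow_eq_iff [simp]: "omega_pow c = omega_pow a \<longleftrightarrow> c = a"
  using strict_mono_omega_pow by (simp add: strict_mono_eq)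

abbreviation fin_pow :: "nat \<Rightarrow> ordinal" where "fin_pow n \<equiv> omega_pow (fin_ord n)"

lemma omega_pow_0 [simp]: "omega_pow 0 = 1"
  by (rule ordinal_eqI) (simp add: less_omega_pow_iff)

text \<open>Positive ordinals below omega^a lie below finite multiples of smaller powers. With the
  larger of the two exponents, these multiples add up to a finite multiple again.\<close>

lemma omega_pow_add_closed:
  assumes "x < omega_pow a" "y < omega_pow a"
  shows "x + y < omega_pow a"
proof (cases "x = 0 \<or> y = 0")
  case False
  then obtain c n d k where *: "c < a" "x < ntimes n (omega_pow c)" "d < a" "y < ntimes k (omega_pow d)"
    using assms by (auto simp: less_omega_pow_iff)
  define e where "e = max c d"
  have "x \<le> ntimes n (omega_pow e)" "y \<le> ntimes k (omega_pow e)"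
    using * ntimes_mono[of "omega_pow c" "omega_pow e" n] ntimes_mono[of "omega_pow d" "omega_pow e" k]
    by (auto simp: e_def)
  then have "x + y \<le> ntimes (n + k) (omega_pow e)"
    by (simp add: ntimes_add ordinal_add_mono)
  also have "\<dots> < omega_pow a"
    using * by (intro ntimes_omega_pow_less) (auto simp: e_def)
  finally show ?thesis .
qed (use assms in auto)

lemma add_omega_pow_absorb: "x < omega_pow a \<Longrightarrow> x + omega_pow a = omega_pow a"
  by (intro order.antisym) (auto simp: plus_le_iff omega_pow_add_closed)

lemma strict_mono_ordinal_le:
  assumes "strict_mono (f :: ordinal \<Rightarrow> ordinal)"
  shows "x \<le> f x"
proof (induction x rule: less_induct)
  case (less x)
  show ?case
  proof (rule ccontr)
    assume "\<not> x \<le> f x"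
    then have "f x < x" by simp
    with less[of "f x"] assms show False
      by (meson leD strict_monoD)
  qed
qed

lemma le_omega_pow: "a \<le> omega_pow a"
  using strict_mono_ordinal_le[OF strict_mono_omega_pow] .

lemma leading_omega_power:
  assumes "x \<noteq> 0"
  obtains e r where "x = omega_pow e + r" "r < x"
proof -
  define e' where "e' = (LEAST e. x < omega_pow e)"
  have "x < omega_pow (osucc x)"
    using le_omega_pow[of "osucc x"] less_osucc[of x] by simp
  then have "x < omega_pow e'" unfolding e'_def by (rule LeastI)
  with assms obtain c n where c: "c < e'" "x < ntimes n (omega_pow c)"
    by (auto simp: less_omega_pow_iff)
  have "omega_pow c \<le> x"
    using c(1) not_less_Least unfolding e'_def by (metis not_less)
  then obtain r where r: "x = omega_pow c + r" by (rule ordinal_le_imp_diff)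
  \<comment> \<open>Otherwise omega^c + x = x, so every finite multiple of omega^c would be at most
    x, while x lies below one of them.\<close>
  have "r \<noteq> x"
  proof
    assume "r = x"
    have "ntimes k (omega_pow c) + x = x" for k
      by (induction k) (simp_all add: add.assoc r[unfolded \<open>r = x\<close>, symmetric])
    then show False using c(2) by (metis ordinal_le_add1 not_less)
  qed
  moreover have "r \<le> x" unfolding r by simp
  ultimately show thesis using that[OF r] by simp
qed

subsection \<open>Cantor normal forms\<close>

definition cnf :: "ordinal list \<Rightarrow> ordinal" where
  "cnf es = foldr (\<lambda>e s. omega_pow e + s) es 0"

lemma cnf_Nil [simp]: "cnf [] = 0"
  and cnf_Cons [simp]: "cnf (e # es) = omega_pow e + cnf es"
  by (simp_all add: cnf_def)

lemma is_CNF_iff: "is_CNF es a \<longleftrightarrow> sorted_wrt (\<ge>) es \<and> a = cnf es"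
  by (simp add: is_CNF_def cnf_def)

lemma cnf_append: "cnf (xs @ ys) = cnf xs + cnf ys"
  by (induction xs) (simp_all add: add.assoc)

lemma cnf_replicate: "cnf (replicate n e) = ntimes n (omega_pow e)"
  by (induction n) (simp_all add: ntimes_Suc_left del: ntimes.simps(2))

lemma cnf_less_omega_pow: "(\<And>e. e \<in> set es \<Longrightarrow> e < c) \<Longrightarrow> cnf es < omega_pow c"
  by (induction es) (auto intro!: omega_pow_add_closed)

lemma cnf_eq_0_iff [simp]: "cnf es = 0 \<longleftrightarrow> es = []"
proof (cases es)
  case (Cons e r)
  have "0 < omega_pow e + cnf r"
    by (rule less_le_trans[OF omega_pow_pos[of e] ordinal_le_add1])
  then show ?thesis using Cons by (simp add: ordinal_pos_iff)
qed simp

lemma cnf_less_leading: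
  assumes "sorted_wrt (\<ge>) (e # es)"
  shows "cnf (e # es) < omega_pow (osucc e)"
  using assms by (intro cnf_less_omega_pow) (auto simp: less_osucc_iff)

lemma ex_cnf: "\<exists>es. sorted_wrt (\<ge>) es \<and> cnf es = x"
proof (induction x rule: less_induct)
  case (less x)
  show ?case
  proof (cases "x = 0")
    case True
    then show ?thesis by (intro exI[of _ "[]"]) simp
  next
    case False
    then obtain e r where r: "x = omega_pow e + r" "r < x" by (rule leading_omega_power)
    obtain es where es: "sorted_wrt (\<ge>) es" "cnf es = r" using less[OF r(2)] by blast
    have "sorted_wrt (\<ge>) (e # es)"
    proof (cases es)
      case (Cons f fs)
      \<comment> \<open>A larger next exponent would absorb omega^e and make x equal to its
        remainder r, which is smaller.\<close>
      have "f \<le> e"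
      proof (rule ccontr)
        assume "\<not> f \<le> e"
        then have "omega_pow e + cnf (f # fs) = cnf (f # fs)"
          by (simp add: add_omega_pow_absorb flip: add.assoc)
        then show False using r es Cons by simp
      qed
      then show ?thesis using es Cons by auto
    qed simp
    then show ?thesis using es r by (intro exI[of _ "e # es"]) simp
  qed
qed

text \<open>The leading exponent is determined because a nonincreasing sum with leading exponent e
  lies between omega^e and omega^(e+1), the latter excluded. Cancelling that term on the left gives
  the induction.\<close>

lemma cnf_unique:
  "sorted_wrt (\<ge>) xs \<Longrightarrow> sorted_wrt (\<ge>) ys \<Longrightarrow> cnf xs = cnf ys \<Longrightarrow> xs = ys"
proof (induction xs arbitrary: ys)
  case Nil
  then show ?case by (metis cnf_Nil cnf_eq_0_iff)
next
  case (Cons x xs)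
  then have "cnf ys \<noteq> 0" by (metis cnf_eq_0_iff list.distinct(1))
  then obtain y ys' where ys: "ys = y # ys'" by (cases ys) auto
  have le: "a \<le> b" if "cnf (a # as) = cnf (b # bs)" "sorted_wrt (\<ge>) (b # bs)" for a b as bs
  proof -
    have "omega_pow a \<le> cnf (a # as)" by simp
    also have "\<dots> < omega_pow (osucc b)" using that cnf_less_leading by simp
    finally show ?thesis by (simp add: less_osucc_iff)
  qed
  have "x = y"
    using Cons.prems ys le[of x xs y ys'] le[of y ys' x xs] by (simp add: order.antisym)
  then show ?case using Cons ys by simp
qed

section \<open>Ordinals as multisets of exponents\<close>

definition ord_of_mset :: "ordinal multiset \<Rightarrow> ordinal" where
  "ord_of_mset A = cnf (rev (sorted_list_of_multiset A))"

lemma sorted_rev_mset: "sorted_wrt (\<ge>) (rev (sorted_list_of_multiset (A :: ordinal multiset)))"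
  using sorted_sorted_list_of_multiset[of A] by (simp add: sorted_wrt_rev)

lemma ord_of_mset_mset: "sorted_wrt (\<ge>) es \<Longrightarrow> ord_of_mset (mset es) = cnf es"
proof -
  assume "sorted_wrt (\<ge>) es"
  then have "sorted (rev es)" by (simp add: sorted_wrt_rev)
  then have "sorted_list_of_multiset (mset es) = rev es"
    by (metis mset_rev sorted_list_of_multiset_mset sorted_sort_id)
  then show ?thesis by (simp add: ord_of_mset_def)
qed

lemma bij_ord_of_mset: "bij ord_of_mset"
proof (rule bijI)
  show "inj ord_of_mset"
    by (rule injI) (metis ord_of_mset_def cnf_unique sorted_rev_mset mset_rev mset_sorted_list_of_multiset)
  show "surj ord_of_mset"
    by (metis surjI ord_of_mset_mset ex_cnf surj_def)
qed

lemma ord_of_mset_eq_iff [simp]: "ord_of_mset A = ord_of_mset B \<longleftrightarrow> A = B"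
  using bij_ord_of_mset by (metis bij_is_inj injD)

lemma ord_of_mset_empty [simp]: "ord_of_mset {#} = 0"
  by (simp add: ord_of_mset_def)

text \<open>Ordinal addition is union of multisets as long as no term of A is absorbed by a larger
  one of B; the ordering hypothesis excludes absorption.\<close>

lemma ord_of_mset_add:
  assumes "\<And>a b. a \<in># A \<Longrightarrow> b \<in># B \<Longrightarrow> b \<le> a"
  shows "ord_of_mset (A + B) = ord_of_mset A + ord_of_mset B"
proof -
  let ?l = "\<lambda>A :: ordinal multiset. rev (sorted_list_of_multiset A)"
  have "sorted_wrt (\<ge>) (?l A @ ?l B)"
    using assms sorted_rev_mset by (auto simp: sorted_wrt_append)
  from ord_of_mset_mset[OF this] show ?thesis
    by (simp add: cnf_append ord_of_mset_def)
qed

lemma ord_of_mset_replicate: "ord_of_mset (replicate_mset n e) = ntimes n (omega_pow e)"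
proof -
  have "sorted_wrt (\<ge>) (replicate n e)" by (induction n) auto
  from ord_of_mset_mset[OF this] show ?thesis by (simp add: cnf_replicate)
qed

lemma ord_of_mset_less_omega_pow_iff: "ord_of_mset A < omega_pow c \<longleftrightarrow> (\<forall>e\<in>#A. e < c)"
proof
  assume *: "ord_of_mset A < omega_pow c"
  show "\<forall>e\<in>#A. e < c"
  proof
    fix e assume "e \<in># A"
    then obtain xs ys where "rev (sorted_list_of_multiset A) = xs @ e # ys"
      by (metis set_rev set_sorted_list_of_multiset split_list)
    then have "ord_of_mset A = cnf xs + (omega_pow e + cnf ys)"
      by (simp add: ord_of_mset_def cnf_append)
    then have "omega_pow e \<le> ord_of_mset A"
      by (metis ordinal_le_add1 ordinal_le_add2 order_trans)
    then show "e < c" using * by (metis le_less_trans omega_pow_less_iff)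
  qed
next
  assume "\<forall>e\<in>#A. e < c"
  then show "ord_of_mset A < omega_pow c"
    unfolding ord_of_mset_def by (intro cnf_less_omega_pow) simp
qed

section \<open>Cutting normal forms at a power of omega\<close>

definition high_part :: "ordinal \<Rightarrow> ordinal multiset \<Rightarrow> ordinal multiset" where
  "high_part c A = filter_mset (\<lambda>e. c \<le> e) A"

definition low_part :: "ordinal \<Rightarrow> ordinal multiset \<Rightarrow> ordinal multiset" where
  "low_part c A = filter_mset (\<lambda>e. e < c) A"

lemma high_low_part: "A = high_part c A + low_part c A"
  using multiset_partition[of A "\<lambda>e. c \<le> e"] by (simp add: high_part_def low_part_def not_le)

lemma ord_of_mset_high_add:
  assumes "\<And>b. b \<in># B \<Longrightarrow> b < c"
  shows "ord_of_mset (high_part c A + B) = ord_of_mset (high_part c A) + ord_of_mset B"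
  using assms by (intro ord_of_mset_add) (force simp: high_part_def)

lemma ord_of_mset_split: "ord_of_mset A = ord_of_mset (high_part c A) + ord_of_mset (low_part c A)"
  using ord_of_mset_high_add[of "low_part c A" c A] high_low_part[of A c] by (simp add: low_part_def)

lemma ord_of_mset_low_part: "ord_of_mset (low_part c A) < omega_pow c"
  by (simp add: ord_of_mset_less_omega_pow_iff low_part_def)

text \<open>Here \<open>cnf es\<close> is a multiple of omega^c, so an ordinal below it stays below
  it when less than omega^c is added.\<close>

lemma less_cnf_add:
  "(\<And>e. e \<in> set es \<Longrightarrow> c \<le> e) \<Longrightarrow> x < cnf es \<Longrightarrow> y < omega_pow c \<Longrightarrow> x + y < cnf es"
proof (induction es arbitrary: x)
  case (Cons e es)
  show ?case
  proof (cases "x < omega_pow e")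
    case True
    have "y < omega_pow e" using Cons.prems(1)[of e] Cons.prems(3) by (simp add: less_le_trans)
    with True have "x + y < omega_pow e" by (rule omega_pow_add_closed)
    also have "\<dots> \<le> cnf (e # es)" by simp
    finally show ?thesis .
  next
    case False
    then have "omega_pow e \<le> x" by simp
    then obtain x' where x': "x = omega_pow e + x'" by (rule ordinal_le_imp_diff)
    then have "x' < cnf es" using Cons.prems(2) by simp
    then have "x' + y < cnf es" using Cons by simp
    then show ?thesis by (simp add: x' add.assoc)
  qed
qed simp

lemma less_ord_of_high_part_add:
  "x < ord_of_mset (high_part c A) \<Longrightarrow> y < omega_pow c \<Longrightarrow> x + y < ord_of_mset (high_part c A)"
  unfolding ord_of_mset_def by (rule less_cnf_add) (auto simp: high_part_def)

text \<open>A multiple of omega^c does not see the exponents below c of what it is compared with.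
  This provides segments that are stable under adding and removing small exponents.\<close>

lemma ord_of_mset_less_high_part_iff:
  "ord_of_mset A < ord_of_mset (high_part c B) \<longleftrightarrow> ord_of_mset (high_part c A) < ord_of_mset (high_part c B)"
proof
  show "ord_of_mset A < ord_of_mset (high_part c B) \<Longrightarrow> ord_of_mset (high_part c A) < ord_of_mset (high_part c B)"
    using ord_of_mset_split[of A c] by (metis le_less_trans ordinal_le_add1)
  show "ord_of_mset (high_part c A) < ord_of_mset (high_part c B) \<Longrightarrow> ord_of_mset A < ord_of_mset (high_part c B)"
    using less_ord_of_high_part_add[OF _ ord_of_mset_low_part, of "ord_of_mset (high_part c A)"]
      ord_of_mset_split[of A c] by metis
qed

section \<open>Normal functions and the Veblen hierarchy\<close>

definition unbounded :: "ordinal set \<Rightarrow> bool" where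
  "unbounded A \<longleftrightarrow> (\<forall>x. \<exists>y\<in>A. x < y)"

text \<open>Continuity is asked for countable sets because these are the bounded ones, on which
  \<open>Sup\<close> is a true supremum.\<close>

definition normal :: "(ordinal \<Rightarrow> ordinal) \<Rightarrow> bool" where
  "normal f \<longleftrightarrow> strict_mono f \<and>
     (\<forall>X. countable X \<longrightarrow> X \<noteq> {} \<longrightarrow> f (Sup X) = Sup (f ` X))"

lemma normal_strict_mono: "normal f \<Longrightarrow> strict_mono f"
  by (simp add: normal_def)

text \<open>The \<open>LEAST\<close> in \<open>enum_ord\<close> is attained: the countably many
  earlier values are bounded, and A goes beyond every bound.\<close>

lemma
  assumes "unbounded A"
  shows enum_ord_mem: "enum_ord A a \<in> A"
    and enum_ord_less: "b < a \<Longrightarrow> enum_ord A b < enum_ord A a"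
    and enum_ord_least: "y \<in> A \<Longrightarrow> (\<And>b. b < a \<Longrightarrow> enum_ord A b < y) \<Longrightarrow> enum_ord A a \<le> y"
proof -
  let ?P = "\<lambda>x. x \<in> A \<and> (\<forall>b<a. enum_ord A b < x)"
  have e: "enum_ord A a = (LEAST x. ?P x)"
    by (rule enum_ord.simps)
  have "countable (enum_ord A ` {..<a})"
    using countable_lessThan_ordinal by blast
  then obtain u where u: "\<And>b. b < a \<Longrightarrow> enum_ord A b \<le> u"
    using countable_bdd_above by (force simp: bdd_above_def)
  obtain v where "v \<in> A" "u < v" using assms by (auto simp: unbounded_def)
  then have "?P v" using u le_less_trans by blast
  then have *: "?P (enum_ord A a)" unfolding e by (rule LeastI)
  show "enum_ord A a \<in> A" using * by blast
  show "b < a \<Longrightarrow> enum_ord A b < enum_ord A a" using * by blast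
  show "y \<in> A \<Longrightarrow> (\<And>b. b < a \<Longrightarrow> enum_ord A b < y) \<Longrightarrow> enum_ord A a \<le> y"
    unfolding e by (rule Least_le) blast
qed

lemma strict_mono_enum_ord: "unbounded A \<Longrightarrow> strict_mono (enum_ord A)"
  by (simp add: strict_mono_def enum_ord_less)

lemma enum_ord_surj:
  assumes "unbounded A" "y \<in> A"
  obtains a where "enum_ord A a = y"
proof -
  define a where "a = (LEAST a. y \<le> enum_ord A a)"
  have "y \<le> enum_ord A y"
    using strict_mono_ordinal_le[OF strict_mono_enum_ord[OF assms(1)]] .
  then have "y \<le> enum_ord A a" unfolding a_def by (rule LeastI)
  moreover have "enum_ord A a \<le> y"
    using enum_ord_least[OF assms] not_less_Least unfolding a_def by (metis not_less)
  ultimately show thesis using that by (metis order.antisym)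
qed

lemma normal_enum_ord:
  assumes "unbounded A" and closed: "\<And>X. countable X \<Longrightarrow> X \<noteq> {} \<Longrightarrow> X \<subseteq> A \<Longrightarrow> Sup X \<in> A"
  shows "normal (enum_ord A)"
  unfolding normal_def
proof (intro conjI allI impI)
  show sm: "strict_mono (enum_ord A)" using assms(1) by (rule strict_mono_enum_ord)
  fix X :: "ordinal set" assume X: "countable X" "X \<noteq> {}"
  have le: "Sup (enum_ord A ` X) \<le> enum_ord A (Sup X)"
    using X sm by (auto simp: ordinal_SUP_le_iff strict_mono_less_eq
        intro!: cSup_upper countable_bdd_above)
  have "enum_ord A (Sup X) \<le> Sup (enum_ord A ` X)"
  proof (rule enum_ord_least[OF assms(1)])
    show "Sup (enum_ord A ` X) \<in> A"
      using X assms(1) by (intro closed) (auto intro: enum_ord_mem)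
    fix b assume "b < Sup X"
    then obtain x where x: "x \<in> X" "b < x"
      using ordinal_less_SUP_iff[OF X(1), of b "\<lambda>x. x"] by auto
    then have "enum_ord A b < enum_ord A x"
      using assms(1) enum_ord_less by blast
    with x(1) show "enum_ord A b < Sup (enum_ord A ` X)"
      using ordinal_less_SUP_iff[OF X(1)] by blast
  qed
  with le show "enum_ord A (Sup X) = Sup (enum_ord A ` X)" by (rule order.antisym[rotated])
qed

lemma normal_omega_pow: "normal omega_pow"
  unfolding normal_def
proof (intro conjI allI impI strict_mono_omega_pow)
  fix X :: "ordinal set" assume X: "countable X" "X \<noteq> {}"
  have "z < omega_pow (Sup X) \<longleftrightarrow> z < Sup (omega_pow ` X)" for z
  proof
    assume z: "z < omega_pow (Sup X)"
    show "z < Sup (omega_pow ` X)"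
    proof (cases "z = 0")
      case True
      then show ?thesis using X by (auto simp: ordinal_less_SUP_iff)
    next
      case False
      then obtain c n where c: "c < Sup X" "z < ntimes n (omega_pow c)"
        using z by (auto simp: less_omega_pow_iff)
      then obtain d where d: "d \<in> X" "c < d"
        using ordinal_less_SUP_iff[OF X(1), of c "\<lambda>x. x"] by auto
      have "z < omega_pow d"
        using c(2) ntimes_omega_pow_less[OF d(2)] by (rule less_trans)
      then show ?thesis using X d by (auto simp: ordinal_less_SUP_iff)
    qed
  next
    assume "z < Sup (omega_pow ` X)"
    then obtain d where d: "d \<in> X" "z < omega_pow d"
      using X by (auto simp: ordinal_less_SUP_iff)
    have "d \<le> Sup X" using d X by (intro cSup_upper countable_bdd_above)
    with d(2) show "z < omega_pow (Sup X)"
      by (meson less_le_trans omega_pow_le_iff)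
  qed
  then show "omega_pow (Sup X) = Sup (omega_pow ` X)" by (rule ordinal_eqI)
qed

text \<open>Starting above x, iterate the supremum of all \<open>f b\<close>; by continuity the
  limit of the iteration is fixed by every \<open>f b\<close>. Closure under suprema is continuity
  again. Both facts are what \<open>normal_enum_ord\<close> needs to carry normality up the Veblen
  hierarchy.\<close>

lemma common_fixed_points:
  assumes "countable B" "B \<noteq> {}" and normal: "\<And>b. b \<in> B \<Longrightarrow> normal (f b)"
  shows "unbounded {y. \<forall>b\<in>B. f b y = y}"
    and "countable X \<Longrightarrow> X \<noteq> {} \<Longrightarrow> X \<subseteq> {y. \<forall>b\<in>B. f b y = y} \<Longrightarrow> Sup X \<in> {y. \<forall>b\<in>B. f b y = y}"
proof -
  show "unbounded {y. \<forall>b\<in>B. f b y = y}"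
    unfolding unbounded_def
  proof
    fix x
    define g where "g n = ((\<lambda>z. SUP b\<in>B. f b z) ^^ n) (osucc x)" for n :: nat
    have gS: "g (Suc n) = (SUP b\<in>B. f b (g n))" for n by (simp add: g_def)
    define y where "y = (SUP n. g n)"
    have cg: "countable (range g)" by simp
    have gy: "g n \<le> y" for n
      unfolding y_def using cg by (intro cSup_upper countable_bdd_above) auto
    have "f b y = y" if b: "b \<in> B" for b
    proof (rule order.antisym)
      have "f b y = (SUP n. f b (g n))"
        unfolding y_def using normal[OF b] by (simp add: normal_def image_image)
      moreover have "f b (g n) \<le> y" for n
      proof -
        have "f b (g n) \<le> g (Suc n)"
          unfolding gS using b assms(1) by (intro cSup_upper countable_bdd_above) auto
        then show ?thesis using gy order_trans by blast
      qed
      ultimately show "f b y \<le> y" by (simp add: ordinal_SUP_le_iff)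
      show "y \<le> f b y"
        using strict_mono_ordinal_le[OF normal_strict_mono[OF normal[OF b]]] .
    qed
    moreover have "x < y"
      using gy[of 0] less_osucc[of x] by (simp add: g_def)
    ultimately show "\<exists>y\<in>{y. \<forall>b\<in>B. f b y = y}. x < y" by blast
  qed
  assume X: "countable X" "X \<noteq> {}" "X \<subseteq> {y. \<forall>b\<in>B. f b y = y}"
  have "f b (Sup X) = Sup X" if b: "b \<in> B" for b
  proof -
    have "f b ` X = X" using X(3) b by force
    then show ?thesis using normal[OF b] X by (simp add: normal_def)
  qed
  then show "Sup X \<in> {y. \<forall>b\<in>B. f b y = y}" by blast
qed

lemma veblen_0: "veblen 0 = omega_pow"
  by (rule ext) (simp add: veblen.simps)

lemma veblen_pos_eq: "a \<noteq> 0 \<Longrightarrow> veblen a = enum_ord {y. \<forall>b\<in>{..<a}. veblen b y = y}"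
  by (rule ext, subst veblen.simps) (simp add: lessThan_def)

lemma lessThan_ordinal_nonempty: "a \<noteq> 0 \<Longrightarrow> {..<a :: ordinal} \<noteq> {}"
  by (auto simp: ordinal_pos_iff[symmetric])

lemma normal_veblen: "normal (veblen a)"
proof (induction a rule: less_induct)
  case (less a)
  show ?case
  proof (cases "a = 0")
    case True
    then show ?thesis by (simp add: veblen_0 normal_omega_pow)
  next
    case False
    note fp = common_fixed_points[of "{..<a}" veblen, OF countable_lessThan_ordinal
        lessThan_ordinal_nonempty[OF False]]
    show ?thesis
      unfolding veblen_pos_eq[OF False] using less fp by (intro normal_enum_ord) auto
  qed
qed

lemma strict_mono_veblen: "strict_mono (veblen a)"
  by (rule normal_strict_mono[OF normal_veblen])

lemma veblen_inject: "veblen a x = veblen a y \<longleftrightarrow> x = y"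
  using strict_mono_veblen by (simp add: strict_mono_eq)

lemma unbounded_veblen_fixed_points:
  "a \<noteq> 0 \<Longrightarrow> unbounded {y. \<forall>b\<in>{..<a}. veblen b y = y}"
  by (rule common_fixed_points(1)[OF countable_lessThan_ordinal lessThan_ordinal_nonempty normal_veblen])

lemma veblen_veblen: "b < a \<Longrightarrow> veblen b (veblen a x) = veblen a x"
proof -
  assume "b < a"
  then have "a \<noteq> 0" by auto
  then show ?thesis
    using enum_ord_mem[OF unbounded_veblen_fixed_points, of a x] \<open>b < a\<close>
    by (simp add: veblen_pos_eq)
qed

lemma veblen_is_omega_pow: "\<exists>d. veblen a x = omega_pow d"
  using veblen_veblen[of 0 a x] by (cases "a = 0") (auto simp: veblen_0 ordinal_pos_iff[symmetric] intro: sym)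

lemma veblen_pos: "0 < veblen a x"
  using veblen_is_omega_pow[of a x] by auto

text \<open>For b < a, \<open>veblen a 0\<close> is a positive fixed point of
  \<open>veblen b\<close> and therefore exceeds \<open>veblen b 0\<close>.\<close>

lemma le_veblen_0: "a \<le> veblen a 0"
proof -
  have "veblen b 0 < veblen a 0" if "b < a" for a b
    using veblen_veblen[OF that, of 0] strict_monoD[OF strict_mono_veblen[of b] veblen_pos[of a 0]]
    by simp
  then have "strict_mono (\<lambda>a. veblen a 0)" by (simp add: strict_mono_def)
  then show ?thesis by (rule strict_mono_ordinal_le)
qed

subsection \<open>The fixed point free Veblen function\<close>

text \<open>Powers of omega are closed under addition, but adding 1 to \<open>osucc y\<close> would
  reach the power itself. The double successor matters, since 1 = omega^0 is a successor.\<close>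

lemma omega_pow_eq_osucc_iff: "omega_pow d \<noteq> osucc (osucc y)"
proof
  assume "omega_pow d = osucc (osucc y)"
  moreover from this have "osucc y < omega_pow d" "1 < omega_pow d"
    using less_osucc[of y] less_osucc[of "osucc y"] by (auto simp: one_ordinal_def less_osucc_iff osucc_le_iff
        intro: le_less_trans ordinal_zero_le)
  ultimately have "osucc y + 1 < osucc y + 1"
    using omega_pow_add_closed[of "osucc y" d 1] by (simp add: osucc_eq)
  then show False by simp
qed

lemma unbounded_veblen_bar: "unbounded {veblen a x | x. x < veblen a x}"
  unfolding unbounded_def
proof
  fix y
  \<comment> \<open>Veblen values are powers of omega, so a double successor is never a fixed
    point.\<close>
  define x where "x = osucc (osucc y)"
  have "y < x" unfolding x_def using less_osucc less_trans by blast
  have "x \<le> veblen a x" by (rule strict_mono_ordinal_le[OF strict_mono_veblen])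
  moreover have "x \<noteq> veblen a x"
    using veblen_is_omega_pow[of a x] omega_pow_eq_osucc_iff unfolding x_def by metis
  ultimately have "x < veblen a x" by simp
  with \<open>y < x\<close> show "\<exists>z\<in>{veblen a x | x. x < veblen a x}. y < z"
    using less_trans by blast
qed

text \<open>The passage from y to the argument x is strictly increasing, hence y \<le> x. This
  yields y < \<open>veblen_bar a y\<close>, so that the norm recurs to smaller ordinals.\<close>

lemma veblen_bar_arg:
  obtains x where "veblen_bar a y = veblen a x" "x < veblen a x" "y \<le> x"
proof -
  have "\<exists>x. veblen_bar a y = veblen a x \<and> x < veblen a x" for y
    using enum_ord_mem[OF unbounded_veblen_bar, of a y] by (auto simp: veblen_bar_def)
  then obtain g where g: "\<And>y. veblen_bar a y = veblen a (g y)" "\<And>y. g y < veblen a (g y)"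
    by metis
  have "strict_mono g"
  proof (rule strict_monoI)
    fix x y :: ordinal assume "x < y"
    then have "veblen a (g x) < veblen a (g y)"
      using enum_ord_less[OF unbounded_veblen_bar \<open>x < y\<close>, of a] unfolding veblen_bar_def[symmetric] g(1) by simp
    then show "g x < g y"
      using strict_mono_veblen by (simp add: strict_mono_less)
  qed
  then have "y \<le> g y" by (rule strict_mono_ordinal_le)
  with g that show thesis by blast
qed

lemma veblen_bar_is_omega_pow: obtains d where "veblen_bar a y = omega_pow d"
  using veblen_bar_arg veblen_is_omega_pow by metis

text \<open>For a < b every value of \<open>veblen b\<close> is fixed by \<open>veblen a\<close>,
  whereas \<open>veblen_bar a\<close> takes only values of \<open>veblen a\<close> that are moved by
  it. So equal values have equal levels.\<close>

lemma veblen_bar_inject: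
  assumes "veblen_bar a x = veblen_bar b y"
  shows "a = b \<and> x = y"
proof -
  have *: False if lt: "a < b" and eq: "veblen_bar a x = veblen_bar b y" for a b x y
  proof -
    obtain x' where x': "veblen_bar a x = veblen a x'" "x' < veblen a x'" by (rule veblen_bar_arg)
    obtain y' where y': "veblen_bar b y = veblen b y'" by (rule veblen_bar_arg)
    have "veblen a (veblen a x') = veblen a x'"
      using veblen_veblen[OF lt, of y'] x' y' eq by simp
    then show False using x'(2) by (simp add: veblen_inject)
  qed
  have "a = b" using *[of a b x y] *[of b a y x] assms by (metis linorder_cases)
  moreover have "x = y"
    using assms strict_mono_enum_ord[OF unbounded_veblen_bar] unfolding \<open>a = b\<close> veblen_bar_def
    by (simp add: strict_mono_eq)
  ultimately show ?thesis ..
qed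

text \<open>The level a is the least one whose Veblen function moves omega^d. All lower ones fix it,
  so it is a value of \<open>veblen a\<close>, at a smaller argument. Minimality of
  \<open>Gamma0\<close> excludes a = omega^d.\<close>

lemma omega_pow_eq_veblen_bar:
  assumes "omega_pow d < Gamma0"
  obtains a y where "omega_pow d = veblen_bar a y" "a < omega_pow d" "y < omega_pow d"
proof -
  define \<delta> where "\<delta> = omega_pow d"
  have pos: "0 < \<delta>" by (simp add: \<delta>_def)
  have "\<delta> \<le> veblen \<delta> 0" by (rule le_veblen_0)
  also have "\<dots> < veblen \<delta> \<delta>"
    using pos strict_mono_veblen by (simp add: strict_mono_less)
  finally have ex: "veblen \<delta> \<delta> \<noteq> \<delta>" by simp
  define a where "a = (LEAST a. veblen a \<delta> \<noteq> \<delta>)"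
  have a: "veblen a \<delta> \<noteq> \<delta>" unfolding a_def using ex by (rule LeastI)
  have a_le: "a \<le> \<delta>" unfolding a_def using ex by (rule Least_le)
  have below: "veblen b \<delta> = \<delta>" if "b < a" for b
    using that not_less_Least unfolding a_def by blast
  obtain x where x: "veblen a x = \<delta>"
  proof (cases "a = 0")
    case True
    then show thesis using that[of d] by (simp add: veblen_0 \<delta>_def)
  next
    case False
    then show thesis
      using enum_ord_surj[OF unbounded_veblen_fixed_points[OF False], of \<delta>] below that
      by (auto simp: veblen_pos_eq)
  qed
  have "x \<le> \<delta>" using strict_mono_ordinal_le[OF strict_mono_veblen, of x a] x by simp
  then have "x < \<delta>" using x a by (auto simp: order.order_iff_strict)
  have "a \<noteq> \<delta>"
  proof
    assume "a = \<delta>"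
    have "veblen \<delta> 0 \<le> veblen \<delta> x"
      using strict_mono_veblen by (simp add: strict_mono_less_eq)
    then have "veblen \<delta> 0 = \<delta>"
      using x le_veblen_0[of \<delta>] \<open>a = \<delta>\<close> by simp
    then show False
      using pos not_less_Least[of \<delta> "\<lambda>a. 0 < a \<and> veblen a 0 = a"] assms
      by (simp add: Gamma0_def \<delta>_def)
  qed
  with a_le have "a < \<delta>" by simp
  obtain y where y: "veblen_bar a y = \<delta>"
    using enum_ord_surj[OF unbounded_veblen_bar, of \<delta> a] x \<open>x < \<delta>\<close> unfolding veblen_bar_def by blast
  obtain x' where "veblen_bar a y = veblen a x'" "x' < veblen a x'" "y \<le> x'"
    by (rule veblen_bar_arg)
  then have "y < \<delta>" using y by simp
  with that[of a y] y \<open>a < \<delta>\<close> show thesis by (simp add: \<delta>_def)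
qed

text \<open>Before the first fixed point of e -> omega^e the enumeration \<open>veblen_bar 0\<close>
  skips nothing. A fixed point below x may shift it, hence a hypothesis on all e \<le> x.\<close>

lemma veblen_bar_0:
  assumes "\<And>e. e \<le> x \<Longrightarrow> omega_pow e \<noteq> e"
  shows "veblen_bar 0 x = omega_pow x"
  using assms
proof (induction x rule: less_induct)
  case (less x)
  have less_pow: "e < omega_pow e" if "e \<le> x" for e
    using less.prems[OF that] le_omega_pow[of e] by simp
  have IH: "veblen_bar 0 e = omega_pow e" if "e < x" for e
    using less.IH[OF that] less.prems that by (meson le_less_trans less_imp_le)
  have "veblen_bar 0 x \<le> omega_pow x"
    unfolding veblen_bar_def
  proof (rule enum_ord_least[OF unbounded_veblen_bar])
    show "omega_pow x \<in> {veblen 0 x |x. x < veblen 0 x}"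
      using less_pow[of x] by (auto simp: veblen_0)
    show "enum_ord {veblen 0 x |x. x < veblen 0 x} b < omega_pow x" if "b < x" for b
      using IH[OF that] that by (simp add: veblen_bar_def)
  qed
  moreover have "omega_pow x \<le> veblen_bar 0 x"
    by (metis veblen_bar_arg veblen_0 omega_pow_le_iff)
  ultimately show ?case by (rule order.antisym)
qed

section \<open>The norm\<close>

lemma veblen_bar_add_cnf:
  assumes "c = 0 \<or> (\<exists>e es. is_CNF (e # es) c \<and> omega_pow e \<le> veblen_bar a x)"
  obtains d es where "veblen_bar a x = omega_pow d" "c = cnf es" "sorted_wrt (\<ge>) (d # es)"
proof -
  obtain d where d: "veblen_bar a x = omega_pow d" by (rule veblen_bar_is_omega_pow)
  from assms show thesis
  proof
    assume "c = 0"
    then show thesis using that[OF d, of "[]"] by simp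
  next
    assume "\<exists>e es. is_CNF (e # es) c \<and> omega_pow e \<le> veblen_bar a x"
    then obtain e es where e: "is_CNF (e # es) c" "omega_pow e \<le> omega_pow d" using d by auto
    then show thesis using that[OF d, of "e # es"] by (fastforce simp: is_CNF_iff)
  qed
qed

text \<open>Normal forms are unique and \<open>veblen_bar\<close> is injective in both arguments, so
  the components of a nonzero ordinal are determined. This legitimises the \<open>THE\<close> in
  \<open>norm_ord\<close>.\<close>

lemma has_norm_functional: "has_norm z n \<Longrightarrow> has_norm z n' \<Longrightarrow> n = n'"
proof (induction arbitrary: n' rule: has_norm.induct)
  case zero
  from zero show ?case
  proof cases
    case (step a x c k l m)
    have "veblen_bar a x \<noteq> 0" by (metis veblen_bar_is_omega_pow omega_pow_nonzero)
    moreover have "veblen_bar a x \<le> 0" using step(1) by (metis ordinal_le_add1)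
    ultimately show ?thesis by simp
  qed simp
next
  case (step a x c k l m)
  obtain d es where d: "veblen_bar a x = omega_pow d" "c = cnf es" "sorted_wrt (\<ge>) (d # es)"
    using step.hyps(4) by (rule veblen_bar_add_cnf)
  from step.prems show ?case
  proof cases
    case zero
    then have "cnf (d # es) = 0" using d by simp
    then show ?thesis unfolding cnf_eq_0_iff by simp
  next
    case (step a' x' c' k' l' m')
    obtain d' es' where d': "veblen_bar a' x' = omega_pow d'" "c' = cnf es'" "sorted_wrt (\<ge>) (d' # es')"
      using step(6) by (rule veblen_bar_add_cnf)
    have "cnf (d # es) = cnf (d' # es')" using step(1) d d' by simp
    then have eq: "d # es = d' # es'" using d(3) d'(3) by (intro cnf_unique)
    then have "a = a'" "x = x'" using d d' veblen_bar_inject[of a x a' x'] by auto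
    moreover have "c = c'" using eq d d' by simp
    ultimately show ?thesis using step \<open>\<And>n'. has_norm a n' \<Longrightarrow> k = n'\<close>
      \<open>\<And>n'. has_norm x n' \<Longrightarrow> l = n'\<close> \<open>\<And>n'. has_norm c n' \<Longrightarrow> m = n'\<close> by simp
  qed
qed

lemma norm_ord_eqI: "has_norm z n \<Longrightarrow> norm_ord z = n"
  unfolding norm_ord_def using has_norm_functional by blast

lemma ex_has_norm: "z < Gamma0 \<Longrightarrow> \<exists>n. has_norm z n"
proof (induction z rule: less_induct)
  case (less z)
  show ?case
  proof (cases "z = 0")
    case True
    then show ?thesis using has_norm.zero by blast
  next
    case False
    obtain es where es: "sorted_wrt (\<ge>) es" "cnf es = z" using ex_cnf by blast
    with False obtain d es' where d: "es = d # es'" by (cases es) auto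
    define r where "r = cnf es'"
    have z: "z = omega_pow d + r" using es d by (simp add: r_def)
    have "omega_pow d \<le> z" by (simp add: z)
    then have pow: "omega_pow d < Gamma0" using less.prems by simp
    then obtain a y where ay: "omega_pow d = veblen_bar a y" "a < omega_pow d" "y < omega_pow d"
      by (rule omega_pow_eq_veblen_bar)
    \<comment> \<open>If r = z, a normal form would be equal to its own tail.\<close>
    have "r < z"
    proof (rule ccontr)
      assume "\<not> r < z"
      then have "r = z" by (metis z ordinal_le_add2 not_less order.antisym)
      then have "cnf es' = cnf (d # es')" using es d by (simp add: r_def)
      then have "es' = d # es'" using es(1) d by (intro cnf_unique) auto
      then show False by simp
    qed
    have "a < z" "y < z" using ay \<open>omega_pow d \<le> z\<close> by auto
    obtain k l m where "has_norm a k" "has_norm y l" "has_norm r m"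
      using less.IH[OF \<open>a < z\<close>] less.IH[OF \<open>y < z\<close>] less.IH[OF \<open>r < z\<close>] less.prems
        \<open>a < z\<close> \<open>y < z\<close> \<open>r < z\<close> by (meson less_trans)
    moreover have "r = 0 \<or> (\<exists>e es. is_CNF (e # es) r \<and> omega_pow e \<le> veblen_bar a y)"
    proof (cases es')
      case (Cons e fs)
      then have "is_CNF (e # fs) r" "omega_pow e \<le> veblen_bar a y"
        using es d ay(1)[symmetric] by (auto simp: r_def is_CNF_iff)
      then show ?thesis by blast
    qed (simp add: r_def)
    ultimately have "has_norm (veblen_bar a y + r) (1 + k + l + m)"
      using z ay pow less.prems by (intro has_norm.step) auto
    then show ?thesis using z ay by metis
  qed
qed

lemma has_norm_norm_ord: "z < Gamma0 \<Longrightarrow> has_norm z (norm_ord z)"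
  using ex_has_norm norm_ord_eqI by blast

lemma norm_ord_0 [simp]: "norm_ord 0 = 0"
  by (rule norm_ord_eqI) (rule has_norm.zero)

lemma norm_ord_veblen_bar_add:
  assumes "veblen_bar a y + r < Gamma0" "a < Gamma0" "y < Gamma0"
    and "r = 0 \<or> (\<exists>e es. is_CNF (e # es) r \<and> omega_pow e \<le> veblen_bar a y)"
  shows "norm_ord (veblen_bar a y + r) = 1 + norm_ord a + norm_ord y + norm_ord r"
proof -
  have "r < Gamma0" using assms(1) by (meson le_less_trans ordinal_le_add2)
  then show ?thesis
    using assms by (intro norm_ord_eqI has_norm.step has_norm_norm_ord) auto
qed

lemma norm_ord_veblen_bar:
  assumes "veblen_bar a y < Gamma0" "a < Gamma0" "y < Gamma0"
  shows "norm_ord (veblen_bar a y) = 1 + norm_ord a + norm_ord y"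
  using norm_ord_veblen_bar_add[of a y 0] assms by simp

lemma norm_ord_Cons:
  assumes "sorted_wrt (\<ge>) (d # es)" "cnf (d # es) < Gamma0"
  shows "norm_ord (cnf (d # es)) = norm_ord (omega_pow d) + norm_ord (cnf es)"
proof -
  have pow: "omega_pow d < Gamma0"
    using assms(2) by (auto intro: le_less_trans[OF ordinal_le_add1])
  then obtain a y where ay: "omega_pow d = veblen_bar a y" "a < omega_pow d" "y < omega_pow d"
    by (rule omega_pow_eq_veblen_bar)
  have "cnf es = 0 \<or> (\<exists>e fs. is_CNF (e # fs) (cnf es) \<and> omega_pow e \<le> veblen_bar a y)"
  proof (cases es)
    case (Cons e fs)
    then have "is_CNF (e # fs) (cnf es)" "omega_pow e \<le> veblen_bar a y"
      using assms(1) ay(1)[symmetric] by (auto simp: is_CNF_iff)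
    then show ?thesis by blast
  qed simp
  then show ?thesis
    using norm_ord_veblen_bar_add[of a y "cnf es"] norm_ord_veblen_bar[of a y] assms(2) pow ay
    by (simp add: less_trans)
qed

definition weight :: "ordinal \<Rightarrow> nat" where "weight e = norm_ord (omega_pow e)"

lemma weight_pos: "omega_pow d < Gamma0 \<Longrightarrow> 0 < weight d"
proof -
  assume pow: "omega_pow d < Gamma0"
  then obtain a y where "omega_pow d = veblen_bar a y" "a < omega_pow d" "y < omega_pow d"
    by (rule omega_pow_eq_veblen_bar)
  then show ?thesis
    using norm_ord_veblen_bar[of a y] pow by (simp add: weight_def less_trans)
qed

text \<open>Here epsilon_0 enters: at a fixed point \<open>omega_pow e = e\<close> the weight is
  \<open>norm_ord e\<close> itself, without the additional 1.\<close>

lemma weight_eq: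
  assumes "\<And>e. e \<le> x \<Longrightarrow> omega_pow e \<noteq> e" "omega_pow x < Gamma0"
  shows "weight x = 1 + norm_ord x"
proof -
  have "0 < Gamma0" "x < Gamma0"
    using assms(2) le_omega_pow[of x] by (auto intro: le_less_trans)
  then show ?thesis
    using norm_ord_veblen_bar[of 0 x] veblen_bar_0[OF assms(1)] assms(2) by (simp add: weight_def)
qed

lemma norm_ord_cnf:
  "sorted_wrt (\<ge>) es \<Longrightarrow> cnf es < Gamma0 \<Longrightarrow> norm_ord (cnf es) = sum_list (map weight es)"
proof (induction es)
  case (Cons e es)
  have "cnf es < Gamma0" using Cons.prems(2) by (auto intro: le_less_trans[OF ordinal_le_add2])
  then show ?case using Cons norm_ord_Cons[of e es] by (simp add: weight_def)
qed simp

lemma norm_ord_of_mset: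
  assumes "ord_of_mset A < Gamma0"
  shows "norm_ord (ord_of_mset A) = (\<Sum>e\<in>#A. weight e)"
proof -
  have "norm_ord (ord_of_mset A) = sum_list (map weight (rev (sorted_list_of_multiset A)))"
    unfolding ord_of_mset_def
    by (rule norm_ord_cnf) (use assms in \<open>simp_all add: ord_of_mset_def sorted_rev_mset[simplified]\<close>)
  also have "\<dots> = (\<Sum>e\<in>#A. weight e)"
    by (metis mset_map mset_rev mset_sorted_list_of_multiset sum_mset_sum_list)
  finally show ?thesis .
qed

text \<open>A nonzero ordinal of norm n is assembled from three ordinals of smaller norm.\<close>

lemma finite_has_norm: "finite {z. has_norm z n}"
proof (induction n rule: less_induct)
  case (less n)
  define F where "F = {z. \<exists>k<n. has_norm z k}"
  have "F = (\<Union>k\<in>{..<n}. {z. has_norm z k})" by (auto simp: F_def)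
  then have F: "finite F" using less by simp
  have "{z. has_norm z n} \<subseteq> insert 0 ((\<lambda>(a, x, c). veblen_bar a x + c) ` (F \<times> F \<times> F))"
  proof
    fix z assume "z \<in> {z. has_norm z n}"
    then have "has_norm z n" by simp
    then show "z \<in> insert 0 ((\<lambda>(a, x, c). veblen_bar a x + c) ` (F \<times> F \<times> F))"
    proof cases
      case (step a x c k l m)
      have "k < n" "l < n" "m < n" using step(2) by auto
      then have "a \<in> F" "x \<in> F" "c \<in> F" using step unfolding F_def by blast+
      then show ?thesis using step(1) by force
    qed simp
  qed
  then show ?case by (rule finite_subset) (simp add: F)
qed

lemma finite_norm_ord: "finite {z. z < Gamma0 \<and> norm_ord z = n}"
  by (rule finite_subset[OF _ finite_has_norm[of n]]) (auto intro: has_norm_norm_ord)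

lemma omega_pow_fin_ord_neq: "e \<le> fin_ord n \<Longrightarrow> omega_pow e \<noteq> e"
proof -
  have "fin_ord k < fin_pow k" for k
  proof (induction k)
    case (Suc k)
    have "fin_ord (Suc k) \<le> fin_pow k"
      using Suc by (simp add: fin_ord_Suc osucc_eq[symmetric] osucc_le_iff)
    also have "\<dots> < fin_pow (Suc k)" by simp
    finally show ?case .
  qed simp
  then show "e \<le> fin_ord n \<Longrightarrow> omega_pow e \<noteq> e"
    by (metis less_fin_ord_Suc less_fin_ord_iff less_irrefl)
qed

lemma norm_ord_1: "1 < Gamma0 \<Longrightarrow> norm_ord 1 = 1"
  using weight_eq[of 0] omega_pow_fin_ord_neq[of _ 0] by (simp add: weight_def)

lemma norm_ord_fin_ord: "fin_ord n < Gamma0 \<Longrightarrow> norm_ord (fin_ord n) = n"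
proof -
  assume *: "fin_ord n < Gamma0"
  have ord: "ord_of_mset (replicate_mset k 0) = fin_ord k" for k
    unfolding ord_of_mset_replicate by (induction k) (simp_all add: fin_ord_Suc)
  show ?thesis
  proof (cases n)
    case (Suc k)
    have "1 \<le> fin_ord n" using Suc fin_ord_le_iff[of 1 n] by (simp add: fin_ord_Suc)
    then have "weight 0 = 1" using * norm_ord_1 by (simp add: weight_def)
    then show ?thesis using norm_ord_of_mset[of "replicate_mset n 0"] * by (simp add: ord)
  qed simp
qed

lemma weight_fin_ord: "fin_pow n < Gamma0 \<Longrightarrow> weight (fin_ord n) = Suc n"
proof -
  assume *: "fin_pow n < Gamma0"
  then have "fin_ord n < Gamma0" using le_omega_pow le_less_trans by blast
  then show ?thesis using weight_eq[OF omega_pow_fin_ord_neq *] norm_ord_fin_ord by simp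
qed

section \<open>Ehrenfeucht-Fraisse equivalence for monadic second order logic\<close>

definition some_before :: "'a::linorder set \<Rightarrow> 'a set \<Rightarrow> bool" where
  "some_before X Y \<longleftrightarrow> (\<exists>x\<in>X. \<exists>y\<in>Y. x < y)"

text \<open>On singletons, inclusion is equality or membership and \<open>some_before\<close> is the
  order, so all atomic formulas are covered. Emptiness is recorded because in an ordered sum both
  \<open>some_before\<close> and being a singleton depend on which components a set meets.\<close>

definition atoms :: "'a::linorder set list \<Rightarrow> nat \<Rightarrow> nat \<Rightarrow> bool \<times> bool \<times> bool \<times> bool" where
  "atoms Xs i j =
     (Xs ! i = {}, \<exists>x. Xs ! i = {x}, Xs ! i \<subseteq> Xs ! j, some_before (Xs ! i) (Xs ! j))"

definition same_atoms :: "'a::linorder set list \<Rightarrow> 'a set list \<Rightarrow> bool" where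
  "same_atoms Xs Ys \<longleftrightarrow> length Xs = length Ys \<and>
     (\<forall>i<length Xs. \<forall>j<length Xs. atoms Xs i j = atoms Ys i j)"

lemma same_atomsD:
  assumes "same_atoms Xs Ys"
  shows "length Xs = length Ys"
    and "i < length Xs \<Longrightarrow> Xs ! i = {} \<longleftrightarrow> Ys ! i = {}"
    and "i < length Xs \<Longrightarrow> (\<exists>x. Xs ! i = {x}) \<longleftrightarrow> (\<exists>y. Ys ! i = {y})"
    and "i < length Xs \<Longrightarrow> j < length Xs \<Longrightarrow> Xs ! i \<subseteq> Xs ! j \<longleftrightarrow> Ys ! i \<subseteq> Ys ! j"
    and "i < length Xs \<Longrightarrow> j < length Xs \<Longrightarrow>
      some_before (Xs ! i) (Xs ! j) \<longleftrightarrow> some_before (Ys ! i) (Ys ! j)"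
proof -
  show "length Xs = length Ys" using assms unfolding same_atoms_def by blast
  have *: "atoms Xs i j = atoms Ys i j" if "i < length Xs" "j < length Xs" for i j
    using assms that unfolding same_atoms_def by blast
  show "i < length Xs \<Longrightarrow> Xs ! i = {} \<longleftrightarrow> Ys ! i = {}"
    and "i < length Xs \<Longrightarrow> (\<exists>x. Xs ! i = {x}) \<longleftrightarrow> (\<exists>y. Ys ! i = {y})"
    using *[of i i] unfolding atoms_def prod.inject by blast+
  show "i < length Xs \<Longrightarrow> j < length Xs \<Longrightarrow> Xs ! i \<subseteq> Xs ! j \<longleftrightarrow> Ys ! i \<subseteq> Ys ! j"
    and "i < length Xs \<Longrightarrow> j < length Xs \<Longrightarrow>
      some_before (Xs ! i) (Xs ! j) \<longleftrightarrow> some_before (Ys ! i) (Ys ! j)"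
    using *[of i j] unfolding atoms_def prod.inject by blast+
qed

lemma same_atomsI:
  assumes "length Xs = length Ys"
    and "\<And>i. i < length Xs \<Longrightarrow> Xs ! i = {} \<longleftrightarrow> Ys ! i = {}"
    and "\<And>i. i < length Xs \<Longrightarrow> (\<exists>x. Xs ! i = {x}) \<longleftrightarrow> (\<exists>y. Ys ! i = {y})"
    and "\<And>i j. i < length Xs \<Longrightarrow> j < length Xs \<Longrightarrow> Xs ! i \<subseteq> Xs ! j \<longleftrightarrow> Ys ! i \<subseteq> Ys ! j"
    and "\<And>i j. i < length Xs \<Longrightarrow> j < length Xs \<Longrightarrow>
      some_before (Xs ! i) (Xs ! j) \<longleftrightarrow> some_before (Ys ! i) (Ys ! j)"
  shows "same_atoms Xs Ys"
  unfolding same_atoms_def atoms_def prod.inject by (intro conjI allI impI assms)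

text \<open>
  Only sets are moved; an element is played as a singleton.  This makes the equivalence compatible
  with ordered sums componentwise.
\<close>

primrec ef_equiv :: "nat \<Rightarrow> 'a::linorder set \<Rightarrow> 'a set list \<Rightarrow> 'a set \<Rightarrow> 'a set list \<Rightarrow> bool" where
  "ef_equiv 0 D Xs D' Ys \<longleftrightarrow> same_atoms Xs Ys"
| "ef_equiv (Suc k) D Xs D' Ys \<longleftrightarrow>
     (\<forall>X\<subseteq>D. \<exists>Y\<subseteq>D'. ef_equiv k D (Xs @ [X]) D' (Ys @ [Y])) \<and>
     (\<forall>Y\<subseteq>D'. \<exists>X\<subseteq>D. ef_equiv k D (Xs @ [X]) D' (Ys @ [Y]))"

lemma same_atoms_butlast: "same_atoms (Xs @ [X]) (Ys @ [Y]) \<Longrightarrow> same_atoms Xs Ys"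
proof -
  assume *: "same_atoms (Xs @ [X]) (Ys @ [Y])"
  then have len: "length Xs = length Ys" using same_atomsD(1) by fastforce
  have **: "atoms (Xs @ [X]) i j = atoms Xs i j"
    if "i < length Xs" "j < length Xs" for i j and Xs :: "'a set list" and X
    using that by (simp add: atoms_def nth_append)
  have "atoms Xs i j = atoms Ys i j" if "i < length Xs" "j < length Xs" for i j
  proof -
    have "atoms (Xs @ [X]) i j = atoms (Ys @ [Y]) i j"
      using * that by (simp add: same_atoms_def)
    then show ?thesis using that len by (simp add: **)
  qed
  then show ?thesis using len by (simp add: same_atoms_def)
qed

lemma ef_equiv_refl: "ef_equiv k D Xs D Xs"
  by (induction k arbitrary: Xs) (auto simp: same_atoms_def)

lemma ef_equiv_sym: "ef_equiv k D Xs D' Ys \<Longrightarrow> ef_equiv k D' Ys D Xs"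
proof (induction k arbitrary: Xs Ys)
  case 0
  then show ?case unfolding ef_equiv.simps same_atoms_def by metis
next
  case (Suc k)
  then show ?case unfolding ef_equiv.simps by meson
qed

lemma ef_equiv_trans:
  "ef_equiv k D Xs D' Ys \<Longrightarrow> ef_equiv k D' Ys D'' Zs \<Longrightarrow> ef_equiv k D Xs D'' Zs"
proof (induction k arbitrary: Xs Ys Zs)
  case 0
  then show ?case unfolding ef_equiv.simps same_atoms_def by metis
next
  case (Suc k)
  show ?case
    unfolding ef_equiv.simps
  proof (intro conjI allI impI)
    fix X assume "X \<subseteq> D"
    then obtain Y where Y: "Y \<subseteq> D'" "ef_equiv k D (Xs @ [X]) D' (Ys @ [Y])"
      using Suc.prems(1) unfolding ef_equiv.simps by meson
    then obtain Z where Z: "Z \<subseteq> D''" "ef_equiv k D' (Ys @ [Y]) D'' (Zs @ [Z])"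
      using Suc.prems(2) unfolding ef_equiv.simps by meson
    show "\<exists>Z\<subseteq>D''. ef_equiv k D (Xs @ [X]) D'' (Zs @ [Z])"
      using Z(1) Suc.IH[OF Y(2) Z(2)] by blast
  next
    fix Z assume "Z \<subseteq> D''"
    then obtain Y where Y: "Y \<subseteq> D'" "ef_equiv k D' (Ys @ [Y]) D'' (Zs @ [Z])"
      using Suc.prems(2) unfolding ef_equiv.simps by meson
    then obtain X where X: "X \<subseteq> D" "ef_equiv k D (Xs @ [X]) D' (Ys @ [Y])"
      using Suc.prems(1) unfolding ef_equiv.simps by meson
    show "\<exists>X\<subseteq>D. ef_equiv k D (Xs @ [X]) D'' (Zs @ [Z])"
      using X(1) Suc.IH[OF X(2) Y(2)] by blast
  qed
qed

lemma ef_equiv_same_atoms: "ef_equiv k D Xs D' Ys \<Longrightarrow> same_atoms Xs Ys"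
proof (induction k arbitrary: Xs Ys)
  case (Suc k)
  then show ?case using same_atoms_butlast by (metis ef_equiv.simps(2) empty_subsetI)
qed simp

section \<open>From games to formulas\<close>

primrec set_rank :: "mso \<Rightarrow> nat" where
  "set_rank (Less i j) = 0"
| "set_rank (Equal i j) = 0"
| "set_rank (Member i k) = 0"
| "set_rank (Neg p) = set_rank p"
| "set_rank (Conj p q) = max (set_rank p) (set_rank q)"
| "set_rank (Ex_elem i p) = Suc (set_rank p)"
| "set_rank (Ex_set k p) = Suc (set_rank p)"

text \<open>\<open>pe\<close> and \<open>ps\<close> tell at which list position the value of a
  variable sits; a quantifier appends its choice and redirects its variable to the new last
  position. Both kinds of quantifier use up one round, as elements are played as singletons.\<close>

lemma ef_equiv_mso_sat:
  assumes "ef_equiv k D Xs D' Ys" "set_rank p \<le> k"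
    and "\<And>i. i \<in> free_elem p \<Longrightarrow> pe i < length Xs \<and> Xs ! pe i = {v i} \<and> Ys ! pe i = {v' i}"
    and "\<And>j. j \<in> free_set p \<Longrightarrow> ps j < length Xs \<and> Xs ! ps j = V j \<and> Ys ! ps j = V' j"
  shows "mso_sat D (<) v V p \<longleftrightarrow> mso_sat D' (<) v' V' p"
  using assms
proof (induction p arbitrary: k Xs Ys pe ps v V v' V')
  case (Less i j)
  have "some_before (Xs ! pe i) (Xs ! pe j) \<longleftrightarrow> some_before (Ys ! pe i) (Ys ! pe j)"
    using same_atomsD(5)[OF ef_equiv_same_atoms[OF Less(1)], of "pe i" "pe j"] Less(3)[of i] Less(3)[of j] by simp
  then show ?case using Less(3)[of i] Less(3)[of j] by (simp add: some_before_def)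
next
  case (Equal i j)
  have "Xs ! pe i \<subseteq> Xs ! pe j \<longleftrightarrow> Ys ! pe i \<subseteq> Ys ! pe j"
    using same_atomsD(4)[OF ef_equiv_same_atoms[OF Equal(1)], of "pe i" "pe j"] Equal(3)[of i] Equal(3)[of j] by simp
  then show ?case using Equal(3)[of i] Equal(3)[of j] by simp
next
  case (Member i j)
  have "Xs ! pe i \<subseteq> Xs ! ps j \<longleftrightarrow> Ys ! pe i \<subseteq> Ys ! ps j"
    using same_atomsD(4)[OF ef_equiv_same_atoms[OF Member(1)], of "pe i" "ps j"] Member(3)[of i] Member(4)[of j] by simp
  then show ?case using Member(3)[of i] Member(4)[of j] by simp
next
  case (Neg p)
  have "mso_sat D (<) v V p \<longleftrightarrow> mso_sat D' (<) v' V' p"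
    by (rule Neg.IH[OF Neg.prems(1)]) (use Neg.prems in auto)
  then show ?case by simp
next
  case (Conj p q)
  have "mso_sat D (<) v V p \<longleftrightarrow> mso_sat D' (<) v' V' p"
    by (rule Conj.IH(1)[OF Conj.prems(1)]) (use Conj.prems in auto)
  moreover have "mso_sat D (<) v V q \<longleftrightarrow> mso_sat D' (<) v' V' q"
    by (rule Conj.IH(2)[OF Conj.prems(1)]) (use Conj.prems in auto)
  ultimately show ?case by simp
next
  case (Ex_elem i p)
  obtain l where k: "k = Suc l" using Ex_elem.prems(2) by (cases k) auto
  have len: "length Xs = length Ys"
    using ef_equiv_same_atoms[OF Ex_elem.prems(1)] by (rule same_atomsD)
  have step: "mso_sat D (<) (v(i := d)) V p \<longleftrightarrow> mso_sat D' (<) (v'(i := d')) V' p"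
    if "ef_equiv l D (Xs @ [{d}]) D' (Ys @ [{d'}])" for d d'
    by (rule Ex_elem.IH[OF that, of "pe(i := length Xs)" _ _ ps])
      (use Ex_elem.prems k len in \<open>auto simp: nth_append less_Suc_eq\<close>)
  have single: "(\<exists>x. X = {x}) \<longleftrightarrow> (\<exists>y. Y = {y})"
    if "ef_equiv l D (Xs @ [X]) D' (Ys @ [Y])" for X Y
    using same_atomsD(3)[OF ef_equiv_same_atoms[OF that], of "length Xs"] len by (simp add: nth_append)
  show ?case
  proof
    assume "mso_sat D (<) v V (Ex_elem i p)"
    then obtain d where d: "d \<in> D" "mso_sat D (<) (v(i := d)) V p" by auto
    then have "{d} \<subseteq> D" by simp
    then obtain Y where "Y \<subseteq> D'" "ef_equiv l D (Xs @ [{d}]) D' (Ys @ [Y])"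
      using Ex_elem.prems(1) unfolding k ef_equiv.simps by blast
    then show "mso_sat D' (<) v' V' (Ex_elem i p)"
      using single[of "{d}" Y] step[of d] d by auto
  next
    assume "mso_sat D' (<) v' V' (Ex_elem i p)"
    then obtain d where d: "d \<in> D'" "mso_sat D' (<) (v'(i := d)) V' p" by auto
    then have "{d} \<subseteq> D'" by simp
    then obtain X where "X \<subseteq> D" "ef_equiv l D (Xs @ [X]) D' (Ys @ [{d}])"
      using Ex_elem.prems(1) unfolding k ef_equiv.simps by blast
    then show "mso_sat D (<) v V (Ex_elem i p)"
      using single[of X "{d}"] step[of _ d] d by auto
  qed
next
  case (Ex_set j p)
  obtain l where k: "k = Suc l" using Ex_set.prems(2) by (cases k) auto
  have len: "length Xs = length Ys"
    using ef_equiv_same_atoms[OF Ex_set.prems(1)] by (rule same_atomsD)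
  have "mso_sat D (<) v (V(j := X)) p \<longleftrightarrow> mso_sat D' (<) v' (V'(j := Y)) p"
    if "ef_equiv l D (Xs @ [X]) D' (Ys @ [Y])" for X Y
    by (rule Ex_set.IH[OF that, of pe _ _ "ps(j := length Xs)"])
      (use Ex_set.prems k len in \<open>auto simp: nth_append less_Suc_eq\<close>)
  then show ?case using Ex_set.prems(1) unfolding k mso_sat.simps ef_equiv.simps by meson
qed

subsection \<open>Finite index\<close>

lemma finite_range_colouring:
  fixes g :: "'a \<Rightarrow> 'b"
  assumes "finite F" "\<And>x. g x \<in> F"
  shows "\<exists>(c :: 'a \<Rightarrow> nat) N. (\<forall>x. c x < N) \<and> (\<forall>x y. c x = c y \<longrightarrow> g x = g y)"
proof -
  obtain f :: "'b \<Rightarrow> nat" and n where "f ` F = {i. i < n}" "inj_on f F"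
    using finite_imp_inj_to_nat_seg[OF assms(1)] by blast
  then show ?thesis
    using assms(2) by (intro exI[of _ "f \<circ> g"] exI[of _ n]) (auto dest: inj_onD)
qed

text \<open>A position is coloured by the set of colours of its one-set extensions, a subset of a
  finite set. Extending makes the list longer, so l is free in the induction on k.\<close>

lemma ef_equiv_finite_index:
  "\<exists>(c :: 'a::linorder set \<times> 'a set list \<Rightarrow> nat) N. (\<forall>s. c s < N) \<and>
     (\<forall>D Xs D' Ys. length Xs = l \<longrightarrow> length Ys = l \<longrightarrow> c (D, Xs) = c (D', Ys) \<longrightarrow> ef_equiv k D Xs D' Ys)"
proof (induction k arbitrary: l)
  case 0
  let ?S = "{..<l} \<times> {..<l}"
  define g where "g = (\<lambda>(D :: 'a set, Xs :: 'a set list). (\<lambda>(i, j). (i, j, atoms Xs i j)) ` ?S)"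
  have "finite (Pow ({..<l} \<times> {..<l} \<times> (UNIV :: (bool \<times> bool \<times> bool \<times> bool) set)))" by simp
  moreover have "g s \<in> Pow ({..<l} \<times> {..<l} \<times> UNIV)" for s
    by (auto simp: g_def split: prod.splits)
  ultimately have "\<exists>(c :: 'a set \<times> 'a set list \<Rightarrow> nat) N. (\<forall>x. c x < N) \<and> (\<forall>x y. c x = c y \<longrightarrow> g x = g y)"
    by (rule finite_range_colouring)
  then obtain c :: "'a set \<times> 'a set list \<Rightarrow> nat" and N where
    c: "\<And>x. c x < N" "\<And>x y. c x = c y \<Longrightarrow> g x = g y"
    by blast
  have "ef_equiv 0 D Xs D' Ys" if "length Xs = l" "length Ys = l" "g (D, Xs) = g (D', Ys)"
    for D Xs D' Ys
    unfolding same_atoms_def ef_equiv.simps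
  proof (intro conjI allI impI)
    fix i j assume "i < length Xs" "j < length Xs"
    then have "(i, j, atoms Xs i j) \<in> g (D', Ys)"
      using that unfolding that(3)[symmetric] by (auto simp: g_def)
    then show "atoms Xs i j = atoms Ys i j" by (auto simp: g_def)
  qed (use that in simp)
  then show ?case using c by (intro exI[of _ c] exI[of _ N] conjI allI impI) blast+
next
  case (Suc k)
  obtain c :: "'a set \<times> 'a set list \<Rightarrow> nat" and N where c: "\<And>s. c s < N"
    "\<And>D Xs D' Ys. length Xs = Suc l \<Longrightarrow> length Ys = Suc l \<Longrightarrow> c (D, Xs) = c (D', Ys) \<Longrightarrow> ef_equiv k D Xs D' Ys"
    using Suc.IH[of "Suc l"] by blast
  define g where "g = (\<lambda>(D, Xs). (\<lambda>X. c (D, Xs @ [X])) ` Pow D)"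
  have "finite (Pow {..<N})" by simp
  moreover have "g s \<in> Pow {..<N}" for s
    using c(1) by (auto simp: g_def split: prod.splits)
  ultimately have "\<exists>(c :: 'a set \<times> 'a set list \<Rightarrow> nat) N. (\<forall>x. c x < N) \<and> (\<forall>x y. c x = c y \<longrightarrow> g x = g y)"
    by (rule finite_range_colouring)
  then obtain c' :: "'a set \<times> 'a set list \<Rightarrow> nat" and N' where
    c': "\<And>x. c' x < N'" "\<And>x y. c' x = c' y \<Longrightarrow> g x = g y"
    by blast
  have "ef_equiv (Suc k) D Xs D' Ys"
    if l: "length Xs = l" "length Ys = l" and g: "g (D, Xs) = g (D', Ys)" for D Xs D' Ys
    unfolding ef_equiv.simps
  proof (intro conjI allI impI)
    fix X assume "X \<subseteq> D"
    then have "c (D, Xs @ [X]) \<in> g (D', Ys)" unfolding g[symmetric] by (auto simp: g_def)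
    then obtain Y where Y: "Y \<subseteq> D'" "c (D, Xs @ [X]) = c (D', Ys @ [Y])"
      by (auto simp: g_def)
    have "ef_equiv k D (Xs @ [X]) D' (Ys @ [Y])" by (rule c(2)) (use l Y in simp_all)
    then show "\<exists>Y\<subseteq>D'. ef_equiv k D (Xs @ [X]) D' (Ys @ [Y])" using Y(1) by blast
  next
    fix Y assume "Y \<subseteq> D'"
    then have "c (D', Ys @ [Y]) \<in> g (D, Xs)" unfolding g by (auto simp: g_def)
    then obtain X where X: "X \<subseteq> D" "c (D, Xs @ [X]) = c (D', Ys @ [Y])"
      by (auto simp: g_def)
    have "ef_equiv k D (Xs @ [X]) D' (Ys @ [Y])" by (rule c(2)) (use l X in simp_all)
    then show "\<exists>X\<subseteq>D. ef_equiv k D (Xs @ [X]) D' (Ys @ [Y])" using X(1) by blast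
  qed
  then show ?case using c' by (intro exI[of _ c'] exI[of _ N'] conjI allI impI) blast+
qed

subsection \<open>Isomorphisms and ordered sums\<close>

lemma ef_equiv_iso:
  assumes f: "strict_mono_on D f"
  shows "(\<And>X. X \<in> set Xs \<Longrightarrow> X \<subseteq> D) \<Longrightarrow> ef_equiv k D Xs (f ` D) (map ((`) f) Xs)"
proof (induction k arbitrary: Xs)
  case 0
  have inj: "inj_on f D" using f by (rule strict_mono_on_imp_inj_on)
  have sub: "f ` X \<subseteq> f ` Y \<longleftrightarrow> X \<subseteq> Y" if "X \<subseteq> D" "Y \<subseteq> D" for X Y
    using inj_on_image_mem_iff[OF inj] that by blast
  have "(\<exists>y. f ` X = {y}) \<longleftrightarrow> (\<exists>x. X = {x})" if "X \<subseteq> D" for X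
  proof
    assume "\<exists>y. f ` X = {y}"
    then obtain y where y: "f ` X = {y}" ..
    then obtain x where x: "x \<in> X" by auto
    have "X \<subseteq> {x}"
    proof
      fix z assume "z \<in> X"
      then have "f z \<in> {y}" "f x \<in> {y}" using x y by blast+
      then have "f z = f x" by simp
      then show "z \<in> {x}" using inj that x \<open>z \<in> X\<close> by (auto dest: inj_onD)
    qed
    then show "\<exists>x. X = {x}" using x by auto
  qed auto
  moreover have "some_before (f ` X) (f ` Y) \<longleftrightarrow> some_before X Y" if "X \<subseteq> D" "Y \<subseteq> D" for X Y
  proof -
    have "f x < f y \<longleftrightarrow> x < y" if "x \<in> X" "y \<in> Y" for x y
      using strict_mono_on_less[OF f, of x y] that \<open>X \<subseteq> D\<close> \<open>Y \<subseteq> D\<close> by blast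
    then show ?thesis unfolding some_before_def by blast
  qed
  moreover have "Xs ! i \<subseteq> D" if "i < length Xs" for i
    using 0 that by simp
  ultimately show ?case
    unfolding ef_equiv.simps by (intro same_atomsI) (simp_all add: sub)
next
  case (Suc k)
  have step: "ef_equiv k D (Xs @ [X]) (f ` D) (map ((`) f) Xs @ [f ` X])" if "X \<subseteq> D" for X
    using Suc.IH[of "Xs @ [X]"] Suc.prems that by auto
  then show ?case
    unfolding ef_equiv.simps by (metis image_mono subset_imageE)
qed

definition separated :: "('i::linorder \<Rightarrow> 'a::linorder set) \<Rightarrow> bool" where
  "separated D \<longleftrightarrow> (\<forall>i j. i < j \<longrightarrow> (\<forall>x\<in>D i. \<forall>y\<in>D j. x < y))"

lemma separatedD: "separated D \<Longrightarrow> i < j \<Longrightarrow> x \<in> D i \<Longrightarrow> y \<in> D j \<Longrightarrow> x < y"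
  unfolding separated_def by blast

lemma separated_disjoint: "separated D \<Longrightarrow> i \<noteq> j \<Longrightarrow> D i \<inter> D j = {}"
  unfolding separated_def by (metis disjoint_iff less_irrefl neqE)

abbreviation pieces :: "'a set \<Rightarrow> 'a set list \<Rightarrow> 'a set list" where
  "pieces E Xs \<equiv> map (\<lambda>X. X \<inter> E) Xs"

lemma snoc_subset:
  "W \<in> set (Xs @ [X]) \<Longrightarrow> (\<And>W. W \<in> set Xs \<Longrightarrow> W \<subseteq> U) \<Longrightarrow> X \<subseteq> U \<Longrightarrow> W \<subseteq> U"
  by (cases "W \<in> set Xs") simp_all

text \<open>A move in a sum splits into moves in the components, the replies there are glued to a
  reply in the whole, and the atoms of the whole can be read off from those of the
  components.\<close>

lemma ef_equiv_sum:
  fixes D D' :: "'i::linorder \<Rightarrow> 'a::linorder set"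
  assumes "separated D" "separated D'"
    and "length Xs = length Ys"
    and "\<And>i. ef_equiv k (D i) (pieces (D i) Xs) (D' i) (pieces (D' i) Ys)"
    and "\<And>X. X \<in> set Xs \<Longrightarrow> X \<subseteq> (\<Union>i. D i)" "\<And>Y. Y \<in> set Ys \<Longrightarrow> Y \<subseteq> (\<Union>i. D' i)"
  shows "ef_equiv k (\<Union>i. D i) Xs (\<Union>i. D' i) Ys"
  using assms
proof (induction k arbitrary: D D' Xs Ys)
  case 0
  note ord = 0(1,2)
  have comp: "\<And>i a. a < length Xs \<Longrightarrow> Xs ! a \<inter> D i = {} \<longleftrightarrow> Ys ! a \<inter> D' i = {}"
    "\<And>i a. a < length Xs \<Longrightarrow> (\<exists>x. Xs ! a \<inter> D i = {x}) \<longleftrightarrow> (\<exists>y. Ys ! a \<inter> D' i = {y})"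
    "\<And>i a b. a < length Xs \<Longrightarrow> b < length Xs \<Longrightarrow>
       Xs ! a \<inter> D i \<subseteq> Xs ! b \<inter> D i \<longleftrightarrow> Ys ! a \<inter> D' i \<subseteq> Ys ! b \<inter> D' i"
    "\<And>i a b. a < length Xs \<Longrightarrow> b < length Xs \<Longrightarrow>
       some_before (Xs ! a \<inter> D i) (Xs ! b \<inter> D i) \<longleftrightarrow> some_before (Ys ! a \<inter> D' i) (Ys ! b \<inter> D' i)"
    using same_atomsD[OF 0(4)[unfolded ef_equiv.simps]] 0(3) by simp_all
  have sub: "\<And>a. a < length Xs \<Longrightarrow> Xs ! a \<subseteq> (\<Union>i. D i)" "\<And>a. a < length Xs \<Longrightarrow> Ys ! a \<subseteq> (\<Union>i. D' i)"
    using 0(3,5,6) by auto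
  have empty: "X = {} \<longleftrightarrow> (\<forall>i. X \<inter> E i = {})" if "X \<subseteq> (\<Union>i. E i)"
    for X :: "'a set" and E :: "'i \<Rightarrow> 'a set"
    using that by blast
  have subs: "X \<subseteq> Y \<longleftrightarrow> (\<forall>i. X \<inter> E i \<subseteq> Y \<inter> E i)" if "X \<subseteq> (\<Union>i. E i)"
    for X Y :: "'a set" and E :: "'i \<Rightarrow> 'a set"
    using that by blast
  have sing: "(\<exists>x. X = {x}) \<longleftrightarrow> (\<exists>i. (\<exists>x. X \<inter> E i = {x}) \<and> (\<forall>j. j \<noteq> i \<longrightarrow> X \<inter> E j = {}))"
    if X: "X \<subseteq> (\<Union>i. E i)" and E: "separated E"
    for X :: "'a set" and E :: "'i \<Rightarrow> 'a set"
  proof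
    assume "\<exists>x. X = {x}"
    then obtain x where x: "X = {x}" ..
    then obtain i where i: "x \<in> E i" using X by auto
    have "x \<notin> E j" if "j \<noteq> i" for j
    proof
      assume "x \<in> E j"
      with i separated_disjoint[OF E that] show False by blast
    qed
    then have "\<forall>j. j \<noteq> i \<longrightarrow> X \<inter> E j = {}" unfolding x by blast
    moreover have "X \<inter> E i = {x}" using i unfolding x by blast
    ultimately show "\<exists>i. (\<exists>x. X \<inter> E i = {x}) \<and> (\<forall>j. j \<noteq> i \<longrightarrow> X \<inter> E j = {})" by blast
  next
    assume "\<exists>i. (\<exists>x. X \<inter> E i = {x}) \<and> (\<forall>j. j \<noteq> i \<longrightarrow> X \<inter> E j = {})"
    then obtain i x where ix: "X \<inter> E i = {x}" "\<forall>j. j \<noteq> i \<longrightarrow> X \<inter> E j = {}" by blast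
    have "X \<subseteq> E i"
    proof
      fix y assume "y \<in> X"
      then obtain j where "y \<in> E j" using X by auto
      then show "y \<in> E i" using ix(2) \<open>y \<in> X\<close> by (cases "j = i") auto
    qed
    then show "\<exists>x. X = {x}" using ix(1) by (metis Int_absorb2)
  qed
  have before: "some_before X Y \<longleftrightarrow> (\<exists>i. some_before (X \<inter> E i) (Y \<inter> E i)) \<or>
      (\<exists>i j. i < j \<and> X \<inter> E i \<noteq> {} \<and> Y \<inter> E j \<noteq> {})"
    if X: "X \<subseteq> (\<Union>i. E i)" and Y: "Y \<subseteq> (\<Union>i. E i)"
      and E: "separated E"
    for X Y :: "'a set" and E :: "'i \<Rightarrow> 'a set"
  proof
    assume "some_before X Y"
    then obtain x y where xy: "x \<in> X" "y \<in> Y" "x < y" by (auto simp: some_before_def)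
    obtain i j where ij: "x \<in> E i" "y \<in> E j" using xy X Y by blast
    have "\<not> j < i" using separatedD[OF E _ ij(2,1)] xy(3) by auto
    then consider "i = j" | "i < j" by force
    then show "(\<exists>i. some_before (X \<inter> E i) (Y \<inter> E i)) \<or>
      (\<exists>i j. i < j \<and> X \<inter> E i \<noteq> {} \<and> Y \<inter> E j \<noteq> {})"
    proof cases
      case 1
      then have "some_before (X \<inter> E i) (Y \<inter> E i)"
        using xy ij unfolding some_before_def by blast
      then show ?thesis by blast
    next
      case 2
      then show ?thesis using xy ij by blast
    qed
  next
    assume "(\<exists>i. some_before (X \<inter> E i) (Y \<inter> E i)) \<or>
      (\<exists>i j. i < j \<and> X \<inter> E i \<noteq> {} \<and> Y \<inter> E j \<noteq> {})"
    then show "some_before X Y"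
    proof (elim disjE exE conjE)
      fix i j assume "i < j" "X \<inter> E i \<noteq> {}" "Y \<inter> E j \<noteq> {}"
      then obtain x y where "x \<in> X" "x \<in> E i" "y \<in> Y" "y \<in> E j" by blast
      then show ?thesis using separatedD[OF E \<open>i < j\<close>] unfolding some_before_def by blast
    next
      fix i assume "some_before (X \<inter> E i) (Y \<inter> E i)"
      then show ?thesis unfolding some_before_def by blast
    qed
  qed
  show ?case
    unfolding ef_equiv.simps
  proof (rule same_atomsI)
    show "length Xs = length Ys" by fact
  next
    fix a assume a: "a < length Xs"
    show "Xs ! a = {} \<longleftrightarrow> Ys ! a = {}"
      unfolding empty[OF sub(1)[OF a]] empty[OF sub(2)[OF a]] using comp(1)[OF a] by simp
    show "(\<exists>x. Xs ! a = {x}) \<longleftrightarrow> (\<exists>y. Ys ! a = {y})"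
    proof -
      have "(\<exists>x. Xs ! a = {x}) \<longleftrightarrow>
          (\<exists>i. (\<exists>x. Xs ! a \<inter> D i = {x}) \<and> (\<forall>j. j \<noteq> i \<longrightarrow> Xs ! a \<inter> D j = {}))"
        using sub(1)[OF a] ord(1) by (rule sing)
      also have "\<dots> \<longleftrightarrow> (\<exists>i. (\<exists>x. Ys ! a \<inter> D' i = {x}) \<and> (\<forall>j. j \<noteq> i \<longrightarrow> Ys ! a \<inter> D' j = {}))"
        by (simp only: comp(1,2)[OF a])
      also have "\<dots> \<longleftrightarrow> (\<exists>y. Ys ! a = {y})"
        using sub(2)[OF a] ord(2) by (rule sing[symmetric])
      finally show ?thesis .
    qed
  next
    fix a b assume a: "a < length Xs" and b: "b < length Xs"
    show "Xs ! a \<subseteq> Xs ! b \<longleftrightarrow> Ys ! a \<subseteq> Ys ! b"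
      unfolding subs[OF sub(1)[OF a]] subs[OF sub(2)[OF a]] comp(3)[OF a b] ..
    show "some_before (Xs ! a) (Xs ! b) \<longleftrightarrow> some_before (Ys ! a) (Ys ! b)"
    proof -
      have "some_before (Xs ! a) (Xs ! b) \<longleftrightarrow> (\<exists>i. some_before (Xs ! a \<inter> D i) (Xs ! b \<inter> D i)) \<or>
          (\<exists>i j. i < j \<and> Xs ! a \<inter> D i \<noteq> {} \<and> Xs ! b \<inter> D j \<noteq> {})"
        using sub(1)[OF a] sub(1)[OF b] ord(1) by (rule before)
      also have "\<dots> \<longleftrightarrow> (\<exists>i. some_before (Ys ! a \<inter> D' i) (Ys ! b \<inter> D' i)) \<or>
          (\<exists>i j. i < j \<and> Ys ! a \<inter> D' i \<noteq> {} \<and> Ys ! b \<inter> D' j \<noteq> {})"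
        by (simp only: comp(1)[OF a] comp(1)[OF b] comp(4)[OF a b])
      also have "\<dots> \<longleftrightarrow> some_before (Ys ! a) (Ys ! b)"
        using sub(2)[OF a] sub(2)[OF b] ord(2) by (rule before[symmetric])
      finally show ?thesis .
    qed
  qed
next
  case (Suc k)
  have glue: "(\<Union>j. Z j) \<inter> E i = Z i"
    if Z: "\<And>j. Z j \<subseteq> E j" and E: "separated E"
    for i and Z E :: "'i \<Rightarrow> 'a set"
  proof -
    have "E j \<inter> E i = {}" if "j \<noteq> i" for j
      using E that by (rule separated_disjoint)
    then have "x \<in> Z i" if "x \<in> Z j" "x \<in> E i" for x j
      using that Z[of j] by (cases "j = i") auto
    then show ?thesis using Z[of i] by auto
  qed
  \<comment> \<open>Stated with fresh variables, since the back direction is this one with the two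
    sides exchanged.\<close>
  have forth: "\<exists>Y\<subseteq>\<Union>i. D' i. ef_equiv k (\<Union>i. D i) (Xs @ [X]) (\<Union>i. D' i) (Ys @ [Y])"
    if ord: "separated D" "separated D'"
      and len: "length Xs = length Ys"
      and comp: "\<And>i. ef_equiv (Suc k) (D i) (pieces (D i) Xs) (D' i) (pieces (D' i) Ys)"
      and subs: "\<And>X. X \<in> set Xs \<Longrightarrow> X \<subseteq> (\<Union>i. D i)" "\<And>Y. Y \<in> set Ys \<Longrightarrow> Y \<subseteq> (\<Union>i. D' i)"
      and X: "X \<subseteq> (\<Union>i. D i)"
    for D D' :: "'i \<Rightarrow> 'a set" and Xs Ys X
  proof -
    have "\<exists>Y\<subseteq>D' i. ef_equiv k (D i) (pieces (D i) Xs @ [X \<inter> D i]) (D' i) (pieces (D' i) Ys @ [Y])" for i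
      using comp[of i] by simp
    then obtain Z where Z: "\<And>i. Z i \<subseteq> D' i"
      "\<And>i. ef_equiv k (D i) (pieces (D i) Xs @ [X \<inter> D i]) (D' i) (pieces (D' i) Ys @ [Z i])"
      by metis
    have "ef_equiv k (\<Union>i. D i) (Xs @ [X]) (\<Union>i. D' i) (Ys @ [\<Union>i. Z i])"
    proof (rule Suc.IH[OF ord])
      show "ef_equiv k (D i) (pieces (D i) (Xs @ [X])) (D' i) (pieces (D' i) (Ys @ [\<Union>i. Z i]))" for i
        using Z(2)[of i] glue[of Z D' i, OF Z(1) ord(2)] by simp
      show "length (Xs @ [X]) = length (Ys @ [\<Union>i. Z i])" using len by simp
      show "W \<subseteq> (\<Union>i. D i)" if "W \<in> set (Xs @ [X])" for W
        using that subs(1) X by (rule snoc_subset)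
      show "W \<subseteq> (\<Union>i. D' i)" if "W \<in> set (Ys @ [\<Union>i. Z i])" for W
        using that subs(2) UN_mono[OF subset_refl Z(1)] by (rule snoc_subset)
    qed
    then show ?thesis
      using UN_mono[OF subset_refl Z(1)] by (intro exI[of _ "\<Union>i. Z i"] conjI)
  qed
  show ?case
    unfolding ef_equiv.simps
  proof (intro conjI allI impI)
    show "\<exists>Y\<subseteq>\<Union>i. D' i. ef_equiv k (\<Union>i. D i) (Xs @ [X]) (\<Union>i. D' i) (Ys @ [Y])"
      if "X \<subseteq> (\<Union>i. D i)" for X
      using Suc.prems that by (rule forth)
    show "\<exists>X\<subseteq>\<Union>i. D i. ef_equiv k (\<Union>i. D i) (Xs @ [X]) (\<Union>i. D' i) (Ys @ [Y])"
      if "Y \<subseteq> (\<Union>i. D' i)" for Y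
    proof -
      have "\<exists>X\<subseteq>\<Union>i. D i. ef_equiv k (\<Union>i. D' i) (Ys @ [Y]) (\<Union>i. D i) (Xs @ [X])"
        using Suc.prems(2,1) Suc.prems(3)[symmetric] ef_equiv_sym[OF Suc.prems(4)] Suc.prems(6,5) that
        by (rule forth)
      then show ?thesis by (auto intro: ef_equiv_sym)
    qed
  qed
qed

section \<open>Monadic second order types of ordinals\<close>

definition ord_equiv :: "nat \<Rightarrow> ordinal \<Rightarrow> ordinal \<Rightarrow> bool" where
  "ord_equiv k a b \<longleftrightarrow> ef_equiv k {..<a} [] {..<b} []"

lemma ord_equiv_refl [simp]: "ord_equiv k a a"
  by (simp add: ord_equiv_def ef_equiv_refl)

lemma ord_equiv_sym: "ord_equiv k a b \<Longrightarrow> ord_equiv k b a"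
  unfolding ord_equiv_def by (rule ef_equiv_sym)

lemma ord_equiv_trans [trans]: "ord_equiv k a b \<Longrightarrow> ord_equiv k b c \<Longrightarrow> ord_equiv k a c"
  unfolding ord_equiv_def by (rule ef_equiv_trans)

lemma ord_equiv_models:
  assumes "ord_equiv (set_rank p) a b" "mso_sentence p"
  shows "a \<Turnstile> p \<longleftrightarrow> b \<Turnstile> p"
  using assms unfolding ord_models_def ord_equiv_def mso_sentence_def
  by (intro ef_equiv_mso_sat) auto

lemma ord_equiv_pigeonhole:
  obtains i j where "i < j" "ord_equiv k (f i) (f (j :: nat))"
proof -
  obtain c :: "ordinal set \<times> ordinal set list \<Rightarrow> nat" and N where c: "\<And>s. c s < N"
    "\<And>D D'. c (D, []) = c (D', []) \<Longrightarrow> ef_equiv k D [] D' []"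
    using ef_equiv_finite_index[of 0 k, where 'a = ordinal] by (metis list.size(3))
  have "\<not> inj (\<lambda>i. c ({..<f i}, []))"
  proof
    assume "inj (\<lambda>i. c ({..<f i}, []))"
    moreover have "finite (range (\<lambda>i. c ({..<f i}, [])))"
      by (rule finite_subset[of _ "{..<N}"]) (use c(1) in auto)
    ultimately show False using finite_imageD by blast
  qed
  then obtain i j where "i \<noteq> j" "c ({..<f i}, []) = c ({..<f j}, [])" by (auto simp: inj_def)
  then have "i \<noteq> j" "ord_equiv k (f i) (f j)" using c(2) by (auto simp: ord_equiv_def)
  then show thesis using that ord_equiv_sym by (metis linorder_cases)
qed

section \<open>Omega-sums of ordinals\<close>

primrec psum :: "(nat \<Rightarrow> ordinal) \<Rightarrow> nat \<Rightarrow> ordinal" where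
  "psum f 0 = 0"
| "psum f (Suc n) = psum f n + f n"

definition osum :: "(nat \<Rightarrow> ordinal) \<Rightarrow> ordinal" where "osum f = (SUP n. psum f n)"

lemma psum_mono: "m \<le> n \<Longrightarrow> psum f m \<le> psum f n"
  by (rule lift_Suc_mono_le) auto

lemma less_osum_iff: "x < osum f \<longleftrightarrow> (\<exists>n. x < psum f n)"
  by (simp add: osum_def ordinal_less_SUP_iff)

lemma lessThan_osum: "{..<osum f} = (\<Union>n. {psum f n..<psum f (Suc n)})"
proof (intro equalityI subsetI)
  fix x assume "x \<in> {..<osum f}"
  then have ex: "\<exists>n. x < psum f n" by (simp add: less_osum_iff)
  define n where "n = (LEAST n. x < psum f n)"
  have n: "x < psum f n" unfolding n_def using ex by (rule LeastI_ex)
  then obtain l where l: "n = Suc l" by (cases n) auto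
  then have "psum f l \<le> x" using not_less_Least[of l "\<lambda>n. x < psum f n"] by (simp add: n_def)
  then show "x \<in> (\<Union>n. {psum f n..<psum f (Suc n)})" using n l by auto
next
  fix x assume "x \<in> (\<Union>n. {psum f n..<psum f (Suc n)})"
  then obtain n where "x < psum f (Suc n)" by auto
  then show "x \<in> {..<osum f}" unfolding lessThan_iff less_osum_iff by blast
qed

lemma ef_equiv_interval: "ef_equiv k {..<b} [] {a..<a + b :: ordinal} []"
proof -
  have "(\<lambda>x. a + x) ` {..<b} = {a..<a + b}"
  proof (intro equalityI subsetI)
    fix x assume x: "x \<in> {a..<a + b}"
    then have "a \<le> x" by simp
    then obtain c where "x = a + c" by (rule ordinal_le_imp_diff)
    with x show "x \<in> (\<lambda>x. a + x) ` {..<b}" by auto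
  qed auto
  moreover have "strict_mono_on {..<b} (\<lambda>x. a + x)" by (simp add: strict_mono_on_def)
  ultimately show ?thesis using ef_equiv_iso[of "{..<b}" "\<lambda>x. a + x" "[]" k] by simp
qed

lemma ord_equiv_osum:
  assumes "\<And>i. ord_equiv k (f i) (g i)"
  shows "ord_equiv k (osum f) (osum g)"
proof -
  have sep: "separated (\<lambda>i. {psum f i..<psum f (Suc i)})" for f
    unfolding separated_def
  proof (intro allI impI ballI)
    fix i j x y assume "i < j" "x \<in> {psum f i..<psum f (Suc i)}" "y \<in> {psum f j..<psum f (Suc j)}"
    then show "x < y"
      using psum_mono[of "Suc i" j f] by (auto intro: less_le_trans order_trans)
  qed
  have "ef_equiv k {psum f i..<psum f (Suc i)} [] {psum g i..<psum g (Suc i)} []" for i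
    using ef_equiv_trans[OF ef_equiv_sym[OF ef_equiv_interval]
        ef_equiv_trans[OF assms[of i, unfolded ord_equiv_def] ef_equiv_interval]]
    by simp
  then show ?thesis
    unfolding ord_equiv_def lessThan_osum
    by (intro ef_equiv_sum sep) auto
qed

text \<open>A binary sum is an omega-sum padded with empty pieces.\<close>

lemma ord_equiv_add:
  assumes "ord_equiv k a a'" "ord_equiv k b b'"
  shows "ord_equiv k (a + b) (a' + b')"
proof -
  define f where "f a b i = (if i = 0 then a else if i = Suc 0 then b else 0)" for a b :: ordinal and i :: nat
  have "osum (f a b) = a + b" for a b
  proof (rule ordinal_eqI)
    have ps: "psum (f a b) (Suc (Suc n)) = a + b" for n
      by (induction n) (simp_all add: f_def)
    show "z < osum (f a b) \<longleftrightarrow> z < a + b" for z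
    proof
      assume "z < osum (f a b)"
      then obtain n where "z < psum (f a b) n" by (auto simp: less_osum_iff)
      also have "\<dots> \<le> psum (f a b) (Suc (Suc n))" by (rule psum_mono) simp
      finally show "z < a + b" unfolding ps .
    qed (use ps less_osum_iff in metis)
  qed
  moreover have "ord_equiv k (osum (f a b)) (osum (f a' b'))"
    by (rule ord_equiv_osum) (use assms in \<open>auto simp: f_def\<close>)
  ultimately show ?thesis by simp
qed

lemma psum_const: "psum (\<lambda>_. a) n = ntimes n a"
  by (induction n) simp_all

lemma osum_omega_pow: "osum (\<lambda>_. omega_pow e) = omega_pow (osucc e)"
proof (rule ordinal_eqI)
  fix z
  have "z < omega_pow (osucc e) \<longleftrightarrow> (\<exists>n. z < ntimes n (omega_pow e))"
  proof
    assume z: "z < omega_pow (osucc e)"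
    show "\<exists>n. z < ntimes n (omega_pow e)"
    proof (cases "z = 0")
      case True
      then show ?thesis by (intro exI[of _ 1]) simp
    next
      case False
      then obtain c n where c: "c < osucc e" "z < ntimes n (omega_pow c)"
        using z by (auto simp: less_omega_pow_iff)
      then have "ntimes n (omega_pow c) \<le> ntimes n (omega_pow e)"
        by (intro ntimes_mono) (simp add: less_osucc_iff)
      then show ?thesis using c less_le_trans by blast
    qed
  next
    assume "\<exists>n. z < ntimes n (omega_pow e)"
    then show "z < omega_pow (osucc e)"
      using ntimes_omega_pow_less[OF less_osucc[of e]] by (meson less_trans)
  qed
  then show "z < osum (\<lambda>_. omega_pow e) \<longleftrightarrow> z < omega_pow (osucc e)"
    by (simp add: less_osum_iff psum_const)
qed

text \<open>Each omega^e is absorbed by the omega^(e+1) of the next summand, so the sum is that of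
  omega copies of omega^(e+1).\<close>

lemma osum_omega_pow_add: "osum (\<lambda>_. omega_pow (osucc e) + omega_pow e) = omega_pow (osucc (osucc e))"
proof (rule order.antisym)
  let ?t = "omega_pow (osucc e) + omega_pow e"
  have "?t < omega_pow (osucc (osucc e))"
    by (intro omega_pow_add_closed omega_pow_strict_mono less_osucc less_trans[OF less_osucc less_osucc])
  then have "ntimes n ?t < omega_pow (osucc (osucc e))" for n
    by (induction n) (auto intro: omega_pow_add_closed)
  then show "osum (\<lambda>_. ?t) \<le> omega_pow (osucc (osucc e))"
    by (auto simp: osum_def psum_const ordinal_SUP_le_iff intro: less_imp_le)
  show "omega_pow (osucc (osucc e)) \<le> osum (\<lambda>_. ?t)"
  proof (rule ccontr)
    assume "\<not> ?thesis"
    then obtain n where "osum (\<lambda>_. ?t) < ntimes n (omega_pow (osucc e))"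
      unfolding not_le osum_omega_pow[symmetric] less_osum_iff psum_const by blast
    also have "\<dots> \<le> ntimes n ?t" by (rule ntimes_mono) simp
    finally show False using less_osum_iff[of "osum (\<lambda>_. ?t)" "\<lambda>_. ?t"] by (auto simp: psum_const)
  qed
qed

text \<open>Serves inductions on the exponent that include limits: even there a power is an
  omega-sum of smaller powers, with exponents bounded below by a prescribed d.\<close>

lemma omega_pow_as_osum:
  assumes "d < e"
  obtains c where "\<And>i. d \<le> c i" "\<And>i. c i < e" "osum (\<lambda>i. omega_pow (c i)) = omega_pow e"
proof -
  have ne: "{d..<e} \<noteq> {}" using assms by auto
  have cnt: "countable {d..<e}"
    by (rule countable_subset[OF _ countable_lessThan_ordinal[of e]]) auto
  \<comment> \<open>Decoding pairs lists every exponent of the countable set infinitely often. Hence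
    the partial sums reach every finite multiple of omega^x for every listed x.\<close>
  define c where "c i = from_nat_into {d..<e} (fst (prod_decode i))" for i
  have c: "c i \<in> {d..<e}" for i unfolding c_def by (rule from_nat_into[OF ne])
  have "psum (\<lambda>i. omega_pow (c i)) n < omega_pow e" for n
    by (induction n) (use c in \<open>auto intro!: omega_pow_add_closed\<close>)
  then have "osum (\<lambda>i. omega_pow (c i)) \<le> omega_pow e"
    by (auto simp: osum_def ordinal_SUP_le_iff intro: less_imp_le)
  moreover have "omega_pow e \<le> osum (\<lambda>i. omega_pow (c i))"
  proof (rule ccontr)
    let ?s = "osum (\<lambda>i. omega_pow (c i))"
    have mult: "\<exists>n. ntimes k (omega_pow x) \<le> psum (\<lambda>i. omega_pow (c i)) n" if x: "x \<in> {d..<e}" for k x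
    proof (induction k)
      case (Suc k)
      then obtain n where n: "ntimes k (omega_pow x) \<le> psum (\<lambda>i. omega_pow (c i)) n" by blast
      obtain j where j: "from_nat_into {d..<e} j = x"
        using from_nat_into_surj[OF cnt x] by blast
      define i where "i = prod_encode (j, n)"
      have "c i = x" by (simp add: c_def i_def j)
      have "n \<le> i" unfolding i_def by (rule le_prod_encode_2)
      then have "ntimes k (omega_pow x) \<le> psum (\<lambda>i. omega_pow (c i)) i"
        using n psum_mono order_trans by blast
      then have "ntimes (Suc k) (omega_pow x) \<le> psum (\<lambda>i. omega_pow (c i)) (Suc i)"
        by (simp add: \<open>c i = x\<close> ordinal_add_mono_left)
      then show ?case by blast
    qed simp
    assume "\<not> omega_pow e \<le> ?s"
    then have s: "?s < omega_pow e" by simp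
    have "\<exists>x n. x \<in> {d..<e} \<and> ?s < ntimes n (omega_pow x)"
    proof (cases "?s = 0")
      case True
      then show ?thesis using assms by (intro exI[of _ d] exI[of _ 1]) simp
    next
      case False
      then obtain x n where x: "x < e" "?s < ntimes n (omega_pow x)"
        using s by (auto simp: less_omega_pow_iff)
      moreover have "ntimes n (omega_pow x) \<le> ntimes n (omega_pow (max d x))"
        by (rule ntimes_mono) simp
      ultimately have "?s < ntimes n (omega_pow (max d x))" by (meson less_le_trans)
      then show ?thesis using x(1) assms by (intro exI[of _ "max d x"] exI[of _ n]) simp
    qed
    then obtain x n where "x \<in> {d..<e}" "?s < ntimes n (omega_pow x)" by blast
    then obtain n where "?s < psum (\<lambda>i. omega_pow (c i)) n" using mult less_le_trans by blast
    then have "?s < ?s" unfolding less_osum_iff by blast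
    then show False by simp
  qed
  ultimately show thesis using that[of c] c by (simp add: order.antisym)
qed

lemma fin_ord_osucc: "osucc (fin_ord n) = fin_ord (Suc n)"
  by (simp add: fin_ord_Suc osucc_eq)

text \<open>
  Pigeonhole gives \<open>\<omega>\<^sup>n \<equiv> \<omega>\<^bsup>n+p\<^esup>\<close> for large \<open>n\<close>, hence \<open>\<omega>\<^bsup>n+1\<^esup> + \<omega>\<^sup>n \<equiv> \<omega>\<^sup>n\<close>; summing
  \<open>\<omega>\<close> copies of both sides yields \<open>\<omega>\<^bsup>n+2\<^esup> \<equiv> \<omega>\<^bsup>n+1\<^esup>\<close>.
\<close>

lemma omega_pow_ord_equiv_stable:
  obtains m where "\<And>e. fin_ord m \<le> e \<Longrightarrow> ord_equiv k (omega_pow e) (fin_pow m)"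
proof -
  let ?W = "\<lambda>n. fin_pow n"
  obtain a b where ab: "a < b" "ord_equiv k (?W a) (?W b)"
    by (rule ord_equiv_pigeonhole)
  have succ: "ord_equiv k (omega_pow (osucc e)) (omega_pow (osucc f))"
    if "ord_equiv k (omega_pow e) (omega_pow f)" for e f
    unfolding osum_omega_pow[symmetric] by (rule ord_equiv_osum) (rule that)
  have shift: "ord_equiv k (?W (a + j)) (?W (b + j))" for j
  proof (induction j)
    case (Suc j)
    from succ[OF Suc] show ?case by (simp add: fin_ord_osucc)
  qed (simp add: ab)
  define p where "p = b - a"
  have p: "0 < p" using ab by (simp add: p_def)
  have per: "ord_equiv k (?W n) (?W (n + p))" if "a \<le> n" for n
    using shift[of "n - a"] that ab by (simp add: p_def add.commute)
  \<comment> \<open>After one period the exponent may be only n + 1; after two it exceeds n + 1, as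
    the absorption below requires.\<close>
  have per2: "ord_equiv k (?W n) (?W (n + p + p))" if "a \<le> n" for n
    using ord_equiv_trans[OF per per, of n] that by simp
  have absorb: "ord_equiv k (?W (Suc n) + ?W n) (?W n)" if "a \<le> n" for n
  proof -
    have "ord_equiv k (?W (Suc n) + ?W n) (?W (Suc n) + ?W (n + p + p))"
      by (intro ord_equiv_add per2[OF that]) simp
    also have "?W (Suc n) + ?W (n + p + p) = ?W (n + p + p)"
      using p by (intro add_omega_pow_absorb) simp
    also have "ord_equiv k (?W (n + p + p)) (?W n)"
      by (rule ord_equiv_sym[OF per2[OF that]])
    finally show ?thesis .
  qed
  have step: "ord_equiv k (?W (Suc (Suc n))) (?W (Suc n))" if "a \<le> n" for n
  proof -
    have "ord_equiv k (osum (\<lambda>_. ?W (Suc n) + ?W n)) (osum (\<lambda>_. ?W n))"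
      by (rule ord_equiv_osum) (rule absorb[OF that])
    then show ?thesis
      using osum_omega_pow_add[of "fin_ord n"] by (simp add: osum_omega_pow fin_ord_osucc)
  qed
  \<comment> \<open>The least exponent that occurs on the right of \<open>step\<close>.\<close>
  define m where "m = Suc a"
  have "ord_equiv k (omega_pow e) (?W m)" if "fin_ord m \<le> e" for e
    using that
  proof (induction e rule: less_induct)
    case (less e)
    show ?case
    proof (cases "e = fin_ord m")
      case False
      with less.prems have "fin_ord m < e" by simp
      then obtain c where c: "\<And>i. fin_ord m \<le> c i" "\<And>i. c i < e" "osum (\<lambda>i. omega_pow (c i)) = omega_pow e"
        by (rule omega_pow_as_osum) blast
      \<comment> \<open>By induction all summands are already equivalent to omega^m, so omega^e may
        be exchanged for omega^m * omega = omega^(m+1).\<close>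
      have "ord_equiv k (omega_pow e) (osum (\<lambda>_. ?W m))"
        unfolding c(3)[symmetric] by (rule ord_equiv_osum) (rule less.IH[OF c(2,1)])
      also have "osum (\<lambda>_. ?W m) = ?W (Suc m)" by (simp add: osum_omega_pow fin_ord_osucc)
      also have "ord_equiv k (?W (Suc m)) (?W m)" using step[of a] by (simp add: m_def)
      finally show ?thesis .
    qed simp
  qed
  then show thesis by (rule that)
qed

text \<open>Equivalent multiples stay equivalent when the same number of copies is added on the
  right, so one coincidence i < j gives the period j - i from i on.\<close>

lemma ntimes_ord_equiv_periodic:
  obtains K q where "q > 0"
    "\<And>a b. K \<le> a \<Longrightarrow> K \<le> b \<Longrightarrow> a mod q = b mod q \<Longrightarrow> ord_equiv k (ntimes a x) (ntimes b x)"
proof -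
  obtain i j where ij: "i < j" "ord_equiv k (ntimes i x) (ntimes j x)"
    by (rule ord_equiv_pigeonhole)
  define q where "q = j - i"
  have one: "ord_equiv k (ntimes n x) (ntimes (n + q) x)" if "i \<le> n" for n
  proof -
    have "ord_equiv k (ntimes i x + ntimes (n - i) x) (ntimes j x + ntimes (n - i) x)"
      by (intro ord_equiv_add ij) simp
    then show ?thesis using that ij(1) by (simp add: ntimes_add[symmetric] q_def add.commute)
  qed
  have per: "ord_equiv k (ntimes n x) (ntimes (n + s * q) x)" if "i \<le> n" for n s
  proof (induction s)
    case (Suc s)
    have "n + s * q + q = n + Suc s * q" by simp
    then show ?case using ord_equiv_trans[OF Suc one[of "n + s * q"]] that by (metis trans_le_add1)
  qed simp
  have le: "ord_equiv k (ntimes a x) (ntimes b x)" if "i \<le> a" "a \<le> b" "a mod q = b mod q" for a b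
  proof -
    from that(2,3) obtain s where "b = a + q * s"
      by (metis mod_eq_nat2E)
    then show ?thesis using per[OF that(1), of s] by (simp add: mult.commute)
  qed
  have "ord_equiv k (ntimes a x) (ntimes b x)" if "i \<le> a" "i \<le> b" "a mod q = b mod q" for a b
    using le[of a b] le[of b a] that ord_equiv_sym by (metis nat_le_linear)
  moreover have "q > 0" using ij by (simp add: q_def)
  ultimately show thesis using that by blast
qed

section \<open>Types determined by multiplicities\<close>

definition counts_agree :: "nat \<Rightarrow> nat \<Rightarrow> nat \<Rightarrow> ordinal multiset \<Rightarrow> ordinal multiset \<Rightarrow> bool" where
  "counts_agree m K q A B \<longleftrightarrow> (\<forall>i<m. count A (fin_ord i) = count B (fin_ord i) \<or>
    K \<le> count A (fin_ord i) \<and> K \<le> count B (fin_ord i) \<and>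
    count A (fin_ord i) mod q = count B (fin_ord i) mod q)"

lemma ord_of_mset_ord_equiv:
  obtains m K q where "q > 0"
    "\<And>A B. (\<exists>e\<in>#A. fin_ord m \<le> e) \<Longrightarrow> (\<exists>e\<in>#B. fin_ord m \<le> e) \<Longrightarrow> counts_agree m K q A B \<Longrightarrow>
      ord_equiv k (ord_of_mset A) (ord_of_mset B)"
proof -
  let ?W = "\<lambda>n. fin_pow n"
  obtain m where m: "\<And>e. fin_ord m \<le> e \<Longrightarrow> ord_equiv k (omega_pow e) (?W m)"
    by (rule omega_pow_ord_equiv_stable) blast
  \<comment> \<open>Exchanging the second summand for omega^(m+1) absorbs the first. So a nonempty
    sum of large powers collapses to a single omega^m.\<close>
  have idem: "ord_equiv k (?W m + ?W m) (?W m)"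
  proof -
    have "ord_equiv k (?W m + ?W m) (?W m + ?W (Suc m))"
      by (intro ord_equiv_add ord_equiv_sym[OF m]) simp_all
    also have "?W m + ?W (Suc m) = ?W (Suc m)" by (intro add_omega_pow_absorb) simp
    also have "ord_equiv k (?W (Suc m)) (?W m)" by (rule m) simp
    finally show ?thesis .
  qed
  have high: "ord_equiv k (cnf es) (?W m)" if "es \<noteq> []" "\<forall>e\<in>set es. fin_ord m \<le> e" for es
    using that
  proof (induction es rule: list_nonempty_induct)
    case (single e)
    then show ?case using m by simp
  next
    case (cons e es)
    then have "ord_equiv k (cnf (e # es)) (?W m + ?W m)"
      using m by (auto intro: ord_equiv_add)
    then show ?case using idem ord_equiv_trans by blast
  qed
  have "\<exists>K q. q > 0 \<and> (\<forall>a b. K \<le> a \<longrightarrow> K \<le> b \<longrightarrow> a mod q = b mod q \<longrightarrow>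
      ord_equiv k (ntimes a (?W i)) (ntimes b (?W i)))" for i
    by (rule ntimes_ord_equiv_periodic[of k "?W i"]) blast
  then obtain Kf qf where per: "\<And>i. qf i > (0::nat)"
    "\<And>i a b. Kf i \<le> a \<Longrightarrow> Kf i \<le> b \<Longrightarrow> a mod qf i = b mod qf i \<Longrightarrow>
      ord_equiv k (ntimes a (?W i)) (ntimes b (?W i))"
    by metis
  \<comment> \<open>One threshold and one period for all i < m: the sum bounds every
    \<open>Kf i\<close> and the product is a multiple of every \<open>qf i\<close>. Both are
    meaningful for m = 0 as well.\<close>
  define K where "K = (\<Sum>i<m. Kf i)"
  define q where "q = (\<Prod>i<m. qf i)"
  have q: "q > 0" using per(1) by (simp add: q_def prod_pos)
  have Kq: "Kf i \<le> K \<and> qf i dvd q" if "i < m" for i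
    using that unfolding K_def q_def by (auto intro: member_le_sum dvd_prodI)
  let ?hi = "high_part (fin_ord m)" and ?lo = "\<lambda>i. low_part (fin_ord i)"
  have lo_Suc: "ord_of_mset (?lo (Suc i) A) = ntimes (count A (fin_ord i)) (?W i) + ord_of_mset (?lo i A)" for i A
  proof -
    have "?lo (Suc i) A = replicate_mset (count A (fin_ord i)) (fin_ord i) + ?lo i A"
      by (rule multiset_eqI) (auto simp: low_part_def less_fin_ord_Suc)
    then show ?thesis
      using ord_of_mset_add[of "replicate_mset (count A (fin_ord i)) (fin_ord i)" "?lo i A"]
      by (force simp: low_part_def ord_of_mset_replicate in_replicate_mset split: if_splits)
  qed
  have hi: "ord_equiv k (ord_of_mset (?hi A)) (?W m)" if A: "\<exists>e\<in>#A. fin_ord m \<le> e" for A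
    unfolding ord_of_mset_def
  proof (rule high)
    obtain e where "e \<in># ?hi A" using A by (auto simp: high_part_def)
    then show "rev (sorted_list_of_multiset (?hi A)) \<noteq> []"
      using set_sorted_list_of_multiset[of "?hi A"] by force
  qed (auto simp: high_part_def)
  have "ord_equiv k (ord_of_mset A) (ord_of_mset B)"
    if A: "\<exists>e\<in>#A. fin_ord m \<le> e" and B: "\<exists>e\<in>#B. fin_ord m \<le> e"
      and counts: "counts_agree m K q A B" for A B
  proof -
    have lows: "ord_equiv k (ord_of_mset (?lo i A)) (ord_of_mset (?lo i B))" if "i \<le> m" for i
      using that
    proof (induction i)
      case 0
      then show ?case by (simp add: low_part_def)
    next
      case (Suc i)
      have "ord_equiv k (ntimes (count A (fin_ord i)) (?W i)) (ntimes (count B (fin_ord i)) (?W i))"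
      proof (cases "count A (fin_ord i) = count B (fin_ord i)")
        case False
        then have *: "K \<le> count A (fin_ord i)" "K \<le> count B (fin_ord i)"
          "count A (fin_ord i) mod q = count B (fin_ord i) mod q"
          using counts Suc_le_lessD[OF Suc.prems] unfolding counts_agree_def by blast+
        have "count A (fin_ord i) mod qf i = count B (fin_ord i) mod qf i"
          using *(3) Kq[of i] Suc.prems by (metis Suc_le_lessD mod_mod_cancel)
        then show ?thesis using * Kq[of i] Suc.prems by (intro per(2)) auto
      qed simp
      then show ?case using Suc unfolding lo_Suc by (intro ord_equiv_add) auto
    qed
    have "ord_equiv k (ord_of_mset (?hi A)) (ord_of_mset (?hi B))"
      using hi[OF A] hi[OF B] ord_equiv_sym ord_equiv_trans by blast
    then show ?thesis
      unfolding ord_of_mset_split[of A "fin_ord m"] ord_of_mset_split[of B "fin_ord m"] by (intro ord_equiv_add lows) simp_all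
  qed
  then show thesis using that[OF q] by blast
qed

section \<open>Slowly growing counting functions\<close>

text \<open>This is limsup c(n+1) / c(n) \<le> 1, written without a quotient because c may
  vanish.\<close>

definition slow :: "(nat \<Rightarrow> nat) \<Rightarrow> bool" where
  "slow c \<longleftrightarrow> (\<forall>\<epsilon>>0. \<forall>\<^sub>F n in sequentially. real (c (Suc n)) \<le> (1 + \<epsilon>) * real (c n))"

lemma slow_add:
  assumes "slow c" "slow d"
  shows "slow (\<lambda>n. c n + d n)"
  unfolding slow_def
proof (intro allI impI)
  fix \<epsilon> :: real assume "\<epsilon> > 0"
  then have "\<forall>\<^sub>F n in sequentially. real (c (Suc n)) \<le> (1 + \<epsilon>) * real (c n)"
    "\<forall>\<^sub>F n in sequentially. real (d (Suc n)) \<le> (1 + \<epsilon>) * real (d n)"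
    using assms by (simp_all add: slow_def)
  then show "\<forall>\<^sub>F n in sequentially. real (c (Suc n) + d (Suc n)) \<le> (1 + \<epsilon>) * real (c n + d n)"
    by eventually_elim (simp add: algebra_simps)
qed

lemma slow_shift:
  assumes "slow c"
  shows "slow (\<lambda>n. if n < h then 0 else c (n - h))"
  unfolding slow_def
proof (intro allI impI)
  fix \<epsilon> :: real assume "\<epsilon> > 0"
  then obtain N where N: "\<And>n. N \<le> n \<Longrightarrow> real (c (Suc n)) \<le> (1 + \<epsilon>) * real (c n)"
    using assms unfolding slow_def eventually_sequentially by blast
  have "real (if Suc n < h then 0 else c (Suc n - h)) \<le> (1 + \<epsilon>) * real (if n < h then 0 else c (n - h))"
    if "N + h \<le> n" for n
    using N[of "n - h"] that by (simp add: Suc_diff_le)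
  then show "\<forall>\<^sub>F n in sequentially. real (if Suc n < h then 0 else c (Suc n - h))
      \<le> (1 + \<epsilon>) * real (if n < h then 0 else c (n - h))"
    unfolding eventually_sequentially by blast
qed

lemma slow_eventually_0:
  assumes "\<And>n. N \<le> n \<Longrightarrow> c n = 0"
  shows "slow c"
  unfolding slow_def eventually_sequentially using assms by (auto intro!: exI[of _ N])

text \<open>
  The recursion below is the one that counts multisets with \<open>p s\<close> kinds of elements of weight \<open>s\<close>.
  In the sum for \<open>n + 1\<close>, terms with small \<open>s\<close> are compared with the sum for \<open>n\<close> by \<open>k \<mapsto> k - 1\<close> and
  terms with large \<open>s\<close> by \<open>s \<mapsto> s - 1\<close>; the value \<open>s\<^sub>0\<close> between the two ranges is dropped, and it is
  chosen by averaging so that its terms contribute little.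
\<close>

lemma slow_from_recursion:
  fixes c p :: "nat \<Rightarrow> nat"
  defines "C \<equiv> \<lambda>j::int. if j < 0 then 0 else real (c (nat j))"
  assumes mono: "\<And>n. c n \<le> c (Suc n)"
    and rec: "\<And>n. real n * real (c n) =
      (\<Sum>k=1..n. \<Sum>s=1..n. real s * real (p s) * C (int n - int k * int s))"
    and p: "slow p"
  shows "slow c"
  unfolding slow_def
proof (intro allI impI)
  fix \<epsilon> :: real assume \<epsilon>: "\<epsilon> > 0"
  \<comment> \<open>Three losses of size eta will occur: in comparing P at s and s - 1, in dropping
    s_0, and in the terms k = 1 that the shift of k leaves over. The choice makes 1 - 3 eta = 1 / (1
    + eps).\<close>
  define \<eta> where "\<eta> = \<epsilon> / (1 + \<epsilon>) / 3"
  have \<eta>: "0 < \<eta>" "\<eta> < 1" "(1 - 3 * \<eta>) * (1 + \<epsilon>) = 1"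
    using \<epsilon> by (auto simp: \<eta>_def field_simps)
  have Cmono: "C i \<le> C j" if "i \<le> j" for i j
    using that lift_Suc_mono_le[of c, OF mono, of "nat i" "nat j"] by (auto simp: C_def)
  have C0: "0 \<le> C j" for j by (simp add: C_def)
  have Cneg: "C j = 0" if "j < 0" for j using that by (simp add: C_def)
  have Cc: "C (int n) = real (c n)" for n by (simp add: C_def)
  define P where "P s = real s * real (p s)" for s
  have P0: "0 \<le> P s" for s by (simp add: P_def)
  \<comment> \<open>Both factors of \<open>P s\<close> grow slowly: s and \<open>p s\<close>
    contribute at most 1 + eta/2 each, and (1 - eta) (1 + eta/2)^2 \<le> 1.\<close>
  obtain S where S: "S \<ge> 1" "\<And>s. S < s \<Longrightarrow> (1 - \<eta>) * P s \<le> P (s - 1)"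
  proof -
    obtain S1 where S1: "\<And>s. S1 \<le> s \<Longrightarrow> real (p (Suc s)) \<le> (1 + \<eta> / 2) * real (p s)"
      using p \<eta>(1) unfolding slow_def eventually_sequentially by (metis half_gt_zero)
    obtain S2 :: nat where S2: "2 / \<eta> < real S2" using reals_Archimedean2 by blast
    show thesis
    proof (rule that[of "max 1 (max (Suc S1) S2)"])
      fix s assume s: "max 1 (max (Suc S1) S2) < s"
      then obtain t where t: "s = Suc t" "t \<ge> S1" "t \<ge> S2" "t \<ge> 1" by (cases s) auto
      have "2 / \<eta> < real t" using S2 t by simp
      then have "real (Suc t) \<le> (1 + \<eta> / 2) * real t"
        using \<eta>(1) by (simp add: field_simps)
      then have "P s \<le> ((1 + \<eta> / 2) * real t) * ((1 + \<eta> / 2) * real (p t))"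
        unfolding P_def t(1) using S1[OF t(2)] \<eta>(1) by (intro mult_mono) auto
      also have "\<dots> = (1 + \<eta> / 2)\<^sup>2 * P t" by (simp add: P_def power2_eq_square)
      finally have "(1 - \<eta>) * P s \<le> (1 - \<eta>) * ((1 + \<eta> / 2)\<^sup>2 * P t)"
        using \<eta>(2) by (intro mult_left_mono) auto
      also have "\<dots> = ((1 - \<eta>) * (1 + \<eta> / 2)\<^sup>2) * P t" by simp
      also have "\<dots> \<le> 1 * P t"
      proof (rule mult_right_mono[OF _ P0])
        have "1 - (1 - \<eta>) * (1 + \<eta> / 2)\<^sup>2 = \<eta>\<^sup>2 * (3 + \<eta>) / 4"
          by (simp add: power2_eq_square field_simps)
        moreover have "0 \<le> \<eta>\<^sup>2 * (3 + \<eta>) / 4" using \<eta>(1) by simp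
        ultimately show "(1 - \<eta>) * (1 + \<eta> / 2)\<^sup>2 \<le> 1" by linarith
      qed
      finally show "(1 - \<eta>) * P s \<le> P (s - 1)" by (simp add: t(1))
    qed simp
  qed
  \<comment> \<open>There are R > 1/eta candidates for s_0, so the cheapest of them carries at most
    an eta fraction of the total.\<close>
  obtain R :: nat where R: "1 / \<eta> < real R" using reals_Archimedean2 by blast
  then have R0: "0 < R" using \<eta>(1) by (metis divide_pos_pos less_trans of_nat_0_less_iff zero_less_one)
  define \<Lambda> where "\<Lambda> = (\<Sum>s<S + R. P s)"
  obtain N0 :: nat where N0: "\<Lambda> / \<eta> < real N0" using reals_Archimedean2 by blast
  have main: "real (c (Suc n)) \<le> (1 + \<epsilon>) * real (c n)" if n: "S + R + N0 \<le> n" for n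
  proof -
    define N where "N = Suc n"
    let ?T = "real N * real (c N)"
    \<comment> \<open>The parts of the recursion at N and at n that belong to s. In \<open>H\<close>
      the index k also runs up to N, to allow comparison term by term; the excess terms have a
      negative argument, where \<open>C\<close> is 0.\<close>
    define G where "G s = (\<Sum>k=1..N. P s * C (int N - int k * int s))" for s
    define H where "H s = (\<Sum>k=1..N. P s * C (int n - int k * int s))" for s
    have G0: "0 \<le> G s" for s unfolding G_def by (intro sum_nonneg mult_nonneg_nonneg P0 C0)
    have H0: "0 \<le> H s" for s unfolding H_def by (intro sum_nonneg mult_nonneg_nonneg P0 C0)
    have GN: "(\<Sum>s=1..N. G s) = ?T"
      unfolding rec[of N] G_def P_def by (rule sum.swap)
    have HN: "(\<Sum>s=1..N. H s) = real n * real (c n)"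
    proof -
      have zero: "P s * C (int n - int k * int s) = 0" if "1 \<le> k" "1 \<le> s" "k = N \<or> s = N" for k s
      proof -
        have "N \<le> k * s" using that by auto
        then have "int n < int k * int s" unfolding N_def by (metis Suc_le_lessD of_nat_less_iff of_nat_mult)
        then show ?thesis by (simp add: Cneg)
      qed
      have "(\<Sum>s=1..N. H s) = (\<Sum>s=1..n. \<Sum>k=1..n. P s * C (int n - int k * int s))"
      proof -
        have "H s = (\<Sum>k=1..n. P s * C (int n - int k * int s))" if "1 \<le> s" for s
          unfolding H_def
        proof (rule sum.mono_neutral_right)
          show "\<forall>k\<in>{1..N} - {1..n}. P s * C (int n - int k * int s) = 0"
            using that by (intro ballI zero) (auto simp: N_def)
        qed (auto simp: N_def)
        then have "(\<Sum>s=1..N. H s) = (\<Sum>s=1..N. \<Sum>k=1..n. P s * C (int n - int k * int s))"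
          by (intro sum.cong) auto
        also have "\<dots> = (\<Sum>s=1..n. \<Sum>k=1..n. P s * C (int n - int k * int s))"
        proof (rule sum.mono_neutral_right)
          show "\<forall>s\<in>{1..N} - {1..n}. (\<Sum>k=1..n. P s * C (int n - int k * int s)) = 0"
            using zero by (intro ballI sum.neutral zero) (auto simp: N_def)
        qed (auto simp: N_def)
        finally show ?thesis .
      qed
      also have "\<dots> = real n * real (c n)"
        unfolding rec[of n] P_def by (rule sum.swap)
      finally show ?thesis .
    qed
    have "\<exists>s0. S \<le> s0 \<and> s0 < S + R \<and> real R * G s0 \<le> ?T"
    proof (rule ccontr)
      assume "\<not> ?thesis"
      then have large: "?T < real R * G s" if "s \<in> {S..<S + R}" for s
        using that by (meson atLeastLessThan_iff not_less)
      have "real R * ?T = (\<Sum>s\<in>{S..<S + R}. ?T)"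
        by simp
      also have "\<dots> < (\<Sum>s\<in>{S..<S + R}. real R * G s)"
        using R0 large by (intro sum_strict_mono) auto
      also have "\<dots> = real R * (\<Sum>s\<in>{S..<S + R}. G s)" by (simp add: sum_distrib_left)
      also have "\<dots> \<le> real R * (\<Sum>s=1..N. G s)"
        using S(1) n G0 by (intro mult_left_mono sum_mono2) (auto simp: N_def)
      finally show False unfolding GN by simp
    qed
    then obtain s0 where s0: "S \<le> s0" "s0 < S + R" "real R * G s0 \<le> ?T"
      by blast
    \<comment> \<open>Shift k by one: N - (k + 1) s \<le> n - k s as s \<ge> 1. The term k = 1 has
      no partner; it is at most P s * c(N).\<close>
    have small: "G s - P s * real (c N) \<le> H s" if "1 \<le> s" for s
    proof -
      have "(\<Sum>k=1..N. P s * C (int N - int k * int s))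
          \<le> (\<Sum>k=1..Suc N. P s * C (int N - int k * int s))"
        using P0 C0 by (intro sum_mono2) auto
      also have "\<dots> = P s * C (int N - int s) + (\<Sum>k=Suc 1..Suc N. P s * C (int N - int k * int s))"
        by (subst sum.atLeast_Suc_atMost) simp_all
      also have "(\<Sum>k=Suc 1..Suc N. P s * C (int N - int k * int s))
          = (\<Sum>k=1..N. P s * C (int N - int (Suc k) * int s))"
        by (rule sum.shift_bounds_cl_Suc_ivl)
      also have "\<dots> \<le> H s"
        unfolding H_def using that
        by (intro sum_mono mult_left_mono P0 Cmono) (auto simp: N_def algebra_simps)
      also have "P s * C (int N - int s) \<le> P s * real (c N)"
        unfolding Cc[symmetric] by (intro mult_left_mono P0 Cmono) simp
      finally show ?thesis by (simp add: G_def)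
    qed
    \<comment> \<open>Shift s by one instead: N - k (s + 1) \<le> n - k s as k \<ge> 1. No term is
      left over, but P changes by a factor that is controlled beyond S.\<close>
    have big: "(1 - \<eta>) * G (Suc s) \<le> H s" if "S \<le> s" for s
    proof -
      have "(1 - \<eta>) * G (Suc s) = (\<Sum>k=1..N. (1 - \<eta>) * P (Suc s) * C (int N - int k * int (Suc s)))"
        by (simp add: G_def sum_distrib_left mult.assoc)
      also have "\<dots> \<le> H s"
        unfolding H_def using S(2)[of "Suc s"] that P0 C0
        by (intro sum_mono mult_mono Cmono) (auto simp: N_def algebra_simps)
      finally show ?thesis .
    qed
    have s0N: "1 \<le> s0" "s0 < N" using s0 S(1) n by (auto simp: N_def)
    have "(1 - \<eta>) * (?T - G s0) =
        (1 - \<eta>) * (\<Sum>s=1..<s0. G s) + (1 - \<eta>) * (\<Sum>s=Suc s0..N. G s)"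
    proof -
      have disj: "{Suc 0..<s0} \<inter> {Suc s0..N} = {}" by auto
      have "{1..N} = {1..<s0} \<union> {s0} \<union> {Suc s0..N}" using s0N by auto
      then have "(\<Sum>s=1..N. G s) = (\<Sum>s=1..<s0. G s) + G s0 + (\<Sum>s=Suc s0..N. G s)"
        by (simp add: sum.union_disjoint disj)
      then show ?thesis by (simp add: GN[symmetric] algebra_simps)
    qed
    also have "(1 - \<eta>) * (\<Sum>s=1..<s0. G s) \<le> (\<Sum>s=1..<s0. G s)"
      using \<eta>(1) sum_nonneg[of "{1..<s0}" G] G0 by (simp add: algebra_simps)
    also have "\<dots> \<le> (\<Sum>s=1..<s0. H s + P s * real (c N))"
      by (intro sum_mono) (use small in \<open>force simp: algebra_simps\<close>)
    also have "\<dots> = (\<Sum>s=1..<s0. H s) + (\<Sum>s=1..<s0. P s) * real (c N)"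
      by (simp add: sum.distrib sum_distrib_right)
    also have "(\<Sum>s=1..<s0. P s) * real (c N) \<le> \<Lambda> * real (c N)"
      unfolding \<Lambda>_def using s0(2) P0 by (intro mult_right_mono sum_mono2) auto
    also have "(1 - \<eta>) * (\<Sum>s=Suc s0..N. G s) \<le> (\<Sum>s=s0..n. H s)"
    proof -
      have "(1 - \<eta>) * (\<Sum>s=Suc s0..N. G s) = (\<Sum>s=s0..n. (1 - \<eta>) * G (Suc s))"
        unfolding N_def sum_distrib_left by (rule sum.shift_bounds_cl_Suc_ivl)
      also have "\<dots> \<le> (\<Sum>s=s0..n. H s)"
        by (intro sum_mono big) (use s0(1) in auto)
      finally show ?thesis .
    qed
    finally have "(1 - \<eta>) * (?T - G s0)
        \<le> ((\<Sum>s=1..<s0. H s) + (\<Sum>s=s0..n. H s)) + \<Lambda> * real (c N)"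
      by simp
    also have "(\<Sum>s=1..<s0. H s) + (\<Sum>s=s0..n. H s) = (\<Sum>s\<in>{1..<s0} \<union> {s0..n}. H s)"
      by (rule sum.union_disjoint[symmetric]) auto
    also have "\<dots> \<le> (\<Sum>s=1..N. H s)"
      using s0N H0 by (intro sum_mono2) (auto simp: N_def)
    also have "\<dots> = real n * real (c n)" by (rule HN)
    also have "real n * real (c n) \<le> real N * real (c n)" by (simp add: N_def mult_right_mono)
    finally have 1: "(1 - \<eta>) * (?T - G s0) \<le> real N * real (c n) + \<Lambda> * real (c N)"
      by simp
    have "G s0 \<le> ?T / real R"
      using s0(3) R0 by (simp add: field_simps)
    also have "\<dots> \<le> \<eta> * ?T"
    proof -
      have "1 / real R \<le> \<eta>" using R \<eta>(1) R0 by (simp add: field_simps)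
      then have "1 / real R * ?T \<le> \<eta> * ?T"
        by (intro mult_right_mono) auto
      then show ?thesis by simp
    qed
    finally have G: "G s0 \<le> \<eta> * ?T" .
    \<comment> \<open>\<open>\<Lambda>\<close> does not depend on n, so for large N the unpaired
      terms k = 1 are a small part of N * c(N).\<close>
    have "\<Lambda> / \<eta> \<le> real N" using N0 n by (simp add: N_def)
    then have "\<Lambda> * real (c N) \<le> \<eta> * ?T"
      unfolding mult.assoc[symmetric] using \<eta>(1) by (intro mult_right_mono) (auto simp: field_simps)
    moreover have "(1 - \<eta>) * (?T - \<eta> * ?T)
        \<le> (1 - \<eta>) * (?T - G s0)"
      using G \<eta>(2) by (intro mult_left_mono) auto
    moreover have "(1 - \<eta>) * (?T - \<eta> * ?T) =
        (1 - 2 * \<eta>) * ?T + \<eta>\<^sup>2 * ?T"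
      by (simp add: power2_eq_square algebra_simps)
    moreover have "0 \<le> \<eta>\<^sup>2 * ?T" by simp
    ultimately have "(1 - 2 * \<eta>) * ?T \<le> real N * real (c n) + \<eta> * ?T"
      using 1 by linarith
    then have "real N * ((1 - 3 * \<eta>) * real (c N)) \<le> real N * real (c n)"
      by (simp add: algebra_simps)
    then have "(1 - 3 * \<eta>) * real (c N) \<le> real (c n)"
      by (simp add: N_def)
    then have "(1 + \<epsilon>) * ((1 - 3 * \<eta>) * real (c N)) \<le> (1 + \<epsilon>) * real (c n)"
      using \<epsilon> by (intro mult_left_mono) auto
    then show ?thesis using \<eta>(3) by (simp add: N_def mult.assoc[symmetric] mult.commute[of "1 + \<epsilon>"])
  qed
  then show "\<forall>\<^sub>F n in sequentially. real (c (Suc n)) \<le> (1 + \<epsilon>) * real (c n)"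
    unfolding eventually_sequentially by blast
qed

section \<open>Counting multisets by weight\<close>

definition wsum :: "('e \<Rightarrow> nat) \<Rightarrow> 'e multiset \<Rightarrow> nat" where
  "wsum w A = (\<Sum>e\<in>#A. w e)"

definition level :: "('e \<Rightarrow> nat) \<Rightarrow> 'e multiset set \<Rightarrow> nat \<Rightarrow> 'e multiset set" where
  "level w S n = {A\<in>S. wsum w A = n}"

abbreviation level_card :: "('e \<Rightarrow> nat) \<Rightarrow> 'e multiset set \<Rightarrow> nat \<Rightarrow> nat" where
  "level_card w S n \<equiv> card (level w S n)"

lemma wsum_simps [simp]:
  "wsum w {#} = 0" "wsum w (add_mset e A) = w e + wsum w A" "wsum w (A + B) = wsum w A + wsum w B"
  "wsum w (replicate_mset k e) = k * w e"
  by (simp_all add: wsum_def)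

lemma wsum_diff:
  assumes "B \<subseteq># A"
  shows "wsum w A = wsum w (A - B) + wsum w B"
  using wsum_simps(3)[of w "A - B" B] assms by simp

text \<open>Removing k copies of e is a bijection onto the multisets in S whose weight is smaller by
  k * w e.\<close>

lemma level_card_count_ge:
  assumes "\<And>A. A + replicate_mset k e \<in> S \<longleftrightarrow> A \<in> S"
  shows "level_card w {A\<in>S. k \<le> count A e} n = (if k * w e \<le> n then level_card w S (n - k * w e) else 0)"
proof (cases "k * w e \<le> n")
  case True
  have "bij_betw (\<lambda>A. A + replicate_mset k e) (level w S (n - k * w e)) (level w {A\<in>S. k \<le> count A e} n)"
  proof (rule bij_betw_byWitness[where f' = "\<lambda>A. A - replicate_mset k e"])
    show "\<forall>A\<in>level w {A \<in> S. k \<le> count A e} n. A - replicate_mset k e + replicate_mset k e = A"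
      by (auto simp: level_def count_le_replicate_mset_subset_eq[symmetric] subset_mset.diff_add)
    show "(\<lambda>A. A + replicate_mset k e) ` level w S (n - k * w e) \<subseteq> level w {A \<in> S. k \<le> count A e} n"
      using True assms by (auto simp: level_def)
    show "(\<lambda>A. A - replicate_mset k e) ` level w {A \<in> S. k \<le> count A e} n \<subseteq> level w S (n - k * w e)"
    proof
      fix B assume "B \<in> (\<lambda>A. A - replicate_mset k e) ` level w {A \<in> S. k \<le> count A e} n"
      then obtain A where A: "A \<in> S" "k \<le> count A e" "wsum w A = n" "B = A - replicate_mset k e"
        by (auto simp: level_def)
      have sub: "replicate_mset k e \<subseteq># A" using A(2) by (simp add: count_le_replicate_mset_subset_eq)
      have "B \<in> S" using A(1,4) assms[of B] sub by simp
      moreover have "wsum w B = n - k * w e" using wsum_diff[OF sub, of w] A by simp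
      ultimately show "B \<in> level w S (n - k * w e)" by (simp add: level_def)
    qed
  qed simp
  then show ?thesis using True by (simp add: bij_betw_same_card)
next
  case False
  have "level w {A\<in>S. k \<le> count A e} n = {}"
  proof -
    have "k * w e \<le> wsum w A" if "k \<le> count A e" for A
      using wsum_diff[of "replicate_mset k e" A w] that by (simp add: count_le_replicate_mset_subset_eq)
    then show ?thesis using False by (auto simp: level_def)
  qed
  then show ?thesis using False by simp
qed

lemma wsum_eq_sum_count: "finite F \<Longrightarrow> set_mset A \<subseteq> F \<Longrightarrow> wsum w A = (\<Sum>e\<in>F. w e * count A e)"
proof (induction A)
  case (add x A)
  have "(\<Sum>e\<in>F. w e * count (add_mset x A) e) = (\<Sum>e\<in>F. w e * count A e + (if e = x then w e else 0))"
    by (rule sum.cong) auto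
  also have "\<dots> = (\<Sum>e\<in>F. w e * count A e) + w x"
    using add.prems by (simp add: sum.distrib)
  finally show ?case using add by simp
qed simp

text \<open>Summing the weights of all multisets of weight n in two ways gives the recursion, as for
  partitions of numbers: s is the weight of an element and k runs through its copies. Adding the
  element z of weight 1 shows monotonicity.\<close>

theorem slow_multisets:
  fixes w :: "'e \<Rightarrow> nat"
  assumes pos: "\<And>e. e \<in> \<Gamma> \<Longrightarrow> 0 < w e" and z: "z \<in> \<Gamma>" "w z = 1"
    and fin: "\<And>n. finite (level w {A. set_mset A \<subseteq> \<Gamma>} n)"
    and slow: "slow (\<lambda>s. card {e\<in>\<Gamma>. w e = s})"
  shows "slow (level_card w {A. set_mset A \<subseteq> \<Gamma>})"
proof (rule slow_from_recursion[OF _ _ slow])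
  define S where "S = {A. set_mset A \<subseteq> \<Gamma>}"
  let ?c = "level_card w S"
  have finS: "finite (level w S n)" for n using fin by (simp add: S_def)
  show "level_card w {A. set_mset A \<subseteq> \<Gamma>} n \<le> level_card w {A. set_mset A \<subseteq> \<Gamma>} (Suc n)" for n
    by (rule card_inj_on_le[of "add_mset z"]) (use z fin in \<open>auto simp: level_def inj_on_def\<close>)
  fix n
  define F where "F = {e\<in>\<Gamma>. w e \<le> n}"
  have finE: "finite {e\<in>\<Gamma>. w e = s}" for s
    by (rule inj_on_finite[OF _ _ finS[of s], of "\<lambda>e. {#e#}"]) (auto simp: level_def S_def inj_on_def)
  have F_eq: "F = (\<Union>s\<in>{1..n}. {e\<in>\<Gamma>. w e = s})"
    using pos by (force simp: F_def Suc_le_eq)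
  then have finF: "finite F" using finE by simp
  have levelF: "set_mset A \<subseteq> F" if "A \<in> level w S n" for A
  proof
    fix e assume e: "e \<in># A"
    then have "w e \<le> wsum w A" by (metis insert_DiffM wsum_simps(2) le_add1)
    then show "e \<in> F" using e that by (auto simp: F_def level_def S_def)
  qed
  have count_le: "count A e \<le> n" if "A \<in> level w S n" "e \<in> F" for A e
  proof -
    have "count A e * 1 \<le> count A e * w e" using that(2) pos by (intro mult_left_mono) (auto simp: F_def Suc_le_eq)
    also have "\<dots> \<le> wsum w A"
    proof -
      have "replicate_mset (count A e) e \<subseteq># A" by (simp flip: count_le_replicate_mset_subset_eq)
      from wsum_diff[OF this, of w] show ?thesis by simp
    qed
    finally show ?thesis using that(1) by (simp add: level_def)
  qed
  have card_k: "(\<Sum>A\<in>level w S n. if k \<le> count A e then 1 else 0) = (if k * w e \<le> n then ?c (n - k * w e) else 0)"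
    if "e \<in> F" for k e
  proof -
    have "(\<Sum>A\<in>level w S n. if k \<le> count A e then 1 else 0) = card (level w S n \<inter> {A. k \<le> count A e})"
      by (simp add: finS sum.If_cases)
    also have "level w S n \<inter> {A. k \<le> count A e} = level w {A\<in>S. k \<le> count A e} n"
      by (auto simp: level_def)
    also have "card \<dots> = (if k * w e \<le> n then ?c (n - k * w e) else 0)"
      by (rule level_card_count_ge) (use that in \<open>auto simp: S_def F_def in_replicate_mset split: if_splits\<close>)
    finally show ?thesis .
  qed
  have "n * ?c n = (\<Sum>A\<in>level w S n. wsum w A)"
    by (simp add: level_def)
  also have "\<dots> = (\<Sum>A\<in>level w S n. \<Sum>e\<in>F. w e * count A e)"
    by (intro sum.cong wsum_eq_sum_count finF levelF) auto
  \<comment> \<open>A multiplicity is the number of k \<ge> 1 that it reaches; after exchanging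
    sums, \<open>card_k\<close> counts the multisets that reach k.\<close>
  also have "\<dots> = (\<Sum>A\<in>level w S n. \<Sum>e\<in>F. \<Sum>k=1..n. w e * (if k \<le> count A e then 1 else 0))"
  proof (intro sum.cong refl)
    fix A e assume "A \<in> level w S n" "e \<in> F"
    then have "count A e \<le> n" by (rule count_le)
    then have "{1..n} \<inter> {k. k \<le> count A e} = {1..count A e}" by auto
    then have "(\<Sum>k=1..n. if k \<le> count A e then 1 else 0) = count A e"
      by (simp add: sum.If_cases)
    then show "w e * count A e = (\<Sum>k=1..n. w e * (if k \<le> count A e then 1 else 0))"
      by (metis sum_distrib_left)
  qed
  also have "\<dots> = (\<Sum>e\<in>F. \<Sum>k=1..n. \<Sum>A\<in>level w S n. w e * (if k \<le> count A e then 1 else 0))"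
    by (subst sum.swap, rule sum.cong[OF refl], rule sum.swap)
  also have "\<dots> = (\<Sum>e\<in>F. \<Sum>k=1..n. w e * (if k * w e \<le> n then ?c (n - k * w e) else 0))"
    by (intro sum.cong refl) (simp only: card_k flip: sum_distrib_left)
  also have "\<dots> = (\<Sum>k=1..n. \<Sum>e\<in>F. w e * (if k * w e \<le> n then ?c (n - k * w e) else 0))"
    by (rule sum.swap)
  also have "\<dots> = (\<Sum>k=1..n. \<Sum>s=1..n. s * card {e\<in>\<Gamma>. w e = s} * (if k * s \<le> n then ?c (n - k * s) else 0))"
  proof (rule sum.cong[OF refl])
    fix k
    have "(\<Sum>e\<in>F. w e * (if k * w e \<le> n then ?c (n - k * w e) else 0)) =
        (\<Sum>s=1..n. \<Sum>e\<in>{e\<in>\<Gamma>. w e = s}. w e * (if k * w e \<le> n then ?c (n - k * w e) else 0))"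
      unfolding F_eq by (rule sum.UNION_disjoint) (use finE in auto)
    also have "\<dots> = (\<Sum>s=1..n. s * card {e\<in>\<Gamma>. w e = s} * (if k * s \<le> n then ?c (n - k * s) else 0))"
      by (intro sum.cong refl) simp
    finally show "(\<Sum>e\<in>F. w e * (if k * w e \<le> n then ?c (n - k * w e) else 0)) = \<dots>" .
  qed
  finally have "real (n * ?c n) = real \<dots>" by (rule arg_cong)
  also have "\<dots> = (\<Sum>k=1..n. \<Sum>s=1..n. real s * real (card {e\<in>\<Gamma>. w e = s}) *
      (if int n - int k * int s < 0 then 0 else real (?c (nat (int n - int k * int s)))))"
  proof -
    have "real (if k * s \<le> n then ?c (n - k * s) else 0) =
      (if int n - int k * int s < 0 then 0 else real (?c (nat (int n - int k * int s))))" for k s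
    proof -
      have "int k * int s = int (k * s)" by simp
      then show ?thesis by (simp add: nat_minus_as_int not_less del: of_nat_mult)
    qed
    then show ?thesis by (simp only: of_nat_sum of_nat_mult)
  qed
  finally show "real n * real (level_card w {A. set_mset A \<subseteq> \<Gamma>} n) =
    (\<Sum>k=1..n. \<Sum>s=1..n. real s * real (card {e\<in>\<Gamma>. w e = s}) *
      (if int n - int k * int s < 0 then 0
       else real (level_card w {A. set_mset A \<subseteq> \<Gamma>} (nat (int n - int k * int s)))))"
    unfolding S_def of_nat_mult .
qed

section \<open>Densities\<close>

text \<open>L may depend on e, since approximate limits already give the Cauchy property.\<close>

lemma convergent_by_approximation:
  fixes q :: "nat \<Rightarrow> real"
  assumes "\<And>e. e > 0 \<Longrightarrow> \<exists>L. \<forall>\<^sub>F n in sequentially. \<bar>q n - L\<bar> < e"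
  shows "convergent q"
proof -
  have "Cauchy q"
    unfolding Cauchy_def
  proof (intro allI impI)
    fix e :: real assume "e > 0"
    then obtain L N where N: "\<And>n. N \<le> n \<Longrightarrow> \<bar>q n - L\<bar> < e / 2"
      using assms[of "e / 2"] unfolding eventually_sequentially by auto
    have "dist (q m) (q n) < e" if "N \<le> m" "N \<le> n" for m n
      using N[OF that(1)] N[OF that(2)] by (simp add: dist_real_def abs_if split: if_splits)
    then show "\<exists>N. \<forall>m\<ge>N. \<forall>n\<ge>N. dist (q m) (q n) < e" by blast
  qed
  then show ?thesis by (simp add: Cauchy_convergent_iff)
qed

lemma tendsto_null_comparison:
  fixes f g :: "nat \<Rightarrow> real"
  assumes "\<And>n. \<bar>f n\<bar> \<le> g n" "g \<longlonglongrightarrow> 0"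
  shows "f \<longlonglongrightarrow> 0"
proof (rule tendsto_rabs_zero_cancel, rule tendsto_sandwich[OF _ _ tendsto_const assms(2)])
qed (use assms(1) in auto)

lemma tendsto_diff_trans:
  fixes f g h :: "nat \<Rightarrow> real"
  assumes "(\<lambda>n. f n - g n) \<longlonglongrightarrow> 0" "(\<lambda>n. g n - h n) \<longlonglongrightarrow> 0"
  shows "(\<lambda>n. f n - h n) \<longlonglongrightarrow> 0"
  using tendsto_add[OF assms] by simp

lemma PiE_neqD: "f \<in> I \<rightarrow>\<^sub>E F \<Longrightarrow> g \<in> I \<rightarrow>\<^sub>E F \<Longrightarrow> f \<noteq> g \<Longrightarrow> \<exists>i\<in>I. f i \<noteq> g i"
  using PiE_ext by blast

text \<open>The intended \<open>z i\<close> is the exponent i, and S represents the ordinals below a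
  multiple of omega^M. Closure runs in both directions, so adding copies of \<open>z i\<close> is a
  bijection from S onto its members with at least that many copies.\<close>

locale closed_multisets =
  fixes w :: "'e \<Rightarrow> nat" and S :: "'e multiset set" and z :: "nat \<Rightarrow> 'e" and M :: nat
  assumes closed: "i < M \<Longrightarrow> add_mset (z i) A \<in> S \<longleftrightarrow> A \<in> S"
    and weight_z: "i < M \<Longrightarrow> w (z i) = Suc i"
    and finite_level_S: "finite (level w S n)"
    and empty_in_S: "{#} \<in> S"
    and M_pos: "0 < M"
begin

abbreviation c :: "nat \<Rightarrow> nat" where "c \<equiv> level_card w S"

lemma c_pos: "0 < c n"
proof -
  have "replicate_mset n (z 0) \<in> level w S n"
  proof -
    have "replicate_mset n (z 0) \<in> S"
      using closed[OF M_pos] empty_in_S by (induction n) auto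
    then show ?thesis using weight_z[OF M_pos] by (simp add: level_def)
  qed
  then show ?thesis using finite_level_S by (auto simp: card_gt_0_iff)
qed

lemma c_mono: "c n \<le> c (Suc n)"
  by (rule card_inj_on_le[of "add_mset (z 0)"])
    (use closed[OF M_pos] weight_z[OF M_pos] finite_level_S in \<open>auto simp: level_def inj_on_def\<close>)

end

locale counted_multisets = closed_multisets w S z M for w :: "'e \<Rightarrow> nat" and S z M +
  fixes \<rho> :: real
  assumes ratio: "(\<lambda>n. real (c n) / real (c (Suc n))) \<longlonglongrightarrow> \<rho>"
begin

abbreviation share :: "'e multiset set \<Rightarrow> nat \<Rightarrow> real" where
  "share Q n \<equiv> real (level_card w Q n) / real (c n)"

text \<open>The inclusion in S ensures finite levels, on which \<open>card\<close> is
  meaningful.\<close>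

definition has_dens :: "'e multiset set \<Rightarrow> real \<Rightarrow> bool" where
  "has_dens Q L \<longleftrightarrow> Q \<subseteq> S \<and> (\<lambda>n. share Q n) \<longlonglongrightarrow> L"

lemma finite_level: "Q \<subseteq> S \<Longrightarrow> finite (level w Q n)"
  by (rule finite_subset[OF _ finite_level_S[of n]]) (auto simp: level_def)

lemma level_card_mono: "Q \<subseteq> Q' \<Longrightarrow> Q' \<subseteq> S \<Longrightarrow> level_card w Q n \<le> level_card w Q' n"
  by (intro card_mono finite_level) (auto simp: level_def)

lemma rho_bounds: "0 \<le> \<rho>" "\<rho> \<le> 1"
proof -
  show "0 \<le> \<rho>" by (rule LIMSEQ_le_const[OF ratio]) auto
  show "\<rho> \<le> 1"
    by (rule LIMSEQ_le_const2[OF ratio]) (use c_mono c_pos in \<open>auto simp: divide_le_eq_1\<close>)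
qed

lemma has_dens_S: "has_dens S 1"
  using c_pos by (simp add: has_dens_def less_imp_neq[symmetric])

lemma has_dens_subset: "has_dens Q L \<Longrightarrow> Q \<subseteq> S"
  by (simp add: has_dens_def)

lemma has_dens_empty: "has_dens {} 0"
  by (simp add: has_dens_def level_def)

lemma has_dens_Un:
  assumes "has_dens Q L" "has_dens Q' L'" "Q \<inter> Q' = {}"
  shows "has_dens (Q \<union> Q') (L + L')"
proof -
  have "level_card w (Q \<union> Q') n = level_card w Q n + level_card w Q' n" for n
  proof -
    have "level w (Q \<union> Q') n = level w Q n \<union> level w Q' n" by (auto simp: level_def)
    moreover have "level w Q n \<inter> level w Q' n = {}" using assms(3) by (auto simp: level_def)
    ultimately show ?thesis
      using finite_level[OF has_dens_subset[OF assms(1)]] finite_level[OF has_dens_subset[OF assms(2)]]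
      by (simp add: card_Un_disjoint)
  qed
  then show ?thesis
    using assms tendsto_add by (fastforce simp: has_dens_def add_divide_distrib)
qed

lemma has_dens_UN:
  assumes "finite I" "\<And>i. i \<in> I \<Longrightarrow> has_dens (Q i) (L i)"
    "\<And>i j. i \<in> I \<Longrightarrow> j \<in> I \<Longrightarrow> i \<noteq> j \<Longrightarrow> Q i \<inter> Q j = {}"
  shows "has_dens (\<Union>i\<in>I. Q i) (\<Sum>i\<in>I. L i)"
  using assms
proof (induction I rule: finite_induct)
  case (insert i I)
  have "has_dens (Q i \<union> (\<Union>i\<in>I. Q i)) (L i + (\<Sum>i\<in>I. L i))"
  proof (rule has_dens_Un)
    show "Q i \<inter> (\<Union>i\<in>I. Q i) = {}" using insert.prems(2)[of i] insert.hyps(2) by blast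
  qed (use insert in auto)
  then show ?case using insert by simp
qed (simp add: has_dens_empty)

lemma has_dens_Diff:
  assumes "has_dens Q L" "has_dens Q' L'" "Q' \<subseteq> Q"
  shows "has_dens (Q - Q') (L - L')"
proof -
  have "real (level_card w (Q - Q') n) = real (level_card w Q n) - real (level_card w Q' n)" for n
  proof -
    have "level w (Q - Q') n = level w Q n - level w Q' n" by (auto simp: level_def)
    moreover have "level w Q' n \<subseteq> level w Q n" using assms by (auto simp: level_def)
    ultimately show ?thesis
      using finite_level[OF has_dens_subset[OF assms(1)]] finite_level[OF has_dens_subset[OF assms(2)]]
      by (simp add: card_Diff_subset card_mono of_nat_diff)
  qed
  then have "(\<lambda>n. share (Q - Q') n) \<longlonglongrightarrow> L - L'"
    using tendsto_diff[OF conjunct2[OF assms(1)[unfolded has_dens_def]] conjunct2[OF assms(2)[unfolded has_dens_def]]]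
    by (simp add: diff_divide_distrib)
  then show ?thesis using has_dens_subset[OF assms(1)] by (auto simp: has_dens_def)
qed

lemma null_subset:
  assumes "has_dens Z 0" "Q \<subseteq> Z"
  shows "has_dens Q 0"
proof -
  have "(\<lambda>n. share Q n) \<longlonglongrightarrow> 0"
  proof (rule tendsto_sandwich[OF _ _ tendsto_const])
    show "\<forall>\<^sub>F n in sequentially. share Q n \<le> share Z n"
      using level_card_mono[OF assms(2) has_dens_subset[OF assms(1)]]
      by (intro always_eventually allI divide_right_mono) auto
    show "(\<lambda>n. share Z n) \<longlonglongrightarrow> 0"
      using assms(1) by (simp add: has_dens_def)
  qed simp
  then show ?thesis using assms has_dens_subset by (auto simp: has_dens_def)
qed

lemma null_Un: "has_dens Z 0 \<Longrightarrow> has_dens Z' 0 \<Longrightarrow> has_dens (Z \<union> Z') 0"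
  using has_dens_Un[of Z 0 "Z' - Z" 0] null_subset[of Z' "Z' - Z"] by simp

lemma null_UN: "finite I \<Longrightarrow> (\<And>i. i \<in> I \<Longrightarrow> has_dens (Z i) 0) \<Longrightarrow> has_dens (\<Union>i\<in>I. Z i) 0"
  by (induction I rule: finite_induct) (auto intro: null_Un simp: has_dens_empty)

lemma share_diff_le:
  assumes "Q \<subseteq> Q' \<union> Z" "Q' \<subseteq> Q \<union> Z" "Q \<subseteq> S" "Q' \<subseteq> S" "Z \<subseteq> S"
  shows "\<bar>share Q n - share Q' n\<bar> \<le> share Z n"
proof -
  have *: "level_card w Q n \<le> level_card w Q' n + level_card w Z n"
    if "Q \<subseteq> Q' \<union> Z" "Q' \<subseteq> S" "Z \<subseteq> S" for Q Q'
  proof -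
    have "level_card w Q n \<le> card (level w Q' n \<union> level w Z n)"
      using that by (intro card_mono) (auto simp: level_def finite_level[unfolded level_def])
    also have "\<dots> \<le> level_card w Q' n + level_card w Z n" by (rule card_Un_le)
    finally show ?thesis .
  qed
  have "\<bar>real (level_card w Q n) - real (level_card w Q' n)\<bar> \<le> real (level_card w Z n)"
    using *[of Q Q'] *[of Q' Q] assms by auto
  from divide_right_mono[OF this, of "real (c n)"] show ?thesis
    unfolding diff_divide_distrib[symmetric] abs_divide by simp
qed

lemma has_dens_modulo_null:
  assumes "has_dens Q' L" "has_dens Z 0" "Q \<subseteq> S" "Q \<subseteq> Q' \<union> Z" "Q' \<subseteq> Q \<union> Z"
  shows "has_dens Q L"
proof -
  have 1: "(\<lambda>n. share Q' n) \<longlonglongrightarrow> L"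
    and 2: "(\<lambda>n. share Z n) \<longlonglongrightarrow> 0"
    using assms by (simp_all add: has_dens_def)
  have "(\<lambda>n. share Q n - share Q' n) \<longlonglongrightarrow> 0"
    using assms has_dens_subset by (intro tendsto_null_comparison[OF share_diff_le 2]) auto
  from tendsto_add[OF this 1] show ?thesis using assms(3) by (simp add: has_dens_def)
qed

lemma ratio_power: "(\<lambda>n. real (c n) / real (c (n + h))) \<longlonglongrightarrow> \<rho> ^ h"
proof (induction h)
  case 0
  then show ?case using c_pos by (simp add: less_imp_neq[symmetric])
next
  case (Suc h)
  have "(\<lambda>n. real (c (n + h)) / real (c (Suc (n + h)))) \<longlonglongrightarrow> \<rho>"
    using LIMSEQ_ignore_initial_segment[OF ratio, of h] by simp
  from tendsto_mult[OF Suc this] show ?case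
    using c_pos by (simp add: less_imp_neq[symmetric] mult.commute)
qed

section \<open>Densities of conditions on multiplicities\<close>

definition invariant :: "'e multiset set \<Rightarrow> nat \<Rightarrow> bool" where
  "invariant Q i \<longleftrightarrow> (\<forall>A. add_mset (z i) A \<in> Q \<longleftrightarrow> A \<in> Q)"

text \<open>Adding k copies of \<open>z i\<close> raises the weight by k (i + 1), and a shift by h
  multiplies shares by rho^h in the limit. So large multiplicities are rare for rho < 1, while for
  rho = 1 a lower bound on a multiplicity costs no density.\<close>

lemma has_dens_count_ge:
  assumes "has_dens Q L" "i < M" "invariant Q i"
  shows "has_dens {A\<in>Q. k \<le> count A (z i)} (L * \<rho> ^ (k * Suc i))"
proof -
  let ?h = "k * Suc i"
  have inv: "A + replicate_mset k (z i) \<in> Q \<longleftrightarrow> A \<in> Q" for A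
    using assms(3) by (induction k) (auto simp: invariant_def)
  have eq: "level_card w {A\<in>Q. k \<le> count A (z i)} n = (if ?h \<le> n then level_card w Q (n - ?h) else 0)" for n
    using level_card_count_ge[of k "z i" Q w n, OF inv] weight_z[OF assms(2)] by simp
  have "(\<lambda>n. share Q n) \<longlonglongrightarrow> L" using assms(1) by (simp add: has_dens_def)
  from tendsto_mult[OF this ratio_power[of ?h]]
  have "(\<lambda>n. real (level_card w Q n) / real (c (n + ?h))) \<longlonglongrightarrow> L * \<rho> ^ ?h"
    using c_pos by (simp add: less_imp_neq[symmetric])
  then have "(\<lambda>n. real (level_card w {A\<in>Q. k \<le> count A (z i)} (n + ?h)) / real (c (n + ?h))) \<longlonglongrightarrow> L * \<rho> ^ ?h"
    unfolding eq by simp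
  then have "(\<lambda>n. share {A\<in>Q. k \<le> count A (z i)} n) \<longlonglongrightarrow> L * \<rho> ^ ?h"
    by (rule LIMSEQ_offset)
  then show ?thesis using has_dens_subset[OF assms(1)] by (auto simp: has_dens_def)
qed

lemma invariant_S: "i < M \<Longrightarrow> invariant S i"
  using closed by (simp add: invariant_def)

lemma z_eq_iff: "i < M \<Longrightarrow> j < M \<Longrightarrow> z i = z j \<longleftrightarrow> i = j"
  using weight_z by (metis nat.inject)

text \<open>An exact multiplicity is the difference of two lower bounds, and prescribing the earlier
  multiplicities keeps the set invariant under adding \<open>z j\<close>.\<close>

lemma has_dens_box:
  assumes "j \<le> M"
  shows "\<exists>L. has_dens {A\<in>S. \<forall>i<j. count A (z i) = a i} L"
  using assms
proof (induction j)
  case 0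
  then show ?case using has_dens_S by auto
next
  case (Suc j)
  define Q where "Q = {A\<in>S. \<forall>i<j. count A (z i) = a i}"
  obtain L where L: "has_dens Q L" using Suc by (auto simp: Q_def)
  have "invariant Q j"
    using Suc.prems closed[of j] z_eq_iff by (auto simp: invariant_def Q_def)
  then have d: "has_dens {A\<in>Q. k \<le> count A (z j)} (L * \<rho> ^ (k * Suc j))" for k
    using L Suc.prems by (intro has_dens_count_ge) auto
  have "has_dens ({A\<in>Q. a j \<le> count A (z j)} - {A\<in>Q. Suc (a j) \<le> count A (z j)})
      (L * \<rho> ^ (a j * Suc j) - L * \<rho> ^ (Suc (a j) * Suc j))"
    by (rule has_dens_Diff[OF d d]) auto
  also have "{A\<in>Q. a j \<le> count A (z j)} - {A\<in>Q. Suc (a j) \<le> count A (z j)} =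
      {A\<in>S. \<forall>i<Suc j. count A (z i) = a i}"
    by (auto simp: Q_def less_Suc_eq)
  finally show ?case by blast
qed

text \<open>Outside the null set X, Q is a union of boxes of prescribed multiplicities. Finitely
  many boxes have all entries below K, and what they miss has a limiting share of at most the sum of
  rho^(K (i + 1)), which is small for large K.\<close>

theorem convergent_if_ratio_less_1:
  assumes "\<rho> < 1" "m \<le> M" "Q \<subseteq> S" "has_dens X 0"
    and det: "\<And>A B. A \<in> S - X \<Longrightarrow> B \<in> S - X \<Longrightarrow>
      (\<And>i. i < m \<Longrightarrow> count A (z i) = count B (z i)) \<Longrightarrow> A \<in> Q \<longleftrightarrow> B \<in> Q"
  shows "convergent (\<lambda>n. share Q n)"
proof (rule convergent_by_approximation)
  fix e :: real assume e: "e > 0"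
  have "(\<lambda>K. \<Sum>i<m. \<rho> ^ (K * Suc i)) \<longlonglongrightarrow> (\<Sum>i<m. 0)"
  proof (rule tendsto_sum)
    fix i
    have "\<rho> ^ Suc i < 1"
      using rho_bounds assms(1) power_Suc_less_one[of \<rho> i] by (cases "\<rho> = 0") auto
    then have "(\<lambda>K. (\<rho> ^ Suc i) ^ K) \<longlonglongrightarrow> 0"
      using rho_bounds by (intro LIMSEQ_realpow_zero) auto
    then show "(\<lambda>K. \<rho> ^ (K * Suc i)) \<longlonglongrightarrow> 0"
      by (simp add: power_mult[symmetric] mult.commute del: power_Suc)
  qed
  then have "\<forall>\<^sub>F K in sequentially. (\<Sum>i<m. \<rho> ^ (K * Suc i)) < e / 2"
    using e by (intro order_tendstoD(2)[where y = 0]) auto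
  then obtain K where K: "(\<Sum>i<m. \<rho> ^ (K * Suc i)) < e / 2"
    unfolding eventually_sequentially by blast
  define box where "box a = {A\<in>S. \<forall>i<m. count A (z i) = a i}" for a :: "nat \<Rightarrow> nat"
  \<comment> \<open>Extensional functions make this index set finite, and distinct ones differ at
    some i < m, so that their boxes are disjoint.\<close>
  define G where "G = {a \<in> {..<m} \<rightarrow>\<^sub>E {..<K}. \<exists>A\<in>Q - X. A \<in> box a}"
  define Q' where "Q' = (\<Union>a\<in>G. box a)"
  define T where "T i = {A\<in>S. K \<le> count A (z i)}" for i
  have finG: "finite G"
  proof (rule finite_subset)
    show "G \<subseteq> {..<m} \<rightarrow>\<^sub>E {..<K}" unfolding G_def by blast
    show "finite ({..<m} \<rightarrow>\<^sub>E {..<K})" by (rule finite_PiE) simp_all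
  qed
  have "\<exists>L. has_dens (box a) L" for a
    unfolding box_def by (rule has_dens_box[OF assms(2)])
  then obtain L where L: "\<And>a. has_dens (box a) (L a)" by metis
  have Q': "has_dens Q' (\<Sum>a\<in>G. L a)"
    unfolding Q'_def
  proof (rule has_dens_UN[OF finG L])
    fix a b assume ab: "a \<in> G" "b \<in> G" "a \<noteq> b"
    then have "a \<in> {..<m} \<rightarrow>\<^sub>E {..<K}" "b \<in> {..<m} \<rightarrow>\<^sub>E {..<K}" unfolding G_def by blast+
    then have "\<exists>i\<in>{..<m}. a i \<noteq> b i" using ab(3) by (rule PiE_neqD)
    then show "box a \<inter> box b = {}" by (auto simp: box_def)
  qed
  have T: "has_dens (T i) (\<rho> ^ (K * Suc i))" if "i < m" for i
    using has_dens_count_ge[OF has_dens_S, of i K] that assms(2) invariant_S[of i] by (simp add: T_def)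
  define Z where "Z = X \<union> (\<Union>i<m. T i)"
  have ZS: "Z \<subseteq> S" using has_dens_subset[OF assms(4)] by (auto simp: Z_def T_def)
  have sub1: "Q \<subseteq> Q' \<union> Z"
  proof
    fix A assume A: "A \<in> Q"
    show "A \<in> Q' \<union> Z"
    proof (cases "A \<in> Z")
      case False
      define a where "a = restrict (\<lambda>i. count A (z i)) {..<m}"
      have "A \<in> box a" using A assms(3) by (auto simp: box_def a_def)
      moreover have "a \<in> G"
        unfolding G_def using False A assms(3) \<open>A \<in> box a\<close>
        by (auto simp: a_def Z_def T_def not_le)
      ultimately show ?thesis by (auto simp: Q'_def)
    qed simp
  qed
  have sub2: "Q' \<subseteq> Q \<union> Z"
  proof
    fix A assume "A \<in> Q'"
    then obtain a B where *: "a \<in> G" "A \<in> box a" "B \<in> Q - X" "B \<in> box a"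
      by (auto simp: Q'_def G_def)
    show "A \<in> Q \<union> Z"
    proof (cases "A \<in> X")
      case False
      have "A \<in> Q \<longleftrightarrow> B \<in> Q" by (rule det) (use * False in \<open>auto simp: box_def\<close>)
      then show ?thesis using * by simp
    qed (simp add: Z_def)
  qed
  have Zcard: "level_card w Z n \<le> level_card w X n + (\<Sum>i<m. level_card w (T i) n)" for n
  proof -
    have "level w Z n = level w X n \<union> (\<Union>i<m. level w (T i) n)" by (auto simp: Z_def level_def)
    then have "level_card w Z n \<le> level_card w X n + card (\<Union>i<m. level w (T i) n)"
      by (simp add: card_Un_le)
    also have "card (\<Union>i<m. level w (T i) n) \<le> (\<Sum>i<m. level_card w (T i) n)"
      by (rule card_UN_le) simp
    finally show ?thesis by simp
  qed
  have Zle: "share Z n \<le>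
      share X n + (\<Sum>i<m. share (T i) n)" for n
  proof -
    have "real (level_card w Z n) \<le> real (level_card w X n + (\<Sum>i<m. level_card w (T i) n))"
      using Zcard[of n] by (simp only: of_nat_le_iff)
    from divide_right_mono[OF this, of "real (c n)"] show ?thesis
      by (simp add: add_divide_distrib sum_divide_distrib)
  qed
  have "(\<lambda>n. share X n + (\<Sum>i<m. share (T i) n))
      \<longlonglongrightarrow> 0 + (\<Sum>i<m. \<rho> ^ (K * Suc i))"
    using assms(4) T by (intro tendsto_add tendsto_sum) (auto simp: has_dens_def)
  then have ev1: "\<forall>\<^sub>F n in sequentially. share X n +
      (\<Sum>i<m. share (T i) n) < e / 2"
    using K by (intro order_tendstoD(2)) auto
  have "\<forall>\<^sub>F n in sequentially. dist (share Q' n) (\<Sum>a\<in>G. L a) < e / 2"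
    using Q' e by (intro tendstoD) (auto simp: has_dens_def)
  with ev1 have "\<forall>\<^sub>F n in sequentially. \<bar>share Q n - (\<Sum>a\<in>G. L a)\<bar> < e"
  proof eventually_elim
    case (elim n)
    have "\<bar>share Q n - share Q' n\<bar> \<le> share Z n"
      using sub1 sub2 assms(3) has_dens_subset[OF Q'] ZS by (rule share_diff_le)
    also have "\<dots> < e / 2" using Zle[of n] elim(1) by linarith
    finally have "\<bar>share Q n - share Q' n\<bar> < e / 2" .
    then show ?case using elim(2) unfolding dist_real_def by linarith
  qed
  then show "\<exists>L. \<forall>\<^sub>F n in sequentially. \<bar>share Q n - L\<bar> < e" by blast
qed

text \<open>
  For \<open>\<rho> = 1\<close> the residues of the multiplicities are equidistributed: replacing one \<open>z (m + j + 1)\<close> by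
  \<open>z m\<close> and \<open>z j\<close> preserves the weight and raises the multiplicity of \<open>z j\<close>.
\<close>

lemma swap_level_card:
  fixes q :: nat
  assumes "m + j + 1 < M" "j < m"
  defines "R \<equiv> \<lambda>r. {A\<in>S. \<forall>i<m. count A (z i) mod q = (r i :: nat)}"
  assumes q: "0 < q" and r: "r j < q"
  shows "level_card w {A \<in> R r. 0 < count A (z (m + j + 1))} n =
    level_card w {A \<in> R (r(j := Suc (r j) mod q)). 0 < count A (z m) \<and> 0 < count A (z j)} n"
proof -
  let ?x = "z (m + j + 1)" and ?y = "z m" and ?v = "z j" and ?r' = "r(j := Suc (r j) mod q)"
  \<comment> \<open>The weights m + j + 2 and (m + 1) + (j + 1) agree. As
    \<open>z (m + j + 1)\<close> and \<open>z m\<close> lie outside the indices below m, the only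
    residue that changes is that at j.\<close>
  define f where "f A = add_mset ?y (add_mset ?v (A - {#?x#}))" for A
  define g where "g A = add_mset ?x (A - {#?y#} - {#?v#})" for A
  have ne: "?x \<noteq> ?y" "?x \<noteq> ?v" "?y \<noteq> ?v" using assms(1,2) z_eq_iff by auto
  have nei: "z i \<noteq> ?x" "z i \<noteq> ?y" if "i < m" for i using assms(1,2) that z_eq_iff by auto
  have nev: "z i \<noteq> ?v" if "i < m" "i \<noteq> j" for i using assms(1,2) that z_eq_iff by auto
  have gf: "g (f A) = A" if "0 < count A ?x" for A
    using that by (simp add: f_def g_def)
  have fg: "f (g A) = A" if A: "0 < count A ?y" "0 < count A ?v" for A
  proof -
    obtain A' where A': "A = add_mset ?y A'" using A(1) by (auto dest: multi_member_split)
    then have "?v \<in># A'" using A(2) ne by (auto split: if_splits)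
    then obtain B where "A' = add_mset ?v B" by (auto dest: multi_member_split)
    then show ?thesis using A' by (simp add: f_def g_def)
  qed
  have fS: "f A \<in> S \<longleftrightarrow> A \<in> S" if "0 < count A ?x" for A
  proof -
    have "f A \<in> S \<longleftrightarrow> A - {#?x#} \<in> S" using assms(1,2) closed[of m] closed[of j] by (simp add: f_def)
    also have "\<dots> \<longleftrightarrow> add_mset ?x (A - {#?x#}) \<in> S" using assms(1) closed[of "m + j + 1"] by simp
    finally show ?thesis using that by simp
  qed
  have fw: "wsum w (f A) = wsum w A" if "0 < count A ?x" for A
  proof -
    have "wsum w A = wsum w (add_mset ?x (A - {#?x#}))" using that by simp
    then show ?thesis using assms(1,2) weight_z by (simp add: f_def)
  qed
  have suc_mod: "Suc a mod q = Suc b mod q \<longleftrightarrow> a mod q = b mod q" for a b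
  proof
    assume "Suc a mod q = Suc b mod q"
    then have "(Suc a + (q - 1)) mod q = (Suc b + (q - 1)) mod q" by (metis mod_add_left_eq)
    then show "a mod q = b mod q" using q by simp
  qed (metis mod_Suc_eq)
  have fR: "f A \<in> R ?r' \<longleftrightarrow> A \<in> R r" if "0 < count A ?x" for A
  proof -
    have cnt: "count (f A) (z i) = (if i = j then Suc (count A (z i)) else count A (z i))" if "i < m" for i
      using nei[OF that] nev[OF that] ne by (cases "i = j") (auto simp: f_def)
    have "(\<forall>i<m. count (f A) (z i) mod q = ?r' i) \<longleftrightarrow> (\<forall>i<m. count A (z i) mod q = r i)"
      using cnt suc_mod[of _ "r j"] r assms(2) by (auto split: if_splits)
    then show ?thesis using fS[OF that] by (simp add: R_def)
  qed
  have "bij_betw f (level w {A \<in> R r. 0 < count A ?x} n)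
      (level w {A \<in> R ?r'. 0 < count A ?y \<and> 0 < count A ?v} n)"
  proof (rule bij_betw_byWitness[where f' = g])
    show "\<forall>A\<in>level w {A \<in> R r. 0 < count A ?x} n. g (f A) = A" by (auto simp: level_def gf)
    show "\<forall>A\<in>level w {A \<in> R ?r'. 0 < count A ?y \<and> 0 < count A ?v} n. f (g A) = A"
      by (auto simp: level_def fg)
    show "f ` level w {A \<in> R r. 0 < count A ?x} n \<subseteq> level w {A \<in> R ?r'. 0 < count A ?y \<and> 0 < count A ?v} n"
    proof
      fix B assume "B \<in> f ` level w {A \<in> R r. 0 < count A ?x} n"
      then obtain A where "B = f A" "A \<in> R r" "0 < count A ?x" "wsum w A = n" by (auto simp: level_def)
      then show "B \<in> level w {A \<in> R ?r'. 0 < count A ?y \<and> 0 < count A ?v} n"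
        using fR fw by (simp add: level_def f_def)
    qed
    show "g ` level w {A \<in> R ?r'. 0 < count A ?y \<and> 0 < count A ?v} n \<subseteq> level w {A \<in> R r. 0 < count A ?x} n"
    proof
      fix B assume "B \<in> g ` level w {A \<in> R ?r'. 0 < count A ?y \<and> 0 < count A ?v} n"
      then obtain A where A: "B = g A" "A \<in> R ?r'" "0 < count A ?y" "0 < count A ?v" "wsum w A = n"
        by (auto simp: level_def)
      have B: "0 < count B ?x" by (simp add: A(1) g_def)
      have "f B = A" using A fg by simp
      then show "B \<in> level w {A \<in> R r. 0 < count A ?x} n"
        using fR[OF B] fw[OF B] A B by (simp add: level_def)
    qed
  qed
  then show ?thesis by (rule bij_betw_same_card)
qed

text \<open>For rho = 1 bounded multiplicities have density 0, so the exchange carries each residue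
  class to the next one up to null sets. All classes then have the same density, and Q is a union of
  some of them up to a null set.\<close>

theorem convergent_if_ratio_1:
  assumes "\<rho> = 1" "2 * m < M" "Q \<subseteq> S" "has_dens X 0" and q: "0 < q"
    and det: "\<And>A B. A \<in> S - X \<Longrightarrow> B \<in> S - X \<Longrightarrow>
      (\<And>i. i < m \<Longrightarrow> K \<le> count A (z i) \<and> K \<le> count B (z i) \<and>
        count A (z i) mod q = count B (z i) mod q) \<Longrightarrow> A \<in> Q \<longleftrightarrow> B \<in> Q"
  shows "convergent (\<lambda>n. share Q n)"
proof -
  define R where "R r = {A\<in>S. \<forall>i<m. count A (z i) mod q = (r i :: nat)}" for r
  define d where "d r n = share (R r) n" for r n
  have RS: "R r \<subseteq> S" for r by (auto simp: R_def)
  have few: "has_dens {A\<in>S. count A (z i) < k} 0" if "i < M" for i k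
  proof -
    have "has_dens (S - {A\<in>S. k \<le> count A (z i)}) (1 - 1 * \<rho> ^ (k * Suc i))"
      using that by (intro has_dens_Diff has_dens_S has_dens_count_ge invariant_S) auto
    moreover have "S - {A\<in>S. k \<le> count A (z i)} = {A\<in>S. count A (z i) < k}" by auto
    ultimately show ?thesis using assms(1) by simp
  qed
  have move: "(\<lambda>n. d r n - d (r(j := Suc (r j) mod q)) n) \<longlonglongrightarrow> 0" if j: "j < m" "r j < q" for r j
  proof -
    let ?r' = "r(j := Suc (r j) mod q)"
    define Z where "Z = {A\<in>S. count A (z (m + j + 1)) < 1} \<union> ({A\<in>S. count A (z m) < 1} \<union> {A\<in>S. count A (z j) < 1})"
    have Z: "has_dens Z 0"
      unfolding Z_def using assms(2) j by (intro null_Un few) auto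
    have le: "\<bar>d r n - d ?r' n\<bar> \<le> 2 * (share Z n)" for n
    proof -
      let ?U = "{A \<in> R r. 0 < count A (z (m + j + 1))}"
        and ?V = "{A \<in> R ?r'. 0 < count A (z m) \<and> 0 < count A (z j)}"
      have "\<bar>share (R r) n - share ?U n\<bar> \<le> share Z n" "\<bar>share (R ?r') n - share ?V n\<bar> \<le> share Z n"
        by (rule share_diff_le; use has_dens_subset[OF Z] in \<open>auto simp: R_def Z_def\<close>)+
      moreover have "level_card w ?U n = level_card w ?V n"
        unfolding R_def using assms(2) j q by (intro swap_level_card) auto
      ultimately show ?thesis by (simp add: d_def)
    qed
    have "(\<lambda>n. 2 * (share Z n)) \<longlonglongrightarrow> 2 * 0"
      using Z by (intro tendsto_mult tendsto_const) (simp add: has_dens_def)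
    then show ?thesis
      by (intro tendsto_null_comparison[OF le]) simp
  qed
  have moves: "(\<lambda>n. d r n - d (r(j := (r j + t) mod q)) n) \<longlonglongrightarrow> 0" if j: "j < m" "r j < q" for r j t
  proof (induction t)
    case 0
    then show ?case using j by simp
  next
    case (Suc t)
    let ?r = "r(j := (r j + t) mod q)"
    have "(\<lambda>n. d ?r n - d (?r(j := Suc (?r j) mod q)) n) \<longlonglongrightarrow> 0"
      using j q by (intro move) auto
    moreover have "?r(j := Suc (?r j) mod q) = r(j := (r j + Suc t) mod q)"
      by (simp add: mod_Suc_eq)
    ultimately have "(\<lambda>n. d ?r n - d (r(j := (r j + Suc t) mod q)) n) \<longlonglongrightarrow> 0" by (simp only:)
    with Suc show ?case by (rule tendsto_diff_trans)
  qed
  have to_zero: "(\<lambda>n. d r n - d (\<lambda>_. 0) n) \<longlonglongrightarrow> 0" if r: "\<And>i. i < m \<Longrightarrow> r i < q" for r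
  proof -
    have "(\<lambda>n. d r n - d (\<lambda>i. if i < k then 0 else r i) n) \<longlonglongrightarrow> 0" if "k \<le> m" for k
      using that
    proof (induction k)
      case (Suc k)
      let ?r = "\<lambda>i. if i < k then 0 else r i"
      \<comment> \<open>Raising the residue at k by q - r k, one exchange at a time, brings it to
        0.\<close>
      have "(\<lambda>n. d ?r n - d (?r(k := (?r k + (q - r k)) mod q)) n) \<longlonglongrightarrow> 0"
        using Suc.prems r by (intro moves) auto
      moreover have "?r(k := (?r k + (q - r k)) mod q) = (\<lambda>i. if i < Suc k then 0 else r i)"
        using r[of k] Suc.prems by (auto simp: fun_eq_iff less_Suc_eq)
      ultimately have "(\<lambda>n. d ?r n - d (\<lambda>i. if i < Suc k then 0 else r i) n) \<longlonglongrightarrow> 0" by (simp only:)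
      with Suc.IH[OF Suc_leD[OF Suc.prems]] show ?case by (rule tendsto_diff_trans)
    qed simp
    from this[of m] have "(\<lambda>n. d r n - d (\<lambda>i. if i < m then 0 else r i) n) \<longlonglongrightarrow> 0" by simp
    moreover have "R (\<lambda>i. if i < m then 0 else r i) = R (\<lambda>_. 0)" by (auto simp: R_def)
    ultimately show ?thesis by (simp add: d_def)
  qed
  define P where "P = {..<m} \<rightarrow>\<^sub>E {..<q}"
  have finP: "finite P" by (simp add: P_def finite_PiE)
  have "P \<noteq> {}" using q by (auto simp: P_def PiE_eq_empty_iff)
  then have cardP: "0 < card P" using finP by (simp add: card_gt_0_iff)
  have disjR: "R r \<inter> R r' = {}" if "r \<in> P" "r' \<in> P" "r \<noteq> r'" for r r'
  proof -
    have "\<exists>i\<in>{..<m}. r i \<noteq> r' i"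
      using that unfolding P_def by (rule PiE_neqD)
    then show ?thesis by (auto simp: R_def)
  qed
  have UNR: "(\<Union>r\<in>P. R r) = S"
  proof
    show "S \<subseteq> (\<Union>r\<in>P. R r)"
    proof
      fix A assume "A \<in> S"
      then have "A \<in> R (restrict (\<lambda>i. count A (z i) mod q) {..<m})" by (auto simp: R_def)
      moreover have "restrict (\<lambda>i. count A (z i) mod q) {..<m} \<in> P" using q by (auto simp: P_def)
      ultimately show "A \<in> (\<Union>r\<in>P. R r)" by blast
    qed
  qed (use RS in auto)
  have sum_d: "(\<Sum>r\<in>P. d r n) = 1" for n
  proof -
    have "level w S n = (\<Union>r\<in>P. level w (R r) n)" using UNR by (auto simp: level_def)
    then have "c n = (\<Sum>r\<in>P. level_card w (R r) n)"
      using finP finite_level[OF RS] disjR by (simp add: card_UN_disjoint level_def disjoint_iff)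
    then have "(\<Sum>r\<in>P. d r n) = real (c n) / real (c n)"
      unfolding d_def sum_divide_distrib[symmetric] by simp
    then show ?thesis using c_pos[of n] by simp
  qed
  \<comment> \<open>No share is known to converge beforehand. But the differences tend to 0 and the
    shares add up to 1, which forces the share of the class 0 to tend to 1 /
    \<open>card P\<close>.\<close>
  have "(\<lambda>n. \<Sum>r\<in>P. d r n - d (\<lambda>_. 0) n) \<longlonglongrightarrow> (\<Sum>r\<in>P. 0)"
    by (intro tendsto_sum to_zero) (auto simp: P_def)
  then have "(\<lambda>n. 1 - real (card P) * d (\<lambda>_. 0) n) \<longlonglongrightarrow> 0"
    by (simp add: sum_subtractf sum_d)
  from tendsto_diff[OF tendsto_const[of 1] this]
  have "(\<lambda>n. real (card P) * d (\<lambda>_. 0) n) \<longlonglongrightarrow> 1" by simp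
  from tendsto_divide[OF this tendsto_const[of "real (card P)"]] cardP
  have d0: "d (\<lambda>_. 0) \<longlonglongrightarrow> 1 / real (card P)" by simp
  have dens_R: "has_dens (R r) (1 / real (card P))" if "r \<in> P" for r
  proof -
    have "(\<lambda>n. d r n - d (\<lambda>_. 0) n) \<longlonglongrightarrow> 0" using that by (intro to_zero) (auto simp: P_def)
    from tendsto_add[OF this d0] show ?thesis using RS by (simp add: has_dens_def d_def)
  qed
  define Z where "Z = X \<union> (\<Union>i<m. {A\<in>S. count A (z i) < K})"
  have Z: "has_dens Z 0"
    unfolding Z_def using assms(2,4) by (intro null_Un null_UN few) auto
  define G where "G = {r\<in>P. \<exists>A\<in>Q - Z. A \<in> R r}"
  have "has_dens (\<Union>r\<in>G. R r) (\<Sum>r\<in>G. 1 / real (card P))"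
    by (rule has_dens_UN) (use finP dens_R disjR in \<open>auto simp: G_def\<close>)
  then have "has_dens Q (\<Sum>r\<in>G. 1 / real (card P))"
  proof (rule has_dens_modulo_null[OF _ Z assms(3)])
    show "Q \<subseteq> (\<Union>r\<in>G. R r) \<union> Z"
    proof
      fix A assume A: "A \<in> Q"
      show "A \<in> (\<Union>r\<in>G. R r) \<union> Z"
      proof (cases "A \<in> Z")
        case False
        obtain r where "r \<in> P" "A \<in> R r" using UNR A assms(3) by blast
        then show ?thesis using A False by (auto simp: G_def)
      qed simp
    qed
    show "(\<Union>r\<in>G. R r) \<subseteq> Q \<union> Z"
    proof
      fix A assume "A \<in> (\<Union>r\<in>G. R r)"
      then obtain r B where *: "A \<in> R r" "B \<in> Q - Z" "B \<in> R r" by (auto simp: G_def)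
      show "A \<in> Q \<union> Z"
      proof (cases "A \<in> Z")
        case False
        have "A \<in> Q \<longleftrightarrow> B \<in> Q"
          by (rule det) (use * False assms(3) in \<open>auto simp: Z_def R_def not_less\<close>)
        then show ?thesis using * by simp
      qed simp
    qed
  qed
  then show ?thesis unfolding has_dens_def convergent_def by blast
qed

end

section \<open>Counting ordinals by norm\<close>

definition below :: "ordinal \<Rightarrow> ordinal multiset set" where
  "below \<beta> = {A. ord_of_mset A < \<beta>}"

abbreviation below_card :: "ordinal \<Rightarrow> nat \<Rightarrow> nat" where
  "below_card \<beta> \<equiv> level_card weight (below \<beta>)"

lemma card_norm_ord_eq:
  assumes "\<beta> \<le> Gamma0"
  shows "card {\<alpha>. \<alpha> < \<beta> \<and> P \<alpha> \<and> norm_ord \<alpha> = n} =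
    level_card weight {A \<in> below \<beta>. P (ord_of_mset A)} n"
proof -
  have norm: "norm_ord (ord_of_mset A) = wsum weight A" if "ord_of_mset A < \<beta>" for A
    using norm_ord_of_mset[of A] assms that by (simp add: wsum_def)
  have "bij_betw ord_of_mset (level weight {A \<in> below \<beta>. P (ord_of_mset A)} n)
      {\<alpha>. \<alpha> < \<beta> \<and> P \<alpha> \<and> norm_ord \<alpha> = n}"
    unfolding bij_betw_def
  proof
    show "inj_on ord_of_mset (level weight {A \<in> below \<beta>. P (ord_of_mset A)} n)"
      by (simp add: inj_on_def)
    show "ord_of_mset ` level weight {A \<in> below \<beta>. P (ord_of_mset A)} n =
        {\<alpha>. \<alpha> < \<beta> \<and> P \<alpha> \<and> norm_ord \<alpha> = n}"
    proof (intro equalityI subsetI)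
      fix \<alpha> assume \<alpha>: "\<alpha> \<in> {\<alpha>. \<alpha> < \<beta> \<and> P \<alpha> \<and> norm_ord \<alpha> = n}"
      obtain A where "\<alpha> = ord_of_mset A" using bij_ord_of_mset by (metis bij_pointE)
      then show "\<alpha> \<in> ord_of_mset ` level weight {A \<in> below \<beta>. P (ord_of_mset A)} n"
        using \<alpha> norm[of A] by (auto simp: level_def below_def)
    qed (auto simp: level_def below_def norm)
  qed
  then show ?thesis by (rule bij_betw_same_card[symmetric])
qed

lemma norm_count_eq: "\<beta> \<le> Gamma0 \<Longrightarrow> norm_count \<beta> n = below_card \<beta> n"
  using card_norm_ord_eq[of \<beta> "\<lambda>_. True" n] by (simp add: norm_count_def)

lemma finite_level_below:
  assumes "\<beta> \<le> Gamma0"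
  shows "finite (level weight (below \<beta>) n)"
proof (rule inj_on_finite[OF _ _ finite_norm_ord[of n]])
  show "inj_on ord_of_mset (level weight (below \<beta>) n)" by (simp add: inj_on_def)
  show "ord_of_mset ` level weight (below \<beta>) n \<subseteq> {z. z < Gamma0 \<and> norm_ord z = n}"
    using assms norm_ord_of_mset by (auto simp: level_def below_def wsum_def)
qed

lemma below_mono: "\<beta> \<le> \<gamma> \<Longrightarrow> below \<beta> \<subseteq> below \<gamma>"
  by (auto simp: below_def)

lemma below_omega_pow: "below (omega_pow e) = {A. set_mset A \<subseteq> {..<e}}"
  by (auto simp: below_def ord_of_mset_less_omega_pow_iff)

lemma ex_ord_of_mset: obtains A where "ord_of_mset A = x"
  using bij_ord_of_mset by (metis bij_pointE)

text \<open>The exponents below e of weight s are the ordinals below e of norm s - 1, so the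
  hypothesis on e is, up to a shift, the one that \<open>slow_multisets\<close> needs.\<close>

lemma slow_below_omega_pow:
  assumes "omega_pow e \<le> Gamma0" and fp: "\<And>f. f \<le> e \<Longrightarrow> omega_pow f \<noteq> f"
    and slow: "slow (below_card e)"
  shows "slow (below_card (omega_pow e))"
proof (cases "e = 0")
  \<comment> \<open>There is no exponent of weight 1 here; only the empty multiset lies below
    omega^0 = 1.\<close>
  case True
  have "{..<0 :: ordinal} = {}" by auto
  then have "level weight (below (omega_pow e)) n = {}" if "1 \<le> n" for n
    using that True unfolding below_omega_pow by (auto simp: level_def)
  then show ?thesis by (intro slow_eventually_0[of 1]) simp
next
  case False
  then have pow_less: "omega_pow f < Gamma0" if "f < e" for f
    using assms(1) that by (meson less_le_trans omega_pow_less_iff)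
  have "0 < e" using False by (simp add: ordinal_pos_iff)
  have eG: "e \<le> Gamma0" using assms(1) le_omega_pow order_trans by blast
  show ?thesis
    unfolding below_omega_pow
  proof (rule slow_multisets)
    show "0 < weight f" if "f \<in> {..<e}" for f
      using that pow_less weight_pos by simp
    show "0 \<in> {..<e}" using \<open>0 < e\<close> by simp
    show "weight 0 = 1" using weight_fin_ord[of 0] pow_less[OF \<open>0 < e\<close>] by simp
    show "finite (level weight {A. set_mset A \<subseteq> {..<e}} n)" for n
      using finite_level_below[OF assms(1)] unfolding below_omega_pow .
    have weight_Suc: "weight f = Suc (norm_ord f)" if "f < e" for f
      using weight_eq[of f] fp pow_less[OF that] that by (simp add: order_trans[OF _ less_imp_le])
    have "card {f \<in> {..<e}. weight f = s} = (if s < 1 then 0 else below_card e (s - 1))" for s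
    proof (cases s)
      case 0
      then have empty: "{f \<in> {..<e}. weight f = s} = {}" using weight_Suc by auto
      show ?thesis unfolding empty using 0 by simp
    next
      case (Suc t)
      then have eq: "{f \<in> {..<e}. weight f = s} = {f. f < e \<and> norm_ord f = t}" using weight_Suc by auto
      show ?thesis unfolding eq using norm_count_eq[OF eG, of t] Suc by (simp add: norm_count_def)
    qed
    then show "slow (\<lambda>s. card {f \<in> {..<e}. weight f = s})"
      using slow_shift[OF slow, of 1] by presburger
  qed
qed

text \<open>With beta = omega^e + r, an ordinal below beta is below omega^e or of the form omega^e +
  s with s < r. So the count is the one below omega^e plus a shifted one below r. The induction
  applies to r, and to e because e < omega^e in the absence of fixed points.\<close>

lemma slow_below:
  assumes "\<beta> \<le> Gamma0" and fp: "\<And>e. e \<le> \<beta> \<Longrightarrow> omega_pow e \<noteq> e"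
  shows "slow (below_card \<beta>)"
  using assms
proof (induction \<beta> rule: less_induct)
  case (less \<beta>)
  show ?case
  proof (cases "\<beta> = 0")
    case True
    then show ?thesis by (intro slow_eventually_0[of 0]) (simp add: below_def level_def)
  next
    case False
    then obtain e r where r: "\<beta> = omega_pow e + r" "r < \<beta>" by (rule leading_omega_power)
    have pow_le: "omega_pow e \<le> \<beta>" unfolding r(1) by simp
    have "e < omega_pow e"
      using le_omega_pow[of e] less.prems(2)[of e] pow_le by (metis order.not_eq_order_implies_strict order_trans)
    then have "e < \<beta>" using pow_le by simp
    \<comment> \<open>Otherwise omega^e would be absorbed and beta = r. So ordinals below r have
      exponents at most e, and the term omega^e can be put in front of them.\<close>
    have r_less: "r < omega_pow (osucc e)"
    proof (rule ccontr)
      assume "\<not> r < omega_pow (osucc e)"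
      then have "omega_pow (osucc e) \<le> r" by simp
      then obtain s where "r = omega_pow (osucc e) + s" by (rule ordinal_le_imp_diff)
      then have "\<beta> = r"
        using add_omega_pow_absorb[OF omega_pow_strict_mono[OF less_osucc[of e]]]
        by (simp add: r(1) add.assoc[symmetric])
      with r(2) show False by simp
    qed
    have ord_add: "ord_of_mset (add_mset e B) = omega_pow e + ord_of_mset B" if "ord_of_mset B < omega_pow (osucc e)" for B
    proof -
      have "\<forall>f\<in>#B. f \<le> e"
        using that by (simp add: ord_of_mset_less_omega_pow_iff less_osucc_iff)
      then show ?thesis
        using ord_of_mset_add[of "{#e#}" B] ord_of_mset_replicate[of 1 e] by simp
    qed
    have "slow (below_card e)"
    proof (rule less.IH[OF \<open>e < \<beta>\<close>])
      show "e \<le> Gamma0" using \<open>e < \<beta>\<close> less.prems(1) by simp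
      show "\<And>f. f \<le> e \<Longrightarrow> omega_pow f \<noteq> f" using \<open>e < \<beta>\<close> less.prems(2) by (meson le_less_trans less_imp_le)
    qed
    then have slow1: "slow (below_card (omega_pow e))"
    proof (rule slow_below_omega_pow[rotated 2])
      show "omega_pow e \<le> Gamma0" using pow_le less.prems(1) by simp
      show "\<And>f. f \<le> e \<Longrightarrow> omega_pow f \<noteq> f" using \<open>e < \<beta>\<close> less.prems(2) by (meson le_less_trans less_imp_le)
    qed
    have slow2: "slow (below_card r)"
    proof (rule less.IH[OF r(2)])
      show "r \<le> Gamma0" using r(2) less.prems(1) by simp
      show "\<And>f. f \<le> r \<Longrightarrow> omega_pow f \<noteq> f" using r(2) less.prems(2) by (meson le_less_trans less_imp_le)
    qed
    define E where "E = {A. omega_pow e \<le> ord_of_mset A \<and> ord_of_mset A < \<beta>}"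
    have E_card: "level_card weight E n = (if n < weight e then 0 else below_card r (n - weight e))" for n
    proof -
      have E_eq: "E = add_mset e ` below r"
      proof (intro equalityI subsetI)
        fix A assume "A \<in> E"
        then have A: "omega_pow e \<le> ord_of_mset A" "ord_of_mset A < \<beta>" by (simp_all add: E_def)
        from A(1) obtain s where s: "ord_of_mset A = omega_pow e + s" by (rule ordinal_le_imp_diff)
        obtain B where B: "ord_of_mset B = s" by (rule ex_ord_of_mset)
        have "s < r" using A(2) s r(1) by simp
        then have "ord_of_mset (add_mset e B) = ord_of_mset A"
          using ord_add[of B] B s r_less by simp
        then have "A = add_mset e B" by simp
        then show "A \<in> add_mset e ` below r" using \<open>s < r\<close> B by (simp add: below_def)
      next
        fix A assume "A \<in> add_mset e ` below r"
        then obtain B where "A = add_mset e B" "ord_of_mset B < r" by (auto simp: below_def)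
        then show "A \<in> E" using ord_add[of B] r_less r(1) by (simp add: E_def less_trans)
      qed
      show ?thesis
      proof (cases "n < weight e")
        case True
        then have "level weight E n = {}" by (auto simp: E_eq level_def)
        then show ?thesis using True by simp
      next
        case False
        then have "level weight E n = add_mset e ` level weight (below r) (n - weight e)"
          unfolding E_eq level_def by auto
        then show ?thesis using False by (simp add: card_image inj_on_def)
      qed
    qed
    have "below_card \<beta> n = below_card (omega_pow e) n + level_card weight E n" for n
    proof -
      have "level weight (below \<beta>) n = level weight (below (omega_pow e)) n \<union> level weight E n"
        using pow_le by (auto simp: level_def below_def E_def not_less)
      moreover have "level weight (below (omega_pow e)) n \<inter> level weight E n = {}"
        by (auto simp: level_def below_def E_def)
      moreover have "finite (level weight (below \<beta>) n)" by (rule finite_level_below[OF less.prems(1)])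
      ultimately show ?thesis by (metis card_Un_disjoint finite_Un)
    qed
    moreover have "slow (\<lambda>n. below_card (omega_pow e) n + level_card weight E n)"
      using slow_add[OF slow1 slow_shift[OF slow2, of "weight e"]] by (simp add: E_card)
    ultimately show ?thesis by presburger
  qed
qed

text \<open>An e \<le> omega^k is finite or satisfies omega^k < omega^e; in neither case is it a
  fixed point. These segments are the yardstick for negligible sets also when beta is beyond
  epsilon_0.\<close>

lemma slow_below_omega_pow_fin_ord:
  assumes "fin_pow k \<le> Gamma0"
  shows "slow (below_card (fin_pow k))"
proof (rule slow_below[OF assms])
  fix e assume e: "e \<le> fin_pow k"
  show "omega_pow e \<noteq> e"
  proof (cases "e < omega")
    case True
    then show ?thesis using omega_pow_fin_ord_neq by (auto simp: less_omega_iff)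
  next
    case False
    then have "fin_ord k < e" by (intro less_le_trans[OF fin_ord_less_omega]) simp
    then have "fin_pow k < omega_pow e" by simp
    from le_less_trans[OF e this] show ?thesis by (metis less_irrefl)
  qed
qed

lemma slow_ratio_tendsto_1:
  assumes "slow c" "\<And>n. c n \<le> c (Suc n)" "\<And>n. 0 < c n"
  shows "(\<lambda>n. real (c n) / real (c (Suc n))) \<longlonglongrightarrow> 1"
proof (rule LIMSEQ_I)
  fix e :: real assume e: "0 < e"
  then obtain N where N: "\<And>n. N \<le> n \<Longrightarrow> real (c (Suc n)) \<le> (1 + e / 2) * real (c n)"
    using assms(1) unfolding slow_def eventually_sequentially by (metis half_gt_zero)
  have "norm (real (c n) / real (c (Suc n)) - 1) < e" if "N \<le> n" for n
  proof -
    have pos: "0 < real (c (Suc n))" using assms(3) by simp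
    have "real (c (Suc n)) - real (c n) \<le> e / 2 * real (c n)"
      using N[OF that] by (simp add: algebra_simps)
    also have "\<dots> \<le> e / 2 * real (c (Suc n))"
      using e assms(2)[of n] by (intro mult_left_mono) auto
    also have "\<dots> < e * real (c (Suc n))" using e pos by simp
    finally have "1 - real (c n) / real (c (Suc n)) < e"
      using pos by (simp add: field_simps)
    moreover have "real (c n) / real (c (Suc n)) \<le> 1" using assms(2)[of n] pos by simp
    ultimately show ?thesis by simp
  qed
  then show "\<exists>N. \<forall>n\<ge>N. norm (real (c n) / real (c (Suc n)) - 1) < e" by blast
qed

section \<open>Stable segments and negligible segments\<close>

lemma below_high_part_add_mset:
  "e < c \<Longrightarrow> add_mset e A \<in> below (ord_of_mset (high_part c B)) \<longleftrightarrow> A \<in> below (ord_of_mset (high_part c B))"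
proof -
  assume "e < c"
  then have "high_part c (add_mset e A) = high_part c A" by (simp add: high_part_def not_le)
  then show ?thesis
    unfolding below_def mem_Collect_eq using ord_of_mset_less_high_part_iff by metis
qed

lemma closed_multisets_below:
  assumes "\<beta> \<le> Gamma0" "fin_pow M \<le> \<beta>" "0 < M"
    and "\<And>i A. i < M \<Longrightarrow> add_mset (fin_ord i) A \<in> below \<beta> \<longleftrightarrow> A \<in> below \<beta>"
  shows "closed_multisets weight (below \<beta>) fin_ord M"
proof
  show "weight (fin_ord i) = Suc i" if "i < M" for i
  proof -
    have "fin_pow i < fin_pow M" using that by simp
    also have "\<dots> \<le> Gamma0" using assms(1,2) by simp
    finally show ?thesis by (rule weight_fin_ord)
  qed
  show "{#} \<in> below \<beta>"
    using assms(2) by (auto simp: below_def intro: less_le_trans[OF omega_pow_pos])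
qed (use assms finite_level_below in auto)

lemma counted_multisets_below_slow:
  assumes "\<beta> \<le> Gamma0" "fin_pow M \<le> \<beta>" "0 < M"
    and "\<And>i A. i < M \<Longrightarrow> add_mset (fin_ord i) A \<in> below \<beta> \<longleftrightarrow> A \<in> below \<beta>"
    and "slow (below_card \<beta>)"
  shows "counted_multisets weight (below \<beta>) fin_ord M 1"
proof -
  interpret closed_multisets weight "below \<beta>" fin_ord M
    by (rule closed_multisets_below[OF assms(1-4)])
  show ?thesis
    by unfold_locales (rule slow_ratio_tendsto_1[OF assms(5) c_mono c_pos])
qed

lemma below_omega_pow_add_mset: "e < c \<Longrightarrow> add_mset e A \<in> below (omega_pow c) \<longleftrightarrow> A \<in> below (omega_pow c)"
  by (simp add: below_omega_pow)

text \<open>The comparison is made inside omega^(M+1), where the counting function is slow whatever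
  beta is, so that avoiding the exponent M has density 0. A larger beta only increases the
  denominator.\<close>

lemma low_ordinals_negligible:
  assumes "fin_pow (Suc M) \<le> \<beta>" "\<beta> \<le> Gamma0"
  shows "(\<lambda>n. real (below_card (fin_pow M) n) / real (below_card \<beta> n)) \<longlonglongrightarrow> 0"
proof -
  let ?\<gamma> = "fin_pow (Suc M)"
  have \<gamma>: "?\<gamma> \<le> Gamma0" using assms by simp
  interpret counted_multisets weight "below ?\<gamma>" fin_ord "Suc M" 1
    by (rule counted_multisets_below_slow[OF \<gamma> order_refl])
      (use below_omega_pow_add_mset slow_below_omega_pow_fin_ord[OF \<gamma>] in simp_all)
  have "has_dens (below ?\<gamma> - {A \<in> below ?\<gamma>. 1 \<le> count A (fin_ord M)}) (1 - 1 * 1 ^ (1 * Suc M))"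
    by (intro has_dens_Diff has_dens_S has_dens_count_ge invariant_S) auto
  moreover have "below ?\<gamma> - {A \<in> below ?\<gamma>. 1 \<le> count A (fin_ord M)} = below (fin_pow M)"
  proof -
    have "A \<in> below ?\<gamma> \<and> \<not> 1 \<le> count A (fin_ord M) \<longleftrightarrow> A \<in> below (fin_pow M)" for A
    proof -
      have "A \<in> below ?\<gamma> \<and> \<not> 1 \<le> count A (fin_ord M) \<longleftrightarrow>
          (\<forall>e\<in>#A. e \<le> fin_ord M) \<and> fin_ord M \<notin># A"
        by (auto simp: below_def ord_of_mset_less_omega_pow_iff less_fin_ord_Suc Suc_le_eq)
      also have "\<dots> \<longleftrightarrow> (\<forall>e\<in>#A. e < fin_ord M)"
        unfolding order.strict_iff_order by blast
      finally show ?thesis by (simp add: below_def ord_of_mset_less_omega_pow_iff)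
    qed
    then show ?thesis by blast
  qed
  ultimately have lim: "(\<lambda>n. real (below_card (fin_pow M) n) / real (c n)) \<longlonglongrightarrow> 0"
    by (simp add: has_dens_def)
  show ?thesis
  proof (rule tendsto_null_comparison[OF _ lim])
    fix n
    have "c n \<le> below_card \<beta> n"
      using below_mono[OF assms(1)] finite_level_below[OF assms(2)]
      by (intro card_mono) (auto simp: level_def)
    then show "\<bar>real (below_card (fin_pow M) n) / real (below_card \<beta> n)\<bar>
        \<le> real (below_card (fin_pow M) n) / real (c n)"
      using c_pos[of n] by (simp add: frac_le)
  qed
qed

section \<open>The limit law\<close>

lemma epsilon0_no_fixed_point: "e < epsilon0 \<Longrightarrow> omega_pow e \<noteq> e"
  unfolding epsilon0_def by (metis (mono_tags, lifting) not_less_Least)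

theorem mainTheorem3:
  fixes \<beta> :: ordinal and \<psi> :: mso
  assumes "omega_pow omega \<le> \<beta>" and "\<beta> \<le> Gamma0"
    and "epsilon0 \<le> \<beta> \<longrightarrow>
      (\<exists>\<rho>::real. \<rho> < 1 \<and>
        (\<lambda>n. real (norm_count \<beta> n) / real (norm_count \<beta> (n + 1))) \<longlonglongrightarrow> \<rho>)"
    and "mso_sentence \<psi>"
  shows "convergent (\<lambda>n. real (card {\<alpha>. \<alpha> < \<beta> \<and> \<alpha> \<Turnstile> \<psi> \<and> norm_ord \<alpha> = n}) /
    real (card {\<alpha>. \<alpha> < \<beta> \<and> norm_ord \<alpha> = n}))"
proof -
  obtain m K q where q: "q > 0" and
    mso: "\<And>A B. (\<exists>e\<in>#A. fin_ord m \<le> e) \<Longrightarrow> (\<exists>e\<in>#B. fin_ord m \<le> e) \<Longrightarrow> counts_agree m K q A B \<Longrightarrow>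
      ord_equiv (set_rank \<psi>) (ord_of_mset A) (ord_of_mset B)"
    by (rule ord_of_mset_ord_equiv[of "set_rank \<psi>"]) blast
  \<comment> \<open>The exchange in \<open>swap_level_card\<close> uses the indices m + j + 1 with j
    < m, of which the largest is 2 m.\<close>
  define M where "M = Suc (2 * m)"
  obtain A\<^sub>\<beta> where A\<beta>: "ord_of_mset A\<^sub>\<beta> = \<beta>" by (rule ex_ord_of_mset)
  \<comment> \<open>The segment below beta itself may fail to be closed: omega^omega lies below
    omega^omega + 1, but adding the exponent 0 to it leads out.\<close>
  define H where "H = high_part (fin_ord M) A\<^sub>\<beta>"
  define \<beta>\<^sub>0 where "\<beta>\<^sub>0 = ord_of_mset H"
  have \<beta>_split: "\<beta> = \<beta>\<^sub>0 + ord_of_mset (low_part (fin_ord M) A\<^sub>\<beta>)"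
    using ord_of_mset_split[of A\<^sub>\<beta> "fin_ord M"] by (simp add: A\<beta> \<beta>\<^sub>0_def H_def)
  have \<beta>0_le: "\<beta>\<^sub>0 \<le> \<beta>" by (subst \<beta>_split) simp
  then have \<beta>0_Gamma0: "\<beta>\<^sub>0 \<le> Gamma0" using assms(2) by simp
  have pow_\<beta>0: "omega_pow omega \<le> \<beta>\<^sub>0"
  proof -
    have "\<not> ord_of_mset A\<^sub>\<beta> < omega_pow omega" using assms(1) A\<beta> by simp
    then obtain e where e: "e \<in># A\<^sub>\<beta>" "omega \<le> e"
      unfolding ord_of_mset_less_omega_pow_iff by (auto simp: not_less)
    have "fin_ord M \<le> e" using less_le_trans[OF fin_ord_less_omega[of M] e(2)] by (rule less_imp_le)
    then have "e \<in># H" using e(1) by (simp add: H_def high_part_def)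
    then have "\<not> \<beta>\<^sub>0 < omega_pow omega"
      unfolding \<beta>\<^sub>0_def ord_of_mset_less_omega_pow_iff using e(2) by (auto simp: not_less)
    then show ?thesis by simp
  qed
  have pow_fin: "fin_pow k \<le> \<beta>\<^sub>0" for k
    using pow_\<beta>0 fin_ord_less_omega[of k] by (meson less_imp_le omega_pow_le_iff order_trans)
  let ?S = "below \<beta>\<^sub>0"
  define c where "c = below_card \<beta>"
  define c0 where "c0 = level_card weight ?S"
  define f where "f = level_card weight {A \<in> below \<beta>. ord_of_mset A \<Turnstile> \<psi>}"
  define Q where "Q = {A \<in> ?S. ord_of_mset A \<Turnstile> \<psi>}"
  define f0 where "f0 = level_card weight Q"
  define low where "low = below_card (fin_pow M)"
  have closed: "add_mset (fin_ord i) A \<in> ?S \<longleftrightarrow> A \<in> ?S" if "i < M" for i A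
    unfolding \<beta>\<^sub>0_def H_def using that by (intro below_high_part_add_mset) simp
  have closed_S: "closed_multisets weight ?S fin_ord M"
    using \<beta>0_Gamma0 pow_fin _ closed by (rule closed_multisets_below) (simp add: M_def)
  have low: "(\<lambda>n. real (low n) / real (c0 n)) \<longlonglongrightarrow> 0"
    unfolding low_def c0_def by (rule low_ordinals_negligible[OF pow_fin \<beta>0_Gamma0])
  define E where "E = {A \<in> below \<beta>. \<beta>\<^sub>0 \<le> ord_of_mset A}"
  have E_low: "level_card weight E n \<le> low n" for n
    unfolding low_def
  proof (rule card_inj_on_le)
    \<comment> \<open>The part H common to all members of E is traded for equally heavy copies of
      the exponent 0, whose weight is 1. This maps E injectively below omega^M and preserves
      weights.\<close>
    let ?g = "\<lambda>A. (A - H) + replicate_mset (wsum weight H) 0"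
    have E_form: "\<exists>B. A = H + B \<and> ord_of_mset B < fin_pow M" if "A \<in> E" for A
    proof -
      have A: "\<beta>\<^sub>0 \<le> ord_of_mset A" "ord_of_mset A < \<beta>" using that by (simp_all add: E_def below_def)
      from A(1) obtain s where s: "ord_of_mset A = \<beta>\<^sub>0 + s" by (rule ordinal_le_imp_diff)
      obtain B where B: "ord_of_mset B = s" by (rule ex_ord_of_mset)
      have "\<beta>\<^sub>0 + s < \<beta>\<^sub>0 + ord_of_mset (low_part (fin_ord M) A\<^sub>\<beta>)"
        using A(2) s \<beta>_split by simp
      then have sB: "ord_of_mset B < fin_pow M"
        using ord_of_mset_low_part[of "fin_ord M" A\<^sub>\<beta>] B by simp
      then have "\<And>b. b \<in># B \<Longrightarrow> b < fin_ord M"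
        unfolding ord_of_mset_less_omega_pow_iff by blast
      then have "ord_of_mset (H + B) = \<beta>\<^sub>0 + s"
        unfolding H_def \<beta>\<^sub>0_def B[symmetric] by (rule ord_of_mset_high_add)
      then have "A = H + B" using s by (metis ord_of_mset_eq_iff)
      then show ?thesis using sB by blast
    qed
    have w0: "weight 0 = 1"
      using closed_multisets.weight_z[OF closed_S, of 0] by (simp add: M_def)
    show "inj_on ?g (level weight E n)"
    proof (rule inj_onI)
      fix A B assume "A \<in> level weight E n" "B \<in> level weight E n" "?g A = ?g B"
      then show "A = B" using E_form[of A] E_form[of B] by (auto simp: level_def)
    qed
    show "?g ` level weight E n \<subseteq> level weight (below (fin_pow M)) n"
    proof
      fix C assume "C \<in> ?g ` level weight E n"
      then obtain A where A: "A \<in> E" "wsum weight A = n" "C = ?g A" by (auto simp: level_def)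
      obtain B where B: "A = H + B" "ord_of_mset B < fin_pow M" using E_form[OF A(1)] by blast
      have "0 < fin_ord M" using fin_ord_less_iff[of 0 M] by (simp add: M_def)
      then have "C \<in> below (fin_pow M)"
        using A(3) B by (auto simp: below_def ord_of_mset_less_omega_pow_iff in_replicate_mset split: if_splits)
      then show "C \<in> level weight (below (fin_pow M)) n"
        using A B w0 by (simp add: level_def)
    qed
    show "finite (level weight (below (fin_pow M)) n)"
      using pow_fin[of M] \<beta>0_Gamma0 by (intro finite_level_below) simp
  qed
  have below_split: "below \<beta> = ?S \<union> E" "?S \<inter> E = {}"
    using \<beta>0_le by (auto simp: E_def below_def)
  have fin_\<beta>: "finite (level weight (below \<beta>) n)" for n by (rule finite_level_below[OF assms(2)])
  have c_diff: "\<bar>real (c n) - real (c0 n)\<bar> \<le> real (low n)"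
    and f_diff: "\<bar>real (f n) - real (f0 n)\<bar> \<le> real (low n)" for n
  proof -
    have "\<bar>real (level_card weight {A \<in> below \<beta>. P A} n) - real (level_card weight {A \<in> ?S. P A} n)\<bar> \<le> real (low n)" for P
    proof -
      have "level weight {A \<in> below \<beta>. P A} n = level weight {A \<in> ?S. P A} n \<union> level weight {A \<in> E. P A} n"
        using below_split(1) by (auto simp: level_def)
      moreover have "finite (level weight {A \<in> below \<beta>. P A} n)"
        by (rule finite_subset[OF _ fin_\<beta>[of n]]) (auto simp: level_def)
      moreover have "level weight {A \<in> ?S. P A} n \<inter> level weight {A \<in> E. P A} n = {}"
        using below_split(2) by (auto simp: level_def)
      ultimately have "level_card weight {A \<in> below \<beta>. P A} n =
          level_card weight {A \<in> ?S. P A} n + level_card weight {A \<in> E. P A} n"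
        by (metis card_Un_disjoint finite_Un)
      moreover have "level_card weight {A \<in> E. P A} n \<le> level_card weight E n"
        by (rule card_mono[OF finite_subset[OF _ fin_\<beta>[of n]]]) (auto simp: level_def E_def)
      ultimately show ?thesis using E_low[of n] by simp
    qed
    from this[of "\<lambda>_. True"] this[of "\<lambda>A. ord_of_mset A \<Turnstile> \<psi>"]
    show "\<bar>real (c n) - real (c0 n)\<bar> \<le> real (low n)" "\<bar>real (f n) - real (f0 n)\<bar> \<le> real (low n)"
      by (simp_all add: c_def c0_def f_def f0_def Q_def)
  qed
  have c0_pos: "0 < c0 n" for n
    unfolding c0_def by (rule closed_multisets.c_pos[OF closed_S])
  have close: "(\<lambda>n. real (a n) / real (c0 n) - real (b n) / real (c0 n)) \<longlonglongrightarrow> 0"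
    if "\<And>n. \<bar>real (a n) - real (b n)\<bar> \<le> real (low n)" for a b :: "nat \<Rightarrow> nat"
  proof (rule tendsto_null_comparison[OF _ low])
    show "\<bar>real (a n) / real (c0 n) - real (b n) / real (c0 n)\<bar> \<le> real (low n) / real (c0 n)" for n
      using divide_right_mono[OF that[of n], of "real (c0 n)"]
      by (simp add: diff_divide_distrib[symmetric] abs_divide)
  qed
  have c_c0: "(\<lambda>n. real (c n) / real (c0 n)) \<longlonglongrightarrow> 1"
  proof -
    have "(\<lambda>n. real (c n) / real (c0 n) - 1) \<longlonglongrightarrow> 0"
      using close[OF c_diff] c0_pos by (simp add: less_imp_neq[symmetric])
    from tendsto_add[OF this tendsto_const[of 1]] show ?thesis by simp
  qed
  have c_pos: "0 < c n" for n
  proof -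
    have "c0 n \<le> c n"
      unfolding c_def c0_def using fin_\<beta>[of n] below_split(1) by (intro card_mono) (auto simp: level_def)
    then show ?thesis using c0_pos[of n] by simp
  qed
  \<comment> \<open>The ordinals below omega^m, about which \<open>mso\<close> says nothing.\<close>
  define X where "X = {A \<in> ?S. \<forall>e\<in>#A. e < fin_ord m}"
  have X_low: "X \<subseteq> below (fin_pow M)"
  proof
    fix A assume "A \<in> X"
    moreover have "fin_ord m \<le> fin_ord M" unfolding fin_ord_le_iff by (simp add: M_def)
    ultimately show "A \<in> below (fin_pow M)"
      unfolding X_def below_def mem_Collect_eq ord_of_mset_less_omega_pow_iff by (auto intro: less_le_trans)
  qed
  have models: "ord_of_mset A \<Turnstile> \<psi> \<longleftrightarrow> ord_of_mset B \<Turnstile> \<psi>"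
    if "A \<in> ?S - X" "B \<in> ?S - X" "counts_agree m K q A B" for A B
  proof (rule ord_equiv_models[OF mso assms(4)])
    show "\<exists>e\<in>#A. fin_ord m \<le> e" "\<exists>e\<in>#B. fin_ord m \<le> e"
      using that(1,2) by (auto simp: X_def not_less)
  qed (rule that(3))
  have "convergent (\<lambda>n. real (f0 n) / real (c0 n))"
  proof (cases "epsilon0 \<le> \<beta>")
    case False
    then have no_fp: "omega_pow e \<noteq> e" if "e \<le> \<beta>\<^sub>0" for e
      using that \<beta>0_le by (intro epsilon0_no_fixed_point) simp
    interpret counted_multisets weight ?S fin_ord M 1
      using \<beta>0_Gamma0 pow_fin closed slow_below[OF \<beta>0_Gamma0 no_fp]
      by (intro counted_multisets_below_slow) (auto simp: M_def)
    have "has_dens (below (fin_pow M)) 0"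
      using low below_mono[OF pow_fin[of M]] by (simp add: has_dens_def low_def c0_def)
    then have X: "has_dens X 0" using X_low by (rule null_subset)
    show ?thesis
      unfolding f0_def c0_def
    proof (rule convergent_if_ratio_1[OF refl _ _ X q])
      show "2 * m < M" by (simp add: M_def)
      show "Q \<subseteq> ?S" by (auto simp: Q_def)
      show "A \<in> Q \<longleftrightarrow> B \<in> Q" if "A \<in> ?S - X" "B \<in> ?S - X"
        "\<And>i. i < m \<Longrightarrow> K \<le> count A (fin_ord i) \<and> K \<le> count B (fin_ord i) \<and>
          count A (fin_ord i) mod q = count B (fin_ord i) mod q" for A B
        using models[OF that(1,2)] that by (simp add: Q_def counts_agree_def)
    qed
  next
    case True
    then obtain \<rho> where \<rho>: "\<rho> < 1"
      "(\<lambda>n. real (norm_count \<beta> n) / real (norm_count \<beta> (n + 1))) \<longlonglongrightarrow> \<rho>"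
      using assms(3) by blast
    have "(\<lambda>n. real (c n) / real (c (Suc n))) \<longlonglongrightarrow> \<rho>"
      using \<rho>(2) by (simp add: norm_count_eq[OF assms(2)] c_def)
    \<comment> \<open>The assumed ratio concerns beta; as c / c0 tends to 1, it passes to
      beta_0.\<close>
    from tendsto_divide[OF tendsto_mult[OF this LIMSEQ_Suc[OF c_c0]] c_c0]
    have "(\<lambda>n. real (c n) / real (c (Suc n)) * (real (c (Suc n)) / real (c0 (Suc n))) / (real (c n) / real (c0 n))) \<longlonglongrightarrow> \<rho>"
      by simp
    moreover have "real (c n) / real (c (Suc n)) * (real (c (Suc n)) / real (c0 (Suc n))) / (real (c n) / real (c0 n)) =
        real (c0 n) / real (c0 (Suc n))" for n
      using c_pos[of n] c_pos[of "Suc n"] c0_pos[of n] c0_pos[of "Suc n"] by (simp add: field_simps)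
    ultimately have ratio0: "(\<lambda>n. real (c0 n) / real (c0 (Suc n))) \<longlonglongrightarrow> \<rho>" by (simp only:)
    interpret counted_multisets weight ?S fin_ord M \<rho>
      using closed_S ratio0 unfolding c0_def
      by (intro counted_multisets.intro counted_multisets_axioms.intro)
    have "has_dens (below (fin_pow M)) 0"
      using low below_mono[OF pow_fin[of M]] by (simp add: has_dens_def low_def c0_def)
    then have X: "has_dens X 0" using X_low by (rule null_subset)
    show ?thesis
      unfolding f0_def c0_def
    proof (rule convergent_if_ratio_less_1[OF \<rho>(1) _ _ X, of m])
      show "m \<le> M" unfolding M_def by linarith
      show "Q \<subseteq> ?S" by (auto simp: Q_def)
      show "A \<in> Q \<longleftrightarrow> B \<in> Q" if "A \<in> ?S - X" "B \<in> ?S - X"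
        "\<And>i. i < m \<Longrightarrow> count A (fin_ord i) = count B (fin_ord i)" for A B
        using models[OF that(1,2)] that by (simp add: Q_def counts_agree_def)
    qed
  qed
  then obtain L where "(\<lambda>n. real (f0 n) / real (c0 n)) \<longlonglongrightarrow> L" by (auto simp: convergent_def)
  from tendsto_divide[OF tendsto_add[OF close[OF f_diff] this] c_c0]
  have "(\<lambda>n. (real (f n) / real (c0 n)) / (real (c n) / real (c0 n))) \<longlonglongrightarrow> L" by simp
  moreover have "(real (f n) / real (c0 n)) / (real (c n) / real (c0 n)) = real (f n) / real (c n)" for n
    using c0_pos[of n] by simp
  ultimately have "(\<lambda>n. real (f n) / real (c n)) \<longlonglongrightarrow> L" by (simp only:)
  moreover have "card {\<alpha>. \<alpha> < \<beta> \<and> \<alpha> \<Turnstile> \<psi> \<and> norm_ord \<alpha> = n} = f n" for n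
    unfolding f_def by (rule card_norm_ord_eq[OF assms(2)])
  moreover have "card {\<alpha>. \<alpha> < \<beta> \<and> norm_ord \<alpha> = n} = c n" for n
    using norm_count_eq[OF assms(2)] by (simp add: c_def norm_count_def)
  ultimately show ?thesis by (auto simp: convergent_def)
qed

end
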